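(* Let $\{\mu_i\}_{i=1}^k$ and $\{r_i\}_{i=1}^{k'}$ be monotonically decreasing (non-increasing) sequences of strictly positive numbers such that $\sum_{i=1}^k\mu_i=\sum_{i=1}^{k'}r_i=1$. Let $n\ge k$ and $n'\ge k'$, and define unital $q$-positive maps $\phi:M_n(\mathbb{C})\to M_n(\mathbb{C})$ and $\psi:M_{n'}(\mathbb{C})\to M_{n'}(\mathbb{C})$ by $$\phi(A)=\Big(\sum_{i=1}^k\mu_ia_{ii}\Big)I_n,\qquad \psi(D)=\Big(\sum_{i=1}^{k'}r_id_{ii}\Big)I_{n'}$$ for all $A=(a_{ij})\in M_n(\mathbb{C})$ and $D=(d_{ij})\in M_{n'}(\mathbb{C})$. Let $\Omega\in M_k(\mathbb{C})$ be the trace density matrix of the faithful state $\rho\in M_k(\mathbb{C})^*$ defined by $\rho(A)=\sum_{i=1}^k\mu_ia_{ii}$. If there is a nonzero $q$-corner from $\phi$ to $\psi$, then $k=k'$ and $\mu_i=r_i$ for all $i=1,\ldots,k$. In that case (i.e. when $k=k'$ and $\mu_i=r_i$ for all $i$), a linear map $\gamma:M_{n,n'}(\mathbb{C})\to M_{n,n'}(\mathbb{C})$ is a $q$-corner from $\phi$ to $\psi$ if and only if for some unitary $X\in M_k(\mathbb{C})$ that commutes with $\Omega$, some contraction $E\in M_{n-k,n'-k}(\mathbb{C})$, and some $\lambda\in\mathbb{C}$ with $|\lambda|^2\le\operatorname{Re}(\lambda)$, we have $$\gamma\begin{pmatrix}B_{k,k}&W_{k,n'-k}\\Q_{n-k,k}&Y_{n-k,n'-k}\end{pmatrix}=\lambda\,\operatorname{tr}(X^*B_{k,k}\Omega)\begin{pmatrix}X&0_{k,n'-k}\\0_{n-k,k}&E\end{pmatrix}$$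 for all $\begin{pmatrix}B_{k,k}&W_{k,n'-k}\\Q_{n-k,k}&Y_{n-k,n'-k}\end{pmatrix}\in M_{n,n'}(\mathbb{C})$.
   Context: $M_{p,q}(\mathbb{C})$ is the space of $p\times q$ complex matrices; subscripts $p,q$ on a block indicate its size; blocks with a zero dimension are absent. A contraction is a matrix of operator norm at most $1$. $\operatorname{tr}$ is the usual (unnormalized) trace, and the trace density matrix of $\rho$ is the matrix $\Omega$ with $\rho(A)=\operatorname{tr}(A\Omega)$ for all $A$; here $\Omega=\operatorname{diag}(\mu_1,\ldots,\mu_k)$. A linear map $\Theta:M_m(\mathbb{C})\to M_m(\mathbb{C})$ with no negative eigenvalues is $q$-positive, written $\Theta\ge_q0$, if $\Theta(I+t\Theta)^{-1}$ is completely positive for all $t\ge0$ (with $I$ the identity map). Given $q$-positive $\phi:M_n(\mathbb{C})\to M_n(\mathbb{C})$ and $\psi:M_{n'}(\mathbb{C})\to M_{n'}(\mathbb{C})$, a linear map $\gamma:M_{n,n'}(\mathbb{C})\to M_{n,n'}(\mathbb{C})$ is a $q$-corner from $\phi$ to $\psi$ if the map $\Theta:M_{n+n'}(\mathbb{C})\to M_{n+n'}(\mathbb{C})$, $$\Theta\begin{pmatrix}A&B\\C&D\end{pmatrix}=\begin{pmatrix}\phi(A)&\gamma(B)\\\gamma^*(C)&\psi(D)\end{pmatrix}$$ ($A\in M_n(\mathbb{C})$, $B\in M_{n,n'}(\mathbb{C})$, $C\in M_{n',n}(\mathbb{C})$, $D\in M_{n'}(\mathbb{C})$) satisfies $\Theta\ge_q0$,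 where $\gamma^*(C)=(\gamma(C^* ))^*$. *)

theory Defs
  imports "Jordan_Normal_Form.Schur_Decomposition"
begin

text \<open>
  \<open>M\<^bsub>p,q\<^esub>(\<complex>)\<close> is \<open>carrier_mat p q :: complex mat set\<close>, which also covers blocks with a zero
  dimension; rows and columns are indexed from 0. Maps between matrix spaces are
  HOL functions on \<open>complex mat\<close> that only matter on the relevant carrier. The adjoint is
  the library's \<open>mat_adjoint\<close>. The order on \<open>complex\<close> is that of
  \<open>HOL-Library.Complex_Order\<close>, so \<open>0 \<le> z\<close> says that \<open>z\<close> is real and non-negative.
\<close>

definition mat_linear :: "nat \<Rightarrow> nat \<Rightarrow> (complex mat \<Rightarrow> complex mat) \<Rightarrow> bool" where
  "mat_linear p q f \<longleftrightarrow>
     (\<forall>A \<in> carrier_mat p q. f A \<in> carrier_mat p q) \<and>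
     (\<forall>A \<in> carrier_mat p q. \<forall>B \<in> carrier_mat p q. f (A + B) = f A + f B) \<and>
     (\<forall>c. \<forall>A \<in> carrier_mat p q. f (c \<cdot>\<^sub>m A) = c \<cdot>\<^sub>m f A)"

definition mat_trace :: "complex mat \<Rightarrow> complex" where
  "mat_trace A = (\<Sum>i<dim_row A. A $$ (i, i))"

definition unitary_mat :: "nat \<Rightarrow> complex mat \<Rightarrow> bool" where
  "unitary_mat k X \<longleftrightarrow> X \<in> carrier_mat k k \<and>
     mat_adjoint X * X = 1\<^sub>m k \<and> X * mat_adjoint X = 1\<^sub>m k"

definition euclid_norm :: "complex vec \<Rightarrow> real" where
  "euclid_norm v = sqrt (\<Sum>i<dim_vec v. (cmod (v $ i))\<^sup>2)"

text \<open>The unit ball contains the zero vector, so this supremum is over a nonempty set (and is 0)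
  also when \<open>A\<close> has no rows or no columns.\<close>

definition op_norm :: "complex mat \<Rightarrow> real" where
  "op_norm A = (SUP v \<in> {v \<in> carrier_vec (dim_col A). euclid_norm v \<le> 1}. euclid_norm (A *\<^sub>v v))"

definition contraction_mat :: "nat \<Rightarrow> nat \<Rightarrow> complex mat \<Rightarrow> bool" where
  "contraction_mat p q E \<longleftrightarrow> E \<in> carrier_mat p q \<and> op_norm E \<le> 1"

definition psd_mat :: "nat \<Rightarrow> complex mat \<Rightarrow> bool" where
  "psd_mat n A \<longleftrightarrow> A \<in> carrier_mat n n \<and> (\<forall>v \<in> carrier_vec n. 0 \<le> (A *\<^sub>v v) \<bullet>c v)"

text \<open>\<open>mat_block n A a b\<close> is the \<open>(a,b)\<close> block of size \<open>n\<close> of a matrix in \<open>M\<^sub>m(M\<^sub>n(\<complex>)) = M\<^bsub>mn\<^esub>(\<complex>)\<close>,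
  and \<open>ampliation m n f\<close> is \<open>id \<otimes> f\<close> on \<open>M\<^sub>m(M\<^sub>n(\<complex>))\<close>, i.e. \<open>f\<close> applied to each block.\<close>

definition mat_block :: "nat \<Rightarrow> complex mat \<Rightarrow> nat \<Rightarrow> nat \<Rightarrow> complex mat" where
  "mat_block n A a b = mat n n (\<lambda>(i, j). A $$ (a * n + i, b * n + j))"

definition ampliation :: "nat \<Rightarrow> nat \<Rightarrow> (complex mat \<Rightarrow> complex mat) \<Rightarrow> complex mat \<Rightarrow> complex mat" where
  "ampliation m n f A =
     mat (m * n) (m * n) (\<lambda>(p, q). f (mat_block n A (p div n) (q div n)) $$ (p mod n, q mod n))"

definition completely_positive :: "nat \<Rightarrow> (complex mat \<Rightarrow> complex mat) \<Rightarrow> bool" where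
  "completely_positive n f \<longleftrightarrow> mat_linear n n f \<and>
     (\<forall>m A. psd_mat (m * n) A \<longrightarrow> psd_mat (m * n) (ampliation m n f A))"

definition map_eigenvalue :: "nat \<Rightarrow> (complex mat \<Rightarrow> complex mat) \<Rightarrow> complex \<Rightarrow> bool" where
  "map_eigenvalue n f c \<longleftrightarrow> (\<exists>A \<in> carrier_mat n n. A \<noteq> 0\<^sub>m n n \<and> f A = c \<cdot>\<^sub>m A)"

text \<open>In the presence of the first two conditions, \<open>I + t\<Theta>\<close> is a bijection of \<open>M\<^sub>n(\<complex>)\<close> for every
  \<open>t \<ge> 0\<close>, so that \<open>inv_into\<close> is its genuine inverse.\<close>

definition q_positive :: "nat \<Rightarrow> (complex mat \<Rightarrow> complex mat) \<Rightarrow> bool" where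
  "q_positive n \<Theta> \<longleftrightarrow> mat_linear n n \<Theta> \<and>
     (\<forall>c::real. c < 0 \<longrightarrow> \<not> map_eigenvalue n \<Theta> (complex_of_real c)) \<and>
     (\<forall>t::real. t \<ge> 0 \<longrightarrow>
        completely_positive n
          (\<Theta> \<circ> inv_into (carrier_mat n n) (\<lambda>A. A + complex_of_real t \<cdot>\<^sub>m \<Theta> A)))"

definition unital :: "nat \<Rightarrow> (complex mat \<Rightarrow> complex mat) \<Rightarrow> bool" where
  "unital n f \<longleftrightarrow> f (1\<^sub>m n) = 1\<^sub>m n"

definition star_map :: "(complex mat \<Rightarrow> complex mat) \<Rightarrow> complex mat \<Rightarrow> complex mat" where
  "star_map \<gamma> C = mat_adjoint (\<gamma> (mat_adjoint C))"

definition corner_map ::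
  "nat \<Rightarrow> nat \<Rightarrow> (complex mat \<Rightarrow> complex mat) \<Rightarrow> (complex mat \<Rightarrow> complex mat) \<Rightarrow>
   (complex mat \<Rightarrow> complex mat) \<Rightarrow> complex mat \<Rightarrow> complex mat" where
  "corner_map n n' \<phi> \<psi> \<gamma> M =
     (case split_block M n n of (A, B, C, D) \<Rightarrow>
        four_block_mat (\<phi> A) (\<gamma> B) (star_map \<gamma> C) (\<psi> D))"

definition q_corner ::
  "nat \<Rightarrow> nat \<Rightarrow> (complex mat \<Rightarrow> complex mat) \<Rightarrow> (complex mat \<Rightarrow> complex mat) \<Rightarrow>
   (complex mat \<Rightarrow> complex mat) \<Rightarrow> bool" where
  "q_corner n n' \<phi> \<psi> \<gamma> \<longleftrightarrow>
     mat_linear n n' \<gamma> \<and> q_positive (n + n') (corner_map n n' \<phi> \<psi> \<gamma>)"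

definition faithful_state :: "nat \<Rightarrow> (complex mat \<Rightarrow> complex) \<Rightarrow> bool" where
  "faithful_state k \<rho> \<longleftrightarrow>
     (\<forall>A \<in> carrier_mat k k. \<forall>B \<in> carrier_mat k k. \<rho> (A + B) = \<rho> A + \<rho> B) \<and>
     (\<forall>c. \<forall>A \<in> carrier_mat k k. \<rho> (c \<cdot>\<^sub>m A) = c * \<rho> A) \<and>
     \<rho> (1\<^sub>m k) = 1 \<and>
     (\<forall>A \<in> carrier_mat k k. 0 \<le> \<rho> (mat_adjoint A * A)) \<and>
     (\<forall>A \<in> carrier_mat k k. \<rho> (mat_adjoint A * A) = 0 \<longrightarrow> A = 0\<^sub>m k k)"

definition trace_density :: "nat \<Rightarrow> (complex mat \<Rightarrow> complex) \<Rightarrow> complex mat \<Rightarrow> bool" where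
  "trace_density k \<rho> \<Omega> \<longleftrightarrow> \<Omega> \<in> carrier_mat k k \<and>
     (\<forall>A \<in> carrier_mat k k. \<rho> A = mat_trace (A * \<Omega>))"

end

theory Submission
  imports Defs
begin

text \<open>
  Necessity: applying the resolvent of the corner map to a positive block matrix with off-diagonal
  block \<open>B + t \<gamma>(B)\<close>, chosen so that the preimage is explicit, bounds
  \<open>(1 + t)\<^sup>2 |\<langle>v, \<gamma>(B) w\<rangle>|\<^sup>2\<close> by the \<open>\<mu>\<close>-weighted (and, symmetrically, the
  \<open>r\<close>-weighted) square norm of the \<open>k \<times> k'\<close> corner of \<open>B + t \<gamma>(B)\<close>. The \<open>t\<^sup>2\<close> coefficient says
  that every \<open>C\<close> in the range of \<open>\<gamma>\<close> has operator norm at most the weighted norm of its corner, an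
  average of squared row norms; hence all these rows are extremal and \<open>C\<close> is a multiple of some
  \<open>X \<oplus> E\<close> with \<open>X\<close> unitary. Polarization makes the range one-dimensional, and the coefficient of
  \<open>t\<close> then determines \<open>\<gamma>\<close> and yields \<open>|\<lambda>|\<^sup>2 \<le> Re \<lambda>\<close>. Comparing the two weights gives
  \<open>X\<^bsub>ip\<^esub> (\<mu>\<^sub>i - r\<^sub>p) = 0\<close>, and counting with the doubly stochastic matrix \<open>|X\<^bsub>ip\<^esub>|\<^sup>2\<close> gives
  \<open>\<mu> = r\<close>.

  Sufficiency: the resolvents of the corner map have the same shape with the parameter \<open>\<lambda>\<close> replaced
  by \<open>\<lambda> / (1 + t \<lambda>)\<close>, and \<open>|\<lambda>|\<^sup>2 \<le> Re \<lambda>\<close> is what makes them completely positive; Kraus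
  operators come from the columns of \<open>X\<close> and a Cholesky factor of \<open>I - |c|\<^sup>2 (X \<oplus> E)(X \<oplus> E)\<^sup>*\<close>,
  where \<open>c = (1 + t) \<lambda> / (1 + t \<lambda>)\<close>.
\<close>

section \<open>Bilinear forms and the rows of an extremal matrix\<close>

text \<open>Because \<phi> and \<psi> return scalar matrices, M + t \<Theta>(M) = S can be solved
  for the diagonal blocks of M once the off-diagonal block of M is fixed to be B, and \<Theta>(M)
  gets the scalar diagonal blocks of S's two states divided by 1 + t. This is the origin of the
  factor (1 + t)^2. There are two natural positive S with the required off-diagonal block, and they
  account for the two weights. Two obstacles shape the argument. The states need not be faithful on
  the full blocks, so the weighted norms at first run over whole rows or columns and must be cut
  down to the corner. And the coefficient of t can be read off only where that of t^2 vanishes, so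
  the extremal vectors have to be known before \<gamma> can be determined. The condition on
  \<lambda> is |\<lambda>| (1 + t) \<le> |1 + t \<lambda>| for all t \<ge> 0: squared, it reads
  |\<lambda>|^2 (1 + 2 t) \<le> 1 + 2 t Re \<lambda>, and large t leaves |\<lambda>|^2 \<le> Re
  \<lambda>, which in turn implies |\<lambda>| \<le> 1.\<close>

definition nsq :: "nat \<Rightarrow> (nat \<Rightarrow> complex) \<Rightarrow> real" where
  "nsq n v = (\<Sum>i<n. (cmod (v i))\<^sup>2)"

text \<open>No conjugation in the first argument, so that transposing \<open>C\<close> just swaps \<open>v\<close> and \<open>w\<close>.\<close>

definition bil :: "nat \<Rightarrow> nat \<Rightarrow> (nat \<Rightarrow> nat \<Rightarrow> complex) \<Rightarrow> (nat \<Rightarrow> complex) \<Rightarrow> (nat \<Rightarrow> complex) \<Rightarrow> complex" where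
  "bil n m C v w = (\<Sum>i<n. \<Sum>p<m. v i * C i p * w p)"

lemma nsq_nonneg: "0 \<le> nsq n v"
  unfolding nsq_def by (intro sum_nonneg) auto

lemma nsq_delta: "i < n \<Longrightarrow> nsq n (\<lambda>l. if l = i then 1 else 0) = 1"
  unfolding nsq_def by (simp add: if_distrib[of cmod] if_distrib[of "\<lambda>x. x\<^sup>2"] cong: if_cong)

lemma sum_mult_delta:
  fixes f :: "nat \<Rightarrow> complex"
  assumes "i < n"
  shows "(\<Sum>l<n. (if l = i then c else 0) * f l) = c * f i"
    "(\<Sum>l<n. f l * (if l = i then c else 0)) = f i * c"
  using assms by (simp_all add: if_distrib[of "\<lambda>x. x * _"] if_distrib[of "\<lambda>x. _ * x"] cong: if_cong)

lemma bil_alt: "bil n m C v w = (\<Sum>p<m. (\<Sum>i<n. v i * C i p) * w p)"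
  unfolding bil_def by (subst sum.swap) (simp add: sum_distrib_right)

lemma bil_alt2: "bil n m C v w = (\<Sum>i<n. v i * (\<Sum>p<m. C i p * w p))"
  unfolding bil_def by (simp add: sum_distrib_left mult.assoc)

lemma bil_transpose: "bil m n (\<lambda>p i. C i p) w v = bil n m C v w"
  unfolding bil_def by (subst sum.swap) (simp add: mult.assoc mult.commute mult.left_commute)

lemma sum_mult_cnj_self: "(\<Sum>p<m. f p * cnj (f p)) = complex_of_real (nsq m f)"
  unfolding nsq_def of_real_sum by (simp only: complex_norm_square)

text \<open>Duality: for u = v C, taking w to be the conjugate of u gives \<open>bil\<close> the
  value |u|^2. The hypothesis becomes |u|^4 \<le> s |v|^2 |u|^2, and one factor |u|^2
  cancels.\<close>

lemma bil_bound_row: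
  assumes bd: "\<And>v w. (cmod (bil n m C v w))\<^sup>2 \<le> s * nsq n v * nsq m w" and s: "0 \<le> s"
  shows "nsq m (\<lambda>p. \<Sum>i<n. v i * C i p) \<le> s * nsq n v"
proof -
  let ?u = "\<lambda>p. \<Sum>i<n. v i * C i p" and ?U = "nsq m (\<lambda>p. \<Sum>i<n. v i * C i p)"
  have "bil n m C v (\<lambda>p. cnj (?u p)) = complex_of_real ?U"
    unfolding bil_alt by (rule sum_mult_cnj_self)
  moreover have "nsq m (\<lambda>p. cnj (?u p)) = ?U" unfolding nsq_def complex_mod_cnj ..
  ultimately have "?U\<^sup>2 \<le> s * nsq n v * ?U"
    using bd[of v "\<lambda>p. cnj (?u p)"] nsq_nonneg[of m ?u] by simp
  hence "?U * ?U \<le> (s * nsq n v) * ?U" by (simp add: power2_eq_square)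
  thus ?thesis
    using nsq_nonneg[of m ?u] mult_nonneg_nonneg[OF s nsq_nonneg[of n v]]
    by (cases "?U = 0") (auto simp: mult_le_cancel_right)
qed

section \<open>Polynomial inequalities and Cauchy-Schwarz\<close>

lemma affine_nonneg_slope:
  fixes c0 c1 :: real
  assumes "\<And>t. t \<ge> 0 \<Longrightarrow> 0 \<le> c0 + c1 * t"
  shows "0 \<le> c1"
proof (rule ccontr)
  assume "\<not> 0 \<le> c1"
  hence neg: "c1 < 0" by simp
  \<comment> \<open>At this t the affine function is c0 - |c0| - 1, which is negative.\<close>
  define t where "t = (\<bar>c0\<bar> + 1) / (- c1)"
  have "t \<ge> 0" "c1 * t = - (\<bar>c0\<bar> + 1)" using neg by (auto simp: t_def field_simps)
  thus False using assms[of t] by simp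
qed

text \<open>Reduces to the affine case: for t \<ge> 1 division by t leaves at most |c0| + |c1| + c2
  t, and for t < 1 the extra summand |c2| absorbs c2 t.\<close>

lemma quadratic_nonneg_lead:
  fixes c0 c1 c2 :: real
  assumes h: "\<And>t. t \<ge> 0 \<Longrightarrow> 0 \<le> c0 + c1 * t + c2 * t\<^sup>2"
  shows "0 \<le> c2"
proof (rule affine_nonneg_slope)
  fix t :: real
  assume t: "t \<ge> 0"
  show "0 \<le> (\<bar>c0\<bar> + \<bar>c1\<bar> + \<bar>c2\<bar>) + c2 * t"
  proof (cases "t \<ge> 1")
    case True
    have "0 \<le> c0 + c1 * t + c2 * t\<^sup>2" using h t by simp
    also have "\<dots> \<le> \<bar>c0\<bar> * t + \<bar>c1\<bar> * t + c2 * t\<^sup>2"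
    proof -
      have "c0 \<le> \<bar>c0\<bar> * t" using True mult_left_mono[of 1 t "\<bar>c0\<bar>"] by simp
      moreover have "c1 * t \<le> \<bar>c1\<bar> * t" using t by (intro mult_right_mono) auto
      ultimately show ?thesis by simp
    qed
    also have "\<dots> = t * (\<bar>c0\<bar> + \<bar>c1\<bar> + c2 * t)"
      by (simp add: algebra_simps power2_eq_square)
    finally have "0 \<le> \<bar>c0\<bar> + \<bar>c1\<bar> + c2 * t" using True by (simp add: zero_le_mult_iff)
    thus ?thesis by simp
  next
    case False
    have "- (\<bar>c2\<bar>) \<le> c2 * t"
    proof -
      have "\<bar>c2 * t\<bar> \<le> \<bar>c2\<bar> * 1" unfolding abs_mult using False t by (intro mult_left_mono) auto
      thus ?thesis by simp
    qed
    thus ?thesis by simp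
  qed
qed

lemma quadratic_nonneg_discriminant:
  fixes a q d :: real
  assumes h: "\<And>\<tau>. 0 \<le> a * \<tau>\<^sup>2 - 2 * q * \<tau> + d" and a: "0 \<le> a"
  shows "q\<^sup>2 \<le> a * d"
proof (cases "a = 0")
  case True
  have "q = 0"
  proof (rule ccontr)
    assume "q \<noteq> 0"
    \<comment> \<open>With a = 0 the form is d - 2 q \<tau>, which equals -1 at this \<tau>.\<close>
    thus False using h[of "(d + 1) / (2 * q)"] True by (simp add: field_simps)
  qed
  thus ?thesis using True by simp
next
  case False
  have "a * (q / a)\<^sup>2 - 2 * q * (q / a) + d = d - q\<^sup>2 / a"
    using False by (simp add: field_simps power2_eq_square)
  hence "q\<^sup>2 / a \<le> d" using h[of "q / a"] by simp
  thus ?thesis using False a by (simp add: field_simps)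
qed

lemma Cauchy_Schwarz_sum:
  fixes x y :: "nat \<Rightarrow> real"
  shows "(\<Sum>i<n. x i * y i)\<^sup>2 \<le> (\<Sum>i<n. (x i)\<^sup>2) * (\<Sum>i<n. (y i)\<^sup>2)"
proof (rule quadratic_nonneg_discriminant)
  fix \<tau> :: real
  have "0 \<le> (\<Sum>i<n. (\<tau> * x i - y i)\<^sup>2)" by (intro sum_nonneg) auto
  also have "\<dots> = (\<Sum>i<n. (x i)\<^sup>2 * \<tau>\<^sup>2 - 2 * (x i * y i) * \<tau> + (y i)\<^sup>2)"
    by (intro sum.cong) (auto simp: power2_eq_square algebra_simps)
  also have "\<dots> = (\<Sum>i<n. (x i)\<^sup>2) * \<tau>\<^sup>2 - 2 * (\<Sum>i<n. x i * y i) * \<tau> + (\<Sum>i<n. (y i)\<^sup>2)"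
    by (simp add: sum.distrib sum_subtractf sum_distrib_right sum_distrib_left)
  finally show "0 \<le> (\<Sum>i<n. (x i)\<^sup>2) * \<tau>\<^sup>2 - 2 * (\<Sum>i<n. x i * y i) * \<tau> + (\<Sum>i<n. (y i)\<^sup>2)" .
qed (intro sum_nonneg, auto)

lemma cauchy_schwarz_nsq: "(cmod (\<Sum>i<n. v i * w i))\<^sup>2 \<le> nsq n v * nsq n w"
proof -
  have "cmod (\<Sum>i<n. v i * w i) \<le> (\<Sum>i<n. cmod (v i) * cmod (w i))"
    by (rule order_trans[OF norm_sum]) (simp add: norm_mult)
  hence "(cmod (\<Sum>i<n. v i * w i))\<^sup>2 \<le> (\<Sum>i<n. cmod (v i) * cmod (w i))\<^sup>2"
    by (rule power_mono) simp
  also have "\<dots> \<le> nsq n v * nsq n w"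
    unfolding nsq_def by (rule Cauchy_Schwarz_sum)
  finally show ?thesis .
qed

text \<open>Cauchy-Schwarz against v. Followed by \<open>bil_bound_row\<close>, it carries a norm
  bound for C acting on columns over to C acting on rows.\<close>

lemma bil_bound_of_col:
  assumes "\<And>w. nsq n (\<lambda>i. \<Sum>p<m. C i p * w p) \<le> s * nsq m w"
  shows "(cmod (bil n m C v w))\<^sup>2 \<le> s * nsq n v * nsq m w"
proof -
  have "(cmod (bil n m C v w))\<^sup>2 \<le> nsq n v * nsq n (\<lambda>i. \<Sum>p<m. C i p * w p)"
    unfolding bil_alt2 by (rule cauchy_schwarz_nsq)
  also have "\<dots> \<le> nsq n v * (s * nsq m w)"
    by (intro mult_left_mono assms nsq_nonneg)
  finally show ?thesis by (simp add: ac_simps)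
qed

lemma cnj_mult_self_nonpos: "Re (cnj z * z) \<le> 0 \<Longrightarrow> z = 0"
  by (simp add: complex_eq_iff sum_squares_le_zero_iff)

lemma cmod_add_sq:
  "(cmod (x + y))\<^sup>2 = (cmod x)\<^sup>2 + 2 * Re (x * cnj y) + (cmod y)\<^sup>2"
  unfolding cmod_power2 by (simp add: algebra_simps power2_eq_square)

text \<open>Serves two purposes: a real z = t yields the polynomial in the resolvent parameter, and
  z equal to the inner product of f and g detects orthogonality.\<close>

lemma nsq_combination:
  "nsq m (\<lambda>p. f p + z * g p)
     = nsq m f + 2 * Re (cnj z * (\<Sum>p<m. f p * cnj (g p))) + (cmod z)\<^sup>2 * nsq m g"
proof -
  have "Re (cnj z * (\<Sum>p<m. f p * cnj (g p))) = (\<Sum>p<m. Re (f p * cnj (z * g p)))"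
    unfolding sum_distrib_left Re_sum by (intro sum.cong) (auto simp: algebra_simps)
  thus ?thesis
    unfolding nsq_def cmod_add_sq
    by (simp add: sum.distrib sum_distrib_left norm_mult power_mult_distrib)
qed

text \<open>The deficits \<open>s - x i\<close> are non-negative, and their average with positive
  weights is 0.\<close>

lemma weighted_sum_eq_imp_eq:
  fixes \<mu> x :: "nat \<Rightarrow> real"
  assumes pos: "\<And>i. i < k \<Longrightarrow> \<mu> i > 0" and one: "(\<Sum>i<k. \<mu> i) = 1"
    and le: "\<And>i. i < k \<Longrightarrow> x i \<le> s" and eq: "(\<Sum>i<k. \<mu> i * x i) = s" and i: "i < k"
  shows "x i = s"
proof -
  have "(\<Sum>i<k. \<mu> i * (s - x i)) = (\<Sum>i<k. \<mu> i) * s - (\<Sum>i<k. \<mu> i * x i)"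
    by (simp add: algebra_simps sum_subtractf sum_distrib_left)
  hence "(\<Sum>i<k. \<mu> i * (s - x i)) = 0" using one eq by simp
  moreover have "\<And>i. i \<in> {..<k} \<Longrightarrow> 0 \<le> \<mu> i * (s - x i)" using pos le by (intro mult_nonneg_nonneg) (auto intro: less_imp_le)
  ultimately have "\<mu> i * (s - x i) = 0" using i by (subst (asm) sum_nonneg_eq_0_iff) auto
  thus ?thesis using pos[OF i] by simp
qed

lemma nsq_mono_dim: "k \<le> n \<Longrightarrow> nsq k v \<le> nsq n v"
  unfolding nsq_def by (intro sum_mono2) auto

lemma nsq_eq_dim_imp_zero:
  assumes "k \<le> n" "nsq k v = nsq n v" "k \<le> i" "i < n"
  shows "v i = 0"
proof -
  have "nsq n v = nsq k v + (\<Sum>i\<in>{k..<n}. (cmod (v i))\<^sup>2)"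
    unfolding nsq_def using assms(1) by (subst sum.union_disjoint[symmetric]) (auto intro!: sum.cong)
  hence "(\<Sum>i\<in>{k..<n}. (cmod (v i))\<^sup>2) = 0" using assms by simp
  thus ?thesis using assms by (subst (asm) sum_nonneg_eq_0_iff) auto
qed

text \<open>As a bound for the squared operator norm, s dominates the square norm of every full row
  (test with a basis vector). But s is also the weighted average of the square norms of the first k
  rows cut off at k'. So each cut-off row already attains s, which leaves nothing for its
  tail.\<close>

lemma row_structure:
  fixes \<mu> :: "nat \<Rightarrow> real"
  assumes pos: "\<And>i. i < k \<Longrightarrow> \<mu> i > 0" and one: "(\<Sum>i<k. \<mu> i) = 1"
    and kn: "k \<le> n" and km: "k' \<le> m"
    and bd: "\<And>v w. (cmod (bil n m C v w))\<^sup>2 \<le> s * nsq n v * nsq m w"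
    and s: "s = (\<Sum>i<k. \<mu> i * nsq k' (C i))"
  shows row_norm: "\<And>i. i < k \<Longrightarrow> nsq k' (C i) = s"
    and row_zero: "\<And>i p. i < k \<Longrightarrow> k' \<le> p \<Longrightarrow> p < m \<Longrightarrow> C i p = 0"
    and row_orth: "\<And>i j. i < k \<Longrightarrow> j < k \<Longrightarrow> i \<noteq> j \<Longrightarrow> (\<Sum>p<k'. C i p * cnj (C j p)) = 0"
proof -
  have s0: "0 \<le> s" unfolding s using pos
    by (intro sum_nonneg mult_nonneg_nonneg nsq_nonneg) (auto intro: less_imp_le)
  have row: "nsq m (C i) \<le> s" if "i < n" for i
    using bil_bound_row[OF bd s0, of "\<lambda>l. if l = i then 1 else 0"] that
    by (simp add: sum_mult_delta nsq_delta)
  have le: "nsq k' (C i) \<le> s" if "i < k" for i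
    using nsq_mono_dim[OF km, of "C i"] row[of i] that kn by linarith
  have eq: "nsq k' (C i) = s" if "i < k" for i
    by (rule weighted_sum_eq_imp_eq[of k \<mu> "\<lambda>i. nsq k' (C i)"]) (use pos one le s that in auto)
  have eqm: "nsq m (C i) = s" if "i < k" for i
    using nsq_mono_dim[OF km, of "C i"] row[of i] that kn eq[OF that] by linarith
  show "nsq k' (C i) = s" if "i < k" for i by (rule eq[OF that])
  show zero: "C i p = 0" if "i < k" "k' \<le> p" "p < m" for i p
    by (rule nsq_eq_dim_imp_zero[OF km]) (use eq eqm that in auto)
  show "(\<Sum>p<k'. C i p * cnj (C j p)) = 0" if ij: "i < k" "j < k" "i \<noteq> j" for i j
  proof -
    \<comment> \<open>The test vector e_i + z e_j, with z the inner product itself, has square norm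
      1 + |z|^2, while its image has s + 2 |z|^2 + s |z|^2. The bound therefore forces z =
      0.\<close>
    let ?z = "\<Sum>p<m. C i p * cnj (C j p)"
    have ijn: "i < n" "j < n" using ij kn by auto
    have "nsq n (\<lambda>l. (if l = i then 1 else 0) + ?z * (if l = j then 1 else 0)) = 1 + (cmod ?z)\<^sup>2"
      unfolding nsq_combination using ijn ij by (simp add: nsq_delta sum_mult_delta)
    hence "nsq m (\<lambda>p. C i p + ?z * C j p) \<le> s * (1 + (cmod ?z)\<^sup>2)"
      using bil_bound_row[OF bd s0, of "\<lambda>l. (if l = i then 1 else 0) + ?z * (if l = j then 1 else 0)"] ijn
      by (simp add: distrib_right sum.distrib sum_mult_delta mult.assoc sum_distrib_left[symmetric])
    hence "2 * Re (cnj ?z * ?z) \<le> 0"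
      unfolding nsq_combination using eqm ij by (simp add: algebra_simps)
    hence "?z = 0" by (intro cnj_mult_self_nonpos) linarith
    moreover have "?z = (\<Sum>p<k'. C i p * cnj (C j p))"
      by (rule sum.mono_neutral_right) (use km zero ij in auto)
    ultimately show ?thesis by simp
  qed
qed

section \<open>The range of a corner\<close>

text \<open>For \<open>k = k'\<close> this says \<open>C = \<surd>s (X \<oplus> F)\<close> with \<open>X\<close> unitary of size \<open>k\<close> and \<open>F\<close> a contraction.\<close>

definition block_form :: "nat \<Rightarrow> nat \<Rightarrow> nat \<Rightarrow> nat \<Rightarrow> (nat \<Rightarrow> nat \<Rightarrow> complex) \<Rightarrow> real \<Rightarrow> bool" where
  "block_form n m k k' C s \<longleftrightarrow>
     (\<forall>i<k. nsq k' (C i) = s) \<and>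
     (\<forall>i p. i < k \<longrightarrow> k' \<le> p \<longrightarrow> p < m \<longrightarrow> C i p = 0) \<and>
     (\<forall>i<k. \<forall>j<k. i \<noteq> j \<longrightarrow> (\<Sum>p<k'. C i p * cnj (C j p)) = 0) \<and>
     (\<forall>p<k'. nsq k (\<lambda>i. C i p) = s) \<and>
     (\<forall>i p. p < k' \<longrightarrow> k \<le> i \<longrightarrow> i < n \<longrightarrow> C i p = 0) \<and>
     (\<forall>p<k'. \<forall>q<k'. p \<noteq> q \<longrightarrow> (\<Sum>i<k. C i p * cnj (C i q)) = 0) \<and>
     (\<forall>v w. (cmod (bil n m C v w))\<^sup>2 \<le> s * nsq n v * nsq m w)"

lemma block_formD:
  assumes "block_form n m k k' C s"
  shows "\<And>i. i < k \<Longrightarrow> nsq k' (C i) = s"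
    "\<And>i p. i < k \<Longrightarrow> k' \<le> p \<Longrightarrow> p < m \<Longrightarrow> C i p = 0"
    "\<And>i j. i < k \<Longrightarrow> j < k \<Longrightarrow> i \<noteq> j \<Longrightarrow> (\<Sum>p<k'. C i p * cnj (C j p)) = 0"
    "\<And>p. p < k' \<Longrightarrow> nsq k (\<lambda>i. C i p) = s"
    "\<And>i p. p < k' \<Longrightarrow> k \<le> i \<Longrightarrow> i < n \<Longrightarrow> C i p = 0"
    "\<And>p q. p < k' \<Longrightarrow> q < k' \<Longrightarrow> p \<noteq> q \<Longrightarrow> (\<Sum>i<k. C i p * cnj (C i q)) = 0"
    "\<And>v w. (cmod (bil n m C v w))\<^sup>2 \<le> s * nsq n v * nsq m w"
proof -
  note c1 = assms[unfolded block_form_def]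
  note c2 = c1[THEN conjunct2]
  note c3 = c2[THEN conjunct2]
  note c4 = c3[THEN conjunct2]
  note c5 = c4[THEN conjunct2]
  note c6 = c5[THEN conjunct2]
  note c7 = c6[THEN conjunct2]
  show "nsq k' (C i) = s" if "i < k" for i
    by (rule c1[THEN conjunct1, rule_format]) (fact that)+
  show "C i p = 0" if "i < k" "k' \<le> p" "p < m" for i p
    by (rule c2[THEN conjunct1, rule_format]) (fact that)+
  show "(\<Sum>p<k'. C i p * cnj (C j p)) = 0" if "i < k" "j < k" "i \<noteq> j" for i j
    by (rule c3[THEN conjunct1, rule_format]) (fact that)+
  show "nsq k (\<lambda>i. C i p) = s" if "p < k'" for p
    by (rule c4[THEN conjunct1, rule_format]) (fact that)+
  show "C i p = 0" if "p < k'" "k \<le> i" "i < n" for i p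
    by (rule c5[THEN conjunct1, rule_format]) (fact that)+
  show "(\<Sum>i<k. C i p * cnj (C i q)) = 0" if "p < k'" "q < k'" "p \<noteq> q" for p q
    by (rule c6[THEN conjunct1, rule_format]) (fact that)+
  show "(cmod (bil n m C v w))\<^sup>2 \<le> s * nsq n v * nsq m w" for v w
    by (rule c7[rule_format])
qed

text \<open>\<open>row_structure\<close> for C and for its transpose yields a scale s for rows and a
  scale s' for columns. Both bound the squared operator norm, so column 0, whose corner has square
  norm s', gives s' \<le> s, and row 0 gives s \<le> s'.\<close>

lemma block_formI:
  fixes \<mu> r :: "nat \<Rightarrow> real"
  assumes mu: "\<And>i. i < k \<Longrightarrow> \<mu> i > 0" "(\<Sum>i<k. \<mu> i) = 1"
    and r: "\<And>i. i < k' \<Longrightarrow> r i > 0" "(\<Sum>i<k'. r i) = 1"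
    and kn: "k \<le> n" "k' \<le> m"
    and bd1: "\<And>v w. (cmod (bil n m C v w))\<^sup>2 \<le> (\<Sum>i<k. \<mu> i * nsq k' (C i)) * nsq n v * nsq m w"
    and bd2: "\<And>v w. (cmod (bil n m C v w))\<^sup>2 \<le> (\<Sum>p<k'. r p * nsq k (\<lambda>i. C i p)) * nsq n v * nsq m w"
  shows "block_form n m k k' C (\<Sum>i<k. \<mu> i * nsq k' (C i))"
proof -
  define s where "s = (\<Sum>i<k. \<mu> i * nsq k' (C i))"
  define s' where "s' = (\<Sum>p<k'. r p * nsq k (\<lambda>i. C i p))"
  have bd2': "(cmod (bil m n (\<lambda>p i. C i p) w v))\<^sup>2 \<le> s' * nsq m w * nsq n v" for v w
    using bd2[of v w] unfolding bil_transpose[of m n C w v] s'_def by (simp add: ac_simps)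
  have bd1': "(cmod (bil m n (\<lambda>p i. C i p) w v))\<^sup>2 \<le> s * nsq m w * nsq n v" for v w
    using bd1[of v w] unfolding bil_transpose[of m n C w v] s_def by (simp add: ac_simps)
  have s0: "0 \<le> s" unfolding s_def using mu(1)
    by (intro sum_nonneg mult_nonneg_nonneg nsq_nonneg) (auto intro: less_imp_le)
  have s'0: "0 \<le> s'" unfolding s'_def using r(1)
    by (intro sum_nonneg mult_nonneg_nonneg nsq_nonneg) (auto intro: less_imp_le)
  note R = row_structure[OF mu kn bd1 refl, folded s_def]
  note R' = row_structure[OF r kn(2,1) bd2' s'_def]
  have pos: "0 < k" "0 < k'" using mu(2) r(2) by (auto intro: gr0I)
  have "nsq k (\<lambda>i. C i 0) \<le> nsq n (\<lambda>i. C i 0)" by (rule nsq_mono_dim[OF kn(1)])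
  also have "\<dots> \<le> s"
    using bil_bound_row[OF bd1' s0, of "\<lambda>l. if l = 0 then 1 else 0"] pos kn
    by (simp add: sum_mult_delta nsq_delta)
  finally have "s' \<le> s" using R'(1)[of 0] pos by simp
  have "nsq k' (C 0) \<le> nsq m (C 0)" by (rule nsq_mono_dim[OF kn(2)])
  also have "\<dots> \<le> s'"
    using bil_bound_row[of n m C s' "\<lambda>l. if l = 0 then 1 else 0"] bd2 s'0 pos kn
    by (simp add: sum_mult_delta nsq_delta s'_def)
  finally have "s \<le> s'" using R(1)[of 0] pos by simp
  with \<open>s' \<le> s\<close> have "s' = s" by simp
  show ?thesis
    unfolding block_form_def s_def[symmetric]
    by (intro conjI allI impI)
      (use R R'[unfolded \<open>s' = s\<close>] bd1[folded s_def] in \<open>simp_all\<close>)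
qed

text \<open>Summing |C i p|^2 over the corner gives k s by rows and k' s by columns.\<close>

lemma block_form_square:
  assumes "block_form n m k k' C s" "s \<noteq> 0"
  shows "k = k'"
proof -
  have "(\<Sum>i<k. nsq k' (C i)) = (\<Sum>p<k'. nsq k (\<lambda>i. C i p))"
    unfolding nsq_def by (rule sum.swap)
  hence "real k * s = real k' * s"
    using block_formD(1,4)[OF assms(1)] by simp
  thus ?thesis using assms(2) by simp
qed

text \<open>The last clause of \<open>block_form\<close> bounds the whole matrix, so scale 0 also
  kills the entries outside the corner.\<close>

lemma block_form_zero:
  assumes "block_form n m k k' C 0" "i < n" "p < m"
  shows "C i p = 0"
proof -
  have "bil n m C (\<lambda>l. if l = i then 1 else 0) (\<lambda>l. if l = p then 1 else 0) = C i p"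
    unfolding bil_alt using assms(2,3) by (simp add: sum_mult_delta)
  thus ?thesis
    using block_formD(7)[OF assms(1), of "\<lambda>l. if l = i then 1 else 0" "\<lambda>l. if l = p then 1 else 0"] by simp
qed

text \<open>Polarization: if \<open>C + z C'\<close> has a scalar Gram matrix on its corner for every \<open>z\<close>, then the
  corner of \<open>C'\<close> is a multiple of that of \<open>C\<close>.\<close>

lemma block_form_line:
  assumes S: "\<And>C. C \<in> S \<Longrightarrow> \<exists>s. block_form n m k k' C s"
    and lin: "\<And>C C' z. C \<in> S \<Longrightarrow> C' \<in> S \<Longrightarrow> (\<lambda>i p. C i p + z * C' i p) \<in> S"
    and C: "C \<in> S" "block_form n m k k' C s" "s \<noteq> 0" and C': "C' \<in> S" and k: "0 < k" "0 < k'"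
  shows "\<exists>c. \<forall>i<n. \<forall>p<m. C' i p = c * C i p"
proof -
  \<comment> \<open>With ^H for the adjoint, H = C' C^H on the corner: the cross term in the Gram
    matrix of C + z C'.\<close>
  define H where "H = (\<lambda>i j. \<Sum>p<k'. C' i p * cnj (C j p))"
  obtain s' where s': "block_form n m k k' C' s'" using S[OF C'] by blast
  have cross: "(\<Sum>p<k'. (C i p + z * C' i p) * cnj (C j p + z * C' j p)) =
      (\<Sum>p<k'. C i p * cnj (C j p)) + z * H i j + cnj z * cnj (H j i)
      + z * cnj z * (\<Sum>p<k'. C' i p * cnj (C' j p))" for i j z
    unfolding H_def by (simp add: algebra_simps sum.distrib sum_distrib_left)
  have off: "H i j = 0" if ij: "i < k" "j < k" "i \<noteq> j" for i j
  proof -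
    have "z * H i j + cnj z * cnj (H j i) = 0" for z
    proof -
      obtain t where "block_form n m k k' (\<lambda>i p. C i p + z * C' i p) t"
        using S[OF lin[OF C(1) C', of z]] by blast
      from block_formD(3)[OF this ij] show ?thesis
        unfolding cross using block_formD(3)[OF C(2) ij] block_formD(3)[OF s' ij] by simp
    qed
    \<comment> \<open>z = 1 gives H i j = - cnj (H j i), and z = \<open>\<i>\<close> gives H i j =
      cnj (H j i).\<close>
    from this[of 1] this[of \<i>] show ?thesis by (simp add: complex_eq_iff)
  qed
  have diag: "H i i = H 0 0" if i: "i < k" for i
  proof -
    \<comment> \<open>The scale t of C + z C' is unknown but the same in every row, so Re (z H i i)
      cannot depend on i.\<close>
    have "Re (z * H i i) = Re (z * H 0 0)" for z
    proof -
      obtain t where t: "block_form n m k k' (\<lambda>i p. C i p + z * C' i p) t"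
        using S[OF lin[OF C(1) C', of z]] by blast
      have "2 * Re (z * H i i) = t - s - (cmod z)\<^sup>2 * s'" if "i < k" for i
      proof -
        have "complex_of_real t = complex_of_real s + z * H i i + cnj (z * H i i) + z * cnj z * complex_of_real s'"
          using cross[of i z i] unfolding sum_mult_cnj_self block_formD(1)[OF C(2) that]
            block_formD(1)[OF s' that] block_formD(1)[OF t that] by simp
        hence "Re (complex_of_real t) = Re (complex_of_real s + z * H i i + cnj (z * H i i) + z * cnj z * complex_of_real s')"
          by (rule arg_cong)
        thus ?thesis unfolding complex_mult_cnj cmod_power2 by simp
      qed
      from this[OF i] this[OF k(1)] show ?thesis by simp
    qed
    from this[of 1] this[of \<i>] show ?thesis by (simp add: complex_eq_iff)
  qed
  \<comment> \<open>H is now H 0 0 times the identity. Multiplying C' C^H = H by C on the right and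
    using the column relations C^H C = s I gives the claim.\<close>
  have corner: "complex_of_real s * C' i q = H 0 0 * C i q" if i: "i < k" and q: "q < k'" for i q
  proof -
    have "(\<Sum>j<k. H i j * C j q) = (\<Sum>j<k. (if j = i then H 0 0 else 0) * C j q)"
    proof (intro sum.cong refl)
      fix j assume "j \<in> {..<k}"
      thus "H i j * C j q = (if j = i then H 0 0 else 0) * C j q"
        using off[OF i, of j] diag[OF i] by (cases "j = i") (simp_all only: lessThan_iff if_True if_False refl)
    qed
    also have "\<dots> = H 0 0 * C i q" by (rule sum_mult_delta(1)[OF i])
    also have "(\<Sum>j<k. H i j * C j q) = (\<Sum>p<k'. C' i p * (\<Sum>j<k. C j q * cnj (C j p)))"
      unfolding H_def sum_distrib_right sum_distrib_left
      by (subst sum.swap) (simp add: ac_simps)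
    also have "\<dots> = (\<Sum>p<k'. C' i p * (if p = q then complex_of_real s else 0))"
    proof (intro sum.cong refl)
      fix p assume p: "p \<in> {..<k'}"
      show "C' i p * (\<Sum>j<k. C j q * cnj (C j p)) = C' i p * (if p = q then complex_of_real s else 0)"
      proof (cases "p = q")
        case True
        thus ?thesis using block_formD(4)[OF C(2) q] by (simp add: sum_mult_cnj_self)
      next
        case False
        thus ?thesis using block_formD(6)[OF C(2) q, of p] p by simp
      qed
    qed
    also have "\<dots> = C' i q * complex_of_real s" by (rule sum_mult_delta(2)[OF q])
    finally show ?thesis by (metis mult.commute)
  qed
  define c where "c = H 0 0 / complex_of_real s"
  \<comment> \<open>C' - c C stays in S and its first corner row vanishes. Its scale is thus 0, and
    so is the whole matrix, also outside the corner.\<close>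
  define D where "D = (\<lambda>i p. C' i p + (- c) * C i p)"
  obtain t where t: "block_form n m k k' D t" using S[OF lin[OF C' C(1), of "- c"]] unfolding D_def by blast
  have "D 0 p = 0" if "p < k'" for p
    using corner[OF k(1) that] C(3) unfolding D_def c_def by (simp add: field_simps)
  hence "nsq k' (D 0) = 0" unfolding nsq_def by simp
  hence "t = 0" using block_formD(1)[OF t k(1)] by simp
  hence D: "D i p = 0" if "i < n" "p < m" for i p
    using block_form_zero[of n m k k' D i p] t that by simp
  have "C' i p = c * C i p" if "i < n" "p < m" for i p
    using D[OF that] unfolding D_def by simp
  thus ?thesis by blast
qed

text \<open>With N = |v|^2 |w|^2, S the squared modulus of \<open>bil\<close>, and q0 + 2 q1 t + q2
  t^2 the expanded weighted norm, the hypothesis says 0 \<le> (q0 N - S) + 2 (q1 N - S) t + (q2 N -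
  S) t^2 for t \<ge> 0. The first claim is the leading coefficient. In the second that coefficient
  is 0, so the next one must be non-negative.\<close>

lemma resolvent_bound_limit:
  fixes \<mu> :: "nat \<Rightarrow> real"
  assumes H: "\<And>t v w. t \<ge> 0 \<Longrightarrow> (1 + t)\<^sup>2 * (cmod (bil n m C v w))\<^sup>2 \<le>
      (\<Sum>i<k. \<mu> i * nsq k' (\<lambda>p. B i p + complex_of_real t * C i p)) * nsq n v * nsq m w"
  shows "(cmod (bil n m C v w))\<^sup>2 \<le> (\<Sum>i<k. \<mu> i * nsq k' (C i)) * nsq n v * nsq m w"
    and "(cmod (bil n m C v w))\<^sup>2 = (\<Sum>i<k. \<mu> i * nsq k' (C i)) * nsq n v * nsq m w \<Longrightarrow>
      0 < nsq n v * nsq m w \<Longrightarrow>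
      (\<Sum>i<k. \<mu> i * nsq k' (C i)) \<le> Re (\<Sum>i<k. complex_of_real (\<mu> i) * (\<Sum>p<k'. B i p * cnj (C i p)))"
proof -
  define q0 where "q0 = (\<Sum>i<k. \<mu> i * nsq k' (B i))"
  define q1 where "q1 = Re (\<Sum>i<k. complex_of_real (\<mu> i) * (\<Sum>p<k'. B i p * cnj (C i p)))"
  define q2 where "q2 = (\<Sum>i<k. \<mu> i * nsq k' (C i))"
  define N where "N = nsq n v * nsq m w"
  define S where "S = (cmod (bil n m C v w))\<^sup>2"
  have Q: "(\<Sum>i<k. \<mu> i * nsq k' (\<lambda>p. B i p + complex_of_real t * C i p)) = q0 + 2 * q1 * t + q2 * t\<^sup>2" for t
    unfolding nsq_combination q0_def q1_def q2_def
    by (simp add: distrib_left sum.distrib sum_distrib_left sum_distrib_right algebra_simps)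
  have *: "0 \<le> (q0 * N - S) + (2 * (q1 * N - S)) * t + (q2 * N - S) * t\<^sup>2" if "t \<ge> 0" for t
    using H[OF that, of v w] unfolding Q S_def[symmetric] mult.assoc N_def[symmetric]
    by (simp add: algebra_simps power2_eq_square)
  have "0 \<le> q2 * N - S" by (rule quadratic_nonneg_lead) (rule *)
  thus "(cmod (bil n m C v w))\<^sup>2 \<le> (\<Sum>i<k. \<mu> i * nsq k' (C i)) * nsq n v * nsq m w"
    unfolding S_def N_def q2_def by (simp add: mult.assoc)
  assume eq: "(cmod (bil n m C v w))\<^sup>2 = (\<Sum>i<k. \<mu> i * nsq k' (C i)) * nsq n v * nsq m w"
    and pos: "0 < nsq n v * nsq m w"
  have SN: "S = q2 * N" using eq unfolding S_def N_def q2_def by (simp add: mult.assoc)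
  have "0 \<le> 2 * (q1 * N - S)"
  proof (rule affine_nonneg_slope)
    fix t :: real assume "t \<ge> 0"
    from *[OF this] show "0 \<le> (q0 * N - S) + (2 * (q1 * N - S)) * t" unfolding SN by simp
  qed
  hence "q2 * N \<le> q1 * N" using SN by simp
  hence "q2 \<le> q1" using pos unfolding N_def by (rule mult_right_le_imp_le)
  thus "(\<Sum>i<k. \<mu> i * nsq k' (C i)) \<le> Re (\<Sum>i<k. complex_of_real (\<mu> i) * (\<Sum>p<k'. B i p * cnj (C i p)))"
    unfolding q1_def q2_def .
qed

text \<open>The limiting bound is attained by v = e_0 and w the conjugate of row 0 of the corner,
  where both of its sides equal s^2. If s = 0, the corner of C vanishes and the claim is 0 \<le>
  0.\<close>

lemma block_form_resolvent_bound:
  fixes \<mu> :: "nat \<Rightarrow> real"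
  assumes H: "\<And>t v w. t \<ge> 0 \<Longrightarrow> (1 + t)\<^sup>2 * (cmod (bil n m C v w))\<^sup>2 \<le>
      (\<Sum>i<k. \<mu> i * nsq k' (\<lambda>p. B i p + complex_of_real t * C i p)) * nsq n v * nsq m w"
    and one: "(\<Sum>i<k. \<mu> i) = 1" and kn: "k \<le> n" "k' \<le> m" and row: "\<And>i. i < k \<Longrightarrow> nsq k' (C i) = s"
  shows "s \<le> Re (\<Sum>i<k. complex_of_real (\<mu> i) * (\<Sum>p<k'. B i p * cnj (C i p)))"
proof -
  have pos: "0 < k" using one by (auto intro: gr0I)
  have s: "(\<Sum>i<k. \<mu> i * nsq k' (C i)) = s"
    using row one by (simp add: sum_distrib_right[symmetric])
  show ?thesis
  proof (cases "s = 0")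
    case True
    have "C i p = 0" if "i < k" "p < k'" for i p
    proof -
      have "(\<Sum>p<k'. (cmod (C i p))\<^sup>2) = 0" using row[OF that(1)] True unfolding nsq_def by simp
      thus ?thesis using that(2) by (subst (asm) sum_nonneg_eq_0_iff) auto
    qed
    thus ?thesis using True by simp
  next
    case False
    let ?v = "\<lambda>l::nat. if l = 0 then 1 else (0::complex)"
    \<comment> \<open>The hypothesis gives the norm of the corner part of row 0 only, hence the cut
      at k'.\<close>
    let ?w = "\<lambda>p. if p < k' then cnj (C 0 p) else 0"
    have v: "nsq n ?v = 1" using pos kn by (intro nsq_delta) simp
    have "nsq m ?w = nsq k' ?w"
      unfolding nsq_def by (rule sum.mono_neutral_right) (use kn in auto)
    also have "\<dots> = nsq k' (C 0)" unfolding nsq_def by simp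
    finally have w: "nsq m ?w = s" using row[OF pos] by simp
    have "bil n m C ?v ?w = (\<Sum>p<m. C 0 p * ?w p)"
      unfolding bil_alt using pos kn by (simp add: sum_mult_delta)
    also have "\<dots> = (\<Sum>p<k'. C 0 p * ?w p)"
      by (rule sum.mono_neutral_right) (use kn in auto)
    also have "\<dots> = (\<Sum>p<k'. C 0 p * cnj (C 0 p))" by simp
    also have "\<dots> = complex_of_real s" using sum_mult_cnj_self[of "C 0" k'] row[OF pos] by simp
    finally have b: "(cmod (bil n m C ?v ?w))\<^sup>2 = s\<^sup>2" by simp
    have s0: "0 < s" using False row[OF pos] nsq_nonneg[of k' "C 0"] by linarith
    show ?thesis
      using resolvent_bound_limit(2)[OF H, of ?v ?w] b s0 unfolding s v w
      by (simp add: power2_eq_square)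
  qed
qed

text \<open>If r j < \<mu> j, then \<mu> i \<ge> \<mu> j > r j \<ge> r p whenever i \<le> j \<le> p,
  so x vanishes there. The first j + 1 rows, of total mass j + 1, would then live in the first j
  columns, of total mass j.\<close>

lemma sorted_eq_of_doubly_stochastic_aux:
  fixes \<mu> r :: "nat \<Rightarrow> real" and x :: "nat \<Rightarrow> nat \<Rightarrow> real"
  assumes dec: "\<And>i j. i \<le> j \<Longrightarrow> j < k \<Longrightarrow> \<mu> j \<le> \<mu> i" "\<And>i j. i \<le> j \<Longrightarrow> j < k \<Longrightarrow> r j \<le> r i"
    and x: "\<And>i p. 0 \<le> x i p" and row: "\<And>i. i < k \<Longrightarrow> (\<Sum>p<k. x i p) = 1"
    and col: "\<And>p. p < k \<Longrightarrow> (\<Sum>i<k. x i p) = 1"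
    and sup: "\<And>i p. i < k \<Longrightarrow> p < k \<Longrightarrow> x i p \<noteq> 0 \<Longrightarrow> \<mu> i = r p" and j: "j < k"
  shows "\<mu> j \<le> r j"
proof (rule ccontr)
  assume "\<not> \<mu> j \<le> r j"
  hence gt: "r j < \<mu> j" by simp
  have zero: "x i p = 0" if "i \<le> j" "j \<le> p" "p < k" for i p
  proof (rule ccontr)
    assume "x i p \<noteq> 0"
    hence "\<mu> i = r p" using sup[of i p] that j by simp
    thus False using dec(1)[OF that(1) j] dec(2)[OF that(2,3)] gt by simp
  qed
  have "real (Suc j) = (\<Sum>i<Suc j. \<Sum>p<k. x i p)" using row j by simp
  also have "\<dots> = (\<Sum>i<Suc j. \<Sum>p<j. x i p)"
    by (intro sum.cong refl sum.mono_neutral_right) (use j zero in auto)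
  also have "\<dots> \<le> (\<Sum>i<k. \<Sum>p<j. x i p)"
    by (intro sum_mono2 sum_nonneg x) (use j in auto)
  also have "\<dots> = (\<Sum>p<j. \<Sum>i<k. x i p)" by (rule sum.swap)
  also have "\<dots> = real j" using col j by simp
  finally show False by simp
qed

lemma sorted_eq_of_doubly_stochastic:
  fixes \<mu> r :: "nat \<Rightarrow> real" and x :: "nat \<Rightarrow> nat \<Rightarrow> real"
  assumes dec: "\<And>i j. i \<le> j \<Longrightarrow> j < k \<Longrightarrow> \<mu> j \<le> \<mu> i" "\<And>i j. i \<le> j \<Longrightarrow> j < k \<Longrightarrow> r j \<le> r i"
    and x: "\<And>i p. 0 \<le> x i p" and row: "\<And>i. i < k \<Longrightarrow> (\<Sum>p<k. x i p) = 1"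
    and col: "\<And>p. p < k \<Longrightarrow> (\<Sum>i<k. x i p) = 1"
    and sup: "\<And>i p. i < k \<Longrightarrow> p < k \<Longrightarrow> x i p \<noteq> 0 \<Longrightarrow> \<mu> i = r p" and j: "j < k"
  shows "\<mu> j = r j"
proof (rule antisym)
  show "\<mu> j \<le> r j"
    by (rule sorted_eq_of_doubly_stochastic_aux[where k = k and \<mu> = \<mu> and r = r and x = x, OF dec x row col sup j])
  have sup': "r p = \<mu> i" if "p < k" "i < k" "x i p \<noteq> 0" for i p
    using sup[OF that(2,1,3)] by simp
  show "r j \<le> \<mu> j"
    by (rule sorted_eq_of_doubly_stochastic_aux[where k = k and \<mu> = r and r = \<mu> and x = "\<lambda>p i. x i p",
          OF dec(2,1) x col row sup' j])
qed

text \<open>At t = 0 the bounds show that g kills every F that vanishes on the first k rows or on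
  the first k' columns, so g sees only the corner. The entries of B off the corner are then free,
  and can be chosen to cancel those of t g(B).\<close>

lemma corner_support_reduction:
  fixes g :: "(nat \<Rightarrow> nat \<Rightarrow> complex) \<Rightarrow> nat \<Rightarrow> nat \<Rightarrow> complex" and \<mu> r :: "nat \<Rightarrow> real"
  assumes kn: "k \<le> n" "k' \<le> m"
    and lin: "\<And>B B' z. g (\<lambda>i p. B i p + z * B' i p) = (\<lambda>i p. g B i p + z * g B' i p)"
    and out: "\<And>B i p. \<not> (i < n \<and> p < m) \<Longrightarrow> g B i p = 0"
    and bd1: "\<And>B t v w. t \<ge> 0 \<Longrightarrow> (1 + t)\<^sup>2 * (cmod (bil n m (g B) v w))\<^sup>2 \<le>
      (\<Sum>i<k. \<mu> i * nsq m (\<lambda>p. B i p + complex_of_real t * g B i p)) * nsq n v * nsq m w"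
    and bd2: "\<And>B t v w. t \<ge> 0 \<Longrightarrow> (1 + t)\<^sup>2 * (cmod (bil n m (g B) v w))\<^sup>2 \<le>
      (\<Sum>p<k'. r p * nsq n (\<lambda>i. B i p + complex_of_real t * g B i p)) * nsq n v * nsq m w"
    and t: "t \<ge> 0"
  shows "(1 + t)\<^sup>2 * (cmod (bil n m (g B) v w))\<^sup>2 \<le>
      (\<Sum>i<k. \<mu> i * nsq k' (\<lambda>p. B i p + complex_of_real t * g B i p)) * nsq n v * nsq m w" (is ?A)
    and "(1 + t)\<^sup>2 * (cmod (bil n m (g B) v w))\<^sup>2 \<le>
      (\<Sum>p<k'. r p * nsq k (\<lambda>i. B i p + complex_of_real t * g B i p)) * nsq n v * nsq m w" (is ?B)
proof -
  have zero: "g F = (\<lambda>i p. 0)" if "\<And>v w. (cmod (bil n m (g F) v w))\<^sup>2 \<le> 0" for F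
  proof (intro ext)
    fix i p
    show "g F i p = 0"
    proof (cases "i < n \<and> p < m")
      case True
      have "bil n m (g F) (\<lambda>l. if l = i then 1 else 0) (\<lambda>l. if l = p then 1 else 0) = g F i p"
        unfolding bil_alt using True by (simp add: sum_mult_delta)
      thus ?thesis
        using that[of "\<lambda>l. if l = i then 1 else 0" "\<lambda>l. if l = p then 1 else 0"] by simp
    qed (use out in blast)
  qed
  have rows: "g F = (\<lambda>i p. 0)" if "\<And>i p. i < k \<Longrightarrow> p < m \<Longrightarrow> F i p = 0" for F
    using bd1[of 0 F] that by (intro zero) (simp add: nsq_def)
  have cols: "g F = (\<lambda>i p. 0)" if "\<And>i p. i < n \<Longrightarrow> p < k' \<Longrightarrow> F i p = 0" for F
    using bd2[of 0 F] that by (intro zero) (simp add: nsq_def)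
  have dep: "g F = g F'" if eq: "\<And>i p. i < k \<Longrightarrow> p < k' \<Longrightarrow> F i p = F' i p" for F F'
  proof -
    \<comment> \<open>F - F' splits into P, which vanishes on the first k rows, and Q, which lives
      in them; Q vanishes on the first k' columns since F and F' agree on the corner.\<close>
    define P where "P = (\<lambda>i p. if i < k then 0 else F i p - F' i p)"
    define Q where "Q = (\<lambda>i p. if i < k then F i p - F' i p else 0)"
    have "g P = (\<lambda>i p. 0)" by (rule rows) (simp add: P_def)
    moreover have "g Q = (\<lambda>i p. 0)" by (rule cols) (simp add: Q_def eq)
    moreover have "F = (\<lambda>i p. (F' i p + 1 * P i p) + 1 * Q i p)"
      unfolding P_def Q_def by (intro ext) simp
    ultimately show ?thesis
      using lin[of F' 1 P] lin[of "\<lambda>i p. F' i p + 1 * P i p" 1 Q] by simp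
  qed
  define c where "c = (\<lambda>F i p. if i < k \<and> p < k' then F i p else (0::complex))"
  \<comment> \<open>F agrees with B on the corner, so g(F) = g(B), and off the corner it is - t
    g(B). Hence F + t g(F) is the corner of B + t g(B), padded with 0.\<close>
  define F where "F = (\<lambda>i p. c B i p + complex_of_real t * (c (g B) i p - g B i p))"
  have gF: "g F = g B" by (rule dep) (simp add: F_def c_def)
  have F: "F i p + complex_of_real t * g F i p
      = (if i < k \<and> p < k' then B i p + complex_of_real t * g B i p else 0)" for i p
    unfolding gF unfolding F_def c_def by (simp add: algebra_simps)
  have "nsq m (\<lambda>p. F i p + complex_of_real t * g F i p) = nsq k' (\<lambda>p. B i p + complex_of_real t * g B i p)"
    if "i < k" for i
    unfolding F nsq_def using kn that by (intro sum.mono_neutral_cong_right) auto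
  thus ?A using bd1[OF t, of F v w] unfolding gF by simp
  have "nsq n (\<lambda>i. F i p + complex_of_real t * g F i p) = nsq k (\<lambda>i. B i p + complex_of_real t * g B i p)"
    if "p < k'" for p
    unfolding F nsq_def using kn that by (intro sum.mono_neutral_cong_right) auto
  thus ?B using bd2[OF t, of F v w] unfolding gF by simp
qed

text \<open>Here g is \<gamma> in entry form, with range spanned by a normalized Z. For g(B) = c Z
  the coefficient of t says |c|^2 \<le> Re (cnj c * ip B), with ip the \<mu>-weighted inner product
  with Z; so g vanishes where ip does. As ip Z = 1, g(B) = ip(B) g(Z) = ip(B) \<kappa> Z, and B = Z
  gives the condition on \<kappa>. The same holds for the r-weighted product ir, and ip = ir couples
  \<mu> with r.\<close>

lemma corner_range_classification:
  fixes g :: "(nat \<Rightarrow> nat \<Rightarrow> complex) \<Rightarrow> nat \<Rightarrow> nat \<Rightarrow> complex" and \<mu> r :: "nat \<Rightarrow> real"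
  assumes mu: "\<And>i. i < k \<Longrightarrow> \<mu> i > 0" "(\<Sum>i<k. \<mu> i) = 1"
    and r: "\<And>i. i < k' \<Longrightarrow> r i > 0" "(\<Sum>i<k'. r i) = 1"
    and dec: "\<And>i j. i \<le> j \<Longrightarrow> j < k \<Longrightarrow> \<mu> j \<le> \<mu> i" "\<And>i j. i \<le> j \<Longrightarrow> j < k' \<Longrightarrow> r j \<le> r i"
    and kn: "k \<le> n" "k' \<le> m"
    and lin: "\<And>B B' z. g (\<lambda>i p. B i p + z * B' i p) = (\<lambda>i p. g B i p + z * g B' i p)"
    and out: "\<And>B i p. \<not> (i < n \<and> p < m) \<Longrightarrow> g B i p = 0"
    and bd1: "\<And>B t v w. t \<ge> 0 \<Longrightarrow> (1 + t)\<^sup>2 * (cmod (bil n m (g B) v w))\<^sup>2 \<le>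
      (\<Sum>i<k. \<mu> i * nsq m (\<lambda>p. B i p + complex_of_real t * g B i p)) * nsq n v * nsq m w"
    and bd2: "\<And>B t v w. t \<ge> 0 \<Longrightarrow> (1 + t)\<^sup>2 * (cmod (bil n m (g B) v w))\<^sup>2 \<le>
      (\<Sum>p<k'. r p * nsq n (\<lambda>i. B i p + complex_of_real t * g B i p)) * nsq n v * nsq m w"
    and nz: "g B0 \<noteq> (\<lambda>i p. 0)"
  shows "\<exists>Z \<kappa>. k = k' \<and> (\<forall>i<k. \<mu> i = r i) \<and> block_form n m k k' Z 1 \<and> (cmod \<kappa>)\<^sup>2 \<le> Re \<kappa> \<and>
    (\<forall>i<k. \<forall>p<k. complex_of_real (\<mu> i) * Z i p = complex_of_real (\<mu> p) * Z i p) \<and>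
    (\<forall>B. \<forall>i<n. \<forall>p<m. g B i p =
       \<kappa> * (\<Sum>a<k. \<Sum>b<k. complex_of_real (\<mu> b) * cnj (Z a b) * B a b) * Z i p)"
proof -
  have red: "(1 + t)\<^sup>2 * (cmod (bil n m (g B) v w))\<^sup>2 \<le>
      (\<Sum>i<k. \<mu> i * nsq k' (\<lambda>p. B i p + complex_of_real t * g B i p)) * nsq n v * nsq m w"
    if "t \<ge> 0" for B t v w
    by (rule corner_support_reduction(1)[where g = g, OF kn lin _ bd1 bd2 that]) (fact out)
  have redc: "(1 + t)\<^sup>2 * (cmod (bil n m (g B) v w))\<^sup>2 \<le>
      (\<Sum>p<k'. r p * nsq k (\<lambda>i. B i p + complex_of_real t * g B i p)) * nsq n v * nsq m w"
    if "t \<ge> 0" for B t v w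
    by (rule corner_support_reduction(2)[where g = g, OF kn lin _ bd1 bd2 that]) (fact out)
  have redT: "(1 + t)\<^sup>2 * (cmod (bil m n (\<lambda>p i. g B i p) w v))\<^sup>2 \<le>
      (\<Sum>p<k'. r p * nsq k (\<lambda>i. B i p + complex_of_real t * g B i p)) * nsq m w * nsq n v"
    if "t \<ge> 0" for B t v w
    using redc[OF that, of B v w] unfolding bil_transpose[of m n "g B"]
    by (simp only: mult.assoc mult.commute[of "nsq m w" "nsq n v"])
  have form: "\<exists>s. block_form n m k k' (g B) s" for B
  proof (intro exI, rule block_formI[where \<mu> = \<mu> and r = r, OF mu r kn])
    show "(cmod (bil n m (g B) v w))\<^sup>2 \<le> (\<Sum>i<k. \<mu> i * nsq k' (g B i)) * nsq n v * nsq m w" for v w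
      by (rule resolvent_bound_limit(1)) (rule red)
    have *: "(cmod (bil m n (\<lambda>p i. g B i p) w v))\<^sup>2 \<le> (\<Sum>p<k'. r p * nsq k (\<lambda>i. g B i p)) * nsq m w * nsq n v" for v w
      by (rule resolvent_bound_limit(1)[where B = "\<lambda>p i. B i p"]) (rule redT)
    show "(cmod (bil n m (g B) v w))\<^sup>2 \<le> (\<Sum>p<k'. r p * nsq k (\<lambda>i. g B i p)) * nsq n v * nsq m w" for v w
      using *[of w v] unfolding bil_transpose[of m n "g B"]
      by (simp only: mult.assoc mult.commute[of "nsq m w" "nsq n v"])
  qed
  have pos: "0 < k" "0 < k'" using mu(2) r(2) by (auto intro: gr0I)
  have zero: "g (\<lambda>i p. 0) = (\<lambda>i p. 0)"
    using lin[of "\<lambda>i p. 0" "-1" "\<lambda>i p. 0"] by simp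
  have scale: "g (\<lambda>i p. z * B i p) = (\<lambda>i p. z * g B i p)" for z B
    using lin[of "\<lambda>i p. 0" z B] zero by simp
  obtain s where s: "block_form n m k k' (g B0) s" using form by blast
  have "s \<noteq> 0"
  proof
    assume "s = 0"
    hence "g B0 i p = 0" for i p using block_form_zero s out by metis
    thus False using nz by blast
  qed
  moreover have "s \<ge> 0" using block_formD(1)[OF s pos(1)] nsq_nonneg by metis
  ultimately have s0: "s > 0" by simp
  \<comment> \<open>This factor turns the rows of the corner into unit vectors.\<close>
  define z where "z = complex_of_real (1 / sqrt s)"
  define Z where "Z = (\<lambda>i p. z * g B0 i p)"
  define BZ where "BZ = (\<lambda>i p. z * B0 i p)"
  have gBZ: "g BZ = Z" unfolding BZ_def Z_def scale ..
  obtain s1 where s1: "block_form n m k k' Z s1" using form[of BZ] unfolding gBZ by blast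
  have "nsq k' (Z 0) = (cmod z)\<^sup>2 * nsq k' (g B0 0)"
    unfolding Z_def nsq_def by (simp add: norm_mult power_mult_distrib sum_distrib_left)
  also have "\<dots> = 1" using block_formD(1)[OF s pos(1)] s0 unfolding z_def
    by (simp add: norm_divide power_divide)
  finally have "s1 = 1" using block_formD(1)[OF s1 pos(1)] by simp
  note Z = s1[unfolded this]
  have kk: "k = k'" using block_form_square[OF Z] by simp
  have line: "\<exists>c. \<forall>i p. g B i p = c * Z i p" for B
  proof -
    have "\<exists>c. \<forall>i<n. \<forall>p<m. g B i p = c * Z i p"
    proof (rule block_form_line[where S = "range g"])
      show "\<And>C. C \<in> range g \<Longrightarrow> \<exists>s. block_form n m k k' C s" using form by blast
      show "(\<lambda>i p. C i p + z * C' i p) \<in> range g" if C: "C \<in> range g" "C' \<in> range g" for C C' z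
      proof -
        obtain B B' where B: "C = g B" "C' = g B'" using C by blast
        show ?thesis unfolding B by (rule range_eqI, rule lin[symmetric])
      qed
      show "Z \<in> range g" using gBZ by blast
    qed (use Z pos in auto)
    then obtain c where c: "\<forall>i<n. \<forall>p<m. g B i p = c * Z i p" by blast
    have "g B i p = c * Z i p" for i p
      using c out[of i p B] out[of i p BZ] unfolding gBZ by (cases "i < n \<and> p < m") auto
    thus ?thesis by blast
  qed
  \<comment> \<open>ip carries the weight \<mu> on the row index and ir the weight r on the column
    index, matching the two weighted norms.\<close>
  define ip where "ip = (\<lambda>B. \<Sum>i<k. complex_of_real (\<mu> i) * (\<Sum>p<k'. B i p * cnj (Z i p)))"
  define ir where "ir = (\<lambda>B. \<Sum>p<k'. complex_of_real (r p) * (\<Sum>i<k. B i p * cnj (Z i p)))"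
  have bound: "(cmod c)\<^sup>2 \<le> Re (cnj c * ip B) \<and> (cmod c)\<^sup>2 \<le> Re (cnj c * ir B)"
    if c: "\<forall>i p. g B i p = c * Z i p" for c B
  proof
    have gB: "g B = (\<lambda>i p. c * Z i p)" using c by blast
    have "nsq k' (g B i) = (cmod c)\<^sup>2" if "i < k" for i
    proof -
      have "nsq k' (g B i) = (cmod c)\<^sup>2 * nsq k' (Z i)"
        unfolding gB nsq_def by (simp add: norm_mult power_mult_distrib sum_distrib_left)
      thus ?thesis using block_formD(1)[OF Z that] by simp
    qed
    hence "(cmod c)\<^sup>2 \<le> Re (\<Sum>i<k. complex_of_real (\<mu> i) * (\<Sum>p<k'. B i p * cnj (g B i p)))"
      by (intro block_form_resolvent_bound[where n = n and m = m] red mu kn)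
    also have "(\<Sum>i<k. complex_of_real (\<mu> i) * (\<Sum>p<k'. B i p * cnj (g B i p))) = cnj c * ip B"
      unfolding gB ip_def sum_distrib_left by (intro sum.cong refl) simp
    finally show "(cmod c)\<^sup>2 \<le> Re (cnj c * ip B)" .
    have "nsq k (\<lambda>i. g B i p) = (cmod c)\<^sup>2" if "p < k'" for p
    proof -
      have "nsq k (\<lambda>i. g B i p) = (cmod c)\<^sup>2 * nsq k (\<lambda>i. Z i p)"
        unfolding gB nsq_def by (simp add: norm_mult power_mult_distrib sum_distrib_left)
      thus ?thesis using block_formD(4)[OF Z that] by simp
    qed
    hence "(cmod c)\<^sup>2 \<le> Re (\<Sum>p<k'. complex_of_real (r p) * (\<Sum>i<k. B i p * cnj (g B i p)))"
      by (intro block_form_resolvent_bound[where n = m and m = n and B = "\<lambda>p i. B i p" and C = "\<lambda>p i. g B i p"]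
            redT r kn)
    also have "(\<Sum>p<k'. complex_of_real (r p) * (\<Sum>i<k. B i p * cnj (g B i p))) = cnj c * ir B"
      unfolding gB ir_def sum_distrib_left by (intro sum.cong refl) simp
    finally show "(cmod c)\<^sup>2 \<le> Re (cnj c * ir B)" .
  qed
  have ipZ: "ip Z = 1" unfolding ip_def using block_formD(1)[OF Z] mu(2)
    by (simp add: sum_mult_cnj_self flip: of_real_sum)
  have irZ: "ir Z = 1" unfolding ir_def
    using block_formD(4)[OF Z] r(2) sum_mult_cnj_self[of "\<lambda>i. Z i _" k]
    by (simp flip: of_real_sum)
  have ip_lin: "ip (\<lambda>i p. B i p + z * B' i p) = ip B + z * ip B'" for B B' z
    unfolding ip_def by (simp add: sum.distrib sum_distrib_left algebra_simps)
  have ir_lin: "ir (\<lambda>i p. B i p + z * B' i p) = ir B + z * ir B'" for B B' z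
    unfolding ir_def by (simp add: sum.distrib sum_distrib_left algebra_simps)
  obtain \<kappa> where \<kappa>: "\<forall>i p. g Z i p = \<kappa> * Z i p" using line by blast
  have re: "(cmod \<kappa>)\<^sup>2 \<le> Re \<kappa>" using bound[OF \<kappa>] ipZ by simp
  have gZ: "g Z = (\<lambda>i p. \<kappa> * Z i p)" using \<kappa> by blast
  have kernel: "g B = (\<lambda>i p. 0)" if "ip B = 0 \<or> ir B = 0" for B
  proof -
    obtain c where c: "\<forall>i p. g B i p = c * Z i p" using line by blast
    have "c = 0" using bound[OF c] that by auto
    thus ?thesis using c by auto
  qed
  have gip: "g B = (\<lambda>i p. ip B * \<kappa> * Z i p)" for B
  proof -
    \<comment> \<open>Subtracting ip(B) Z moves B into the kernel of ip, where g is 0.\<close>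
    have "ip (\<lambda>i p. B i p + (- ip B) * Z i p) = 0" unfolding ip_lin ipZ by simp
    hence "g (\<lambda>i p. B i p + (- ip B) * Z i p) = (\<lambda>i p. 0)" using kernel by blast
    hence "g B i p + (- ip B) * (\<kappa> * Z i p) = 0" for i p unfolding lin gZ by meson
    thus ?thesis by (intro ext) (simp add: algebra_simps)
  qed
  have gir: "g B = (\<lambda>i p. ir B * \<kappa> * Z i p)" for B
  proof -
    have "ir (\<lambda>i p. B i p + (- ir B) * Z i p) = 0" unfolding ir_lin irZ by simp
    hence "g (\<lambda>i p. B i p + (- ir B) * Z i p) = (\<lambda>i p. 0)" using kernel by blast
    hence "g B i p + (- ir B) * (\<kappa> * Z i p) = 0" for i p unfolding lin gZ by meson
    thus ?thesis by (intro ext) (simp add: algebra_simps)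
  qed
  obtain i0 p0 where "g B0 i0 p0 \<noteq> 0" using nz by blast
  hence nz': "\<kappa> * Z i0 p0 \<noteq> 0" unfolding gip[of B0] by auto
  \<comment> \<open>One nonzero entry of \<kappa> Z can be cancelled from the two formulas for
    g.\<close>
  have ipr: "ip B = ir B" for B
  proof -
    have "ip B * (\<kappa> * Z i0 p0) = ir B * (\<kappa> * Z i0 p0)"
      using fun_cong[OF fun_cong[OF trans[OF gip[of B, symmetric] gir[of B]]], of i0 p0] by (simp add: mult.assoc)
    thus ?thesis using nz' by simp
  qed
  have supp: "complex_of_real (\<mu> i) * cnj (Z i p) = complex_of_real (r p) * cnj (Z i p)"
    if ip: "i < k" "p < k'" for i p
  proof -
    \<comment> \<open>On the matrix unit at (i, p) both functionals reduce to cnj (Z i p), weighted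
      with \<mu> i and r p respectively.\<close>
    define e :: "nat \<Rightarrow> nat \<Rightarrow> complex" where "e = (\<lambda>a b. (if a = i then 1 else 0) * (if b = p then 1 else 0))"
    have "ip e = complex_of_real (\<mu> i) * cnj (Z i p)"
      unfolding ip_def e_def using ip
      by (simp add: mult.assoc sum_distrib_left[symmetric] sum_mult_delta mult.left_commute
          if_distrib[of "\<lambda>x. x * _"] if_distrib[of "\<lambda>x. _ * x"] cong: if_cong)
    moreover have "ir e = (\<Sum>q<k'. complex_of_real (r q) * (if q = p then cnj (Z i p) else 0))"
      unfolding ir_def e_def using ip by (intro sum.cong refl) (simp add: sum_mult_delta)
    hence "ir e = complex_of_real (r p) * cnj (Z i p)"
      using ip by (simp add: sum_mult_delta)
    ultimately show ?thesis using ipr[of e] by (simp only:)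
  qed
  have mr: "\<mu> j = r j" if "j < k" for j
  proof (rule sorted_eq_of_doubly_stochastic[of k \<mu> r "\<lambda>i p. (cmod (Z i p))\<^sup>2"])
    show "(\<Sum>p<k. (cmod (Z i p))\<^sup>2) = 1" if "i < k" for i
      using block_formD(1)[OF Z that] kk unfolding nsq_def by simp
    show "(\<Sum>i<k. (cmod (Z i p))\<^sup>2) = 1" if "p < k" for p
      using block_formD(4)[OF Z, of p] kk that unfolding nsq_def by simp
    show "\<mu> i = r p" if "i < k" "p < k" "(cmod (Z i p))\<^sup>2 \<noteq> 0" for i p
      using supp[of i p] that kk by simp
  qed (use dec kk that in auto)
  \<comment> \<open>Where Z i p is nonzero, \<mu> i = r p = \<mu> p.\<close>
  have comm: "complex_of_real (\<mu> i) * Z i p = complex_of_real (\<mu> p) * Z i p" if "i < k" "p < k" for i p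
    using supp[of i p] mr[of p] that kk by (cases "Z i p = 0") auto
  have "ir B = (\<Sum>a<k. \<Sum>b<k. complex_of_real (\<mu> b) * cnj (Z a b) * B a b)" for B
    unfolding ir_def kk[symmetric] sum_distrib_left
    by (subst sum.swap) (intro sum.cong refl, use mr in \<open>auto simp: mult_ac\<close>)
  hence formula: "g B i p = \<kappa> * (\<Sum>a<k. \<Sum>b<k. complex_of_real (\<mu> b) * cnj (Z a b) * B a b) * Z i p" for B i p
    using fun_cong[OF fun_cong[OF gir[of B]], of i p] by (simp add: mult_ac)
  show ?thesis
    using kk mr Z re comm formula by blast
qed

section \<open>Passing from maps to bilinear forms\<close>

lemma mat_adjoint_carrier: "A \<in> carrier_mat p q \<Longrightarrow> mat_adjoint A \<in> carrier_mat q p"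
  unfolding mat_adjoint_def by (auto simp: mat_of_rows_def)

lemma mat_adjoint_index:
  "A \<in> carrier_mat p q \<Longrightarrow> i < q \<Longrightarrow> j < p \<Longrightarrow> mat_adjoint A $$ (i, j) = cnj ((A :: complex mat) $$ (j, i))"
  unfolding mat_adjoint_def by (auto simp: mat_of_rows_index)

lemma sum_lessThan_split_add:
  fixes f :: "nat \<Rightarrow> 'a::comm_monoid_add"
  shows "(\<Sum>p<n + m. f p) = (\<Sum>i<n. f i) + (\<Sum>p<m. f (n + p))"
  by (induction m) (simp_all add: add.assoc)

text \<open>Test vectors become functions on the naturals, of which only the first N values matter,
  so that passing to blocks creates no carrier conditions.\<close>

lemma psd_mat_iff:
  "psd_mat N A \<longleftrightarrow> A \<in> carrier_mat N N \<and>
     (\<forall>v. 0 \<le> (\<Sum>p<N. \<Sum>q<N. cnj (v p) * A $$ (p, q) * v q))"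
proof -
  have form: "(A *\<^sub>v v) \<bullet>c v = (\<Sum>p<N. \<Sum>q<N. cnj (v $ p) * A $$ (p, q) * v $ q)"
    if A: "A \<in> carrier_mat N N" and v: "v \<in> carrier_vec N" for v
  proof -
    have "(A *\<^sub>v v) \<bullet>c v = (\<Sum>p<N. (\<Sum>q<N. A $$ (p, q) * v $ q) * cnj (v $ p))"
      using A v by (auto simp: scalar_prod_def atLeast0LessThan intro!: sum.cong)
    thus ?thesis unfolding sum_distrib_right by (simp only: mult_ac)
  qed
  show ?thesis
  proof
    assume psd: "psd_mat N A"
    hence A: "A \<in> carrier_mat N N" unfolding psd_mat_def by blast
    show "A \<in> carrier_mat N N \<and> (\<forall>v. 0 \<le> (\<Sum>p<N. \<Sum>q<N. cnj (v p) * A $$ (p, q) * v q))"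
    proof (intro conjI allI A)
      fix v :: "nat \<Rightarrow> complex"
      have "0 \<le> (A *\<^sub>v vec N v) \<bullet>c vec N v" using psd unfolding psd_mat_def by auto
      thus "0 \<le> (\<Sum>p<N. \<Sum>q<N. cnj (v p) * A $$ (p, q) * v q)"
        using form[OF A, of "vec N v"] by simp
    qed
  next
    assume "A \<in> carrier_mat N N \<and> (\<forall>v. 0 \<le> (\<Sum>p<N. \<Sum>q<N. cnj (v p) * A $$ (p, q) * v q))"
    thus "psd_mat N A" unfolding psd_mat_def using form by auto
  qed
qed

lemma cnj_mult_self_nonneg: "0 \<le> cnj z * (z::complex)"
  by (simp add: less_eq_complex_def)

text \<open>This is v^H (K^H K) v = (K v)^H (K v), with ^H for the adjoint and the rows of K indexed
  by L.\<close>

lemma gram_form: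
  fixes K :: "'l \<Rightarrow> nat \<Rightarrow> complex"
  shows "(\<Sum>p<N. \<Sum>q<N. cnj (v p) * (\<Sum>l\<in>L. cnj (K l p) * K l q) * v q)
    = (\<Sum>l\<in>L. cnj (\<Sum>p<N. K l p * v p) * (\<Sum>q<N. K l q * v q))"
proof -
  have "(\<Sum>p<N. \<Sum>q<N. cnj (v p) * (\<Sum>l\<in>L. cnj (K l p) * K l q) * v q)
      = (\<Sum>p<N. \<Sum>q<N. \<Sum>l\<in>L. cnj (K l p * v p) * (K l q * v q))"
    by (simp add: sum_distrib_left sum_distrib_right mult_ac)
  also have "\<dots> = (\<Sum>p<N. \<Sum>l\<in>L. \<Sum>q<N. cnj (K l p * v p) * (K l q * v q))"
    by (intro sum.cong refl, rule sum.swap)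
  also have "\<dots> = (\<Sum>l\<in>L. \<Sum>p<N. \<Sum>q<N. cnj (K l p * v p) * (K l q * v q))"
    by (rule sum.swap)
  finally show ?thesis by (simp add: sum_product)
qed

lemma psd_mat_gramI:
  fixes K :: "'l \<Rightarrow> nat \<Rightarrow> complex"
  assumes "A \<in> carrier_mat N N"
    and "\<And>p q. p < N \<Longrightarrow> q < N \<Longrightarrow> A $$ (p, q) = (\<Sum>l\<in>L. cnj (K l p) * K l q)"
  shows "psd_mat N A"
proof -
  have "(\<Sum>p<N. \<Sum>q<N. cnj (v p) * A $$ (p, q) * v q)
      = (\<Sum>l\<in>L. cnj (\<Sum>p<N. K l p * v p) * (\<Sum>q<N. K l q * v q))" for v
    unfolding gram_form[symmetric] using assms(2) by (intro sum.cong refl) auto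
  thus ?thesis
    unfolding psd_mat_iff using assms(1) by (simp only: simp_thms) (intro allI sum_nonneg cnj_mult_self_nonneg)
qed

text \<open>The ampliation at m = 1, whose single block is the matrix itself.\<close>

lemma completely_positive_psd:
  assumes cp: "completely_positive N f" and M: "psd_mat N M"
  shows "psd_mat N (f M)"
proof -
  have c: "M \<in> carrier_mat N N" using M unfolding psd_mat_def by blast
  hence fM: "f M \<in> carrier_mat N N" using cp unfolding completely_positive_def mat_linear_def by blast
  have b: "mat_block N M 0 0 = M" unfolding mat_block_def using c by (intro eq_matI) auto
  have "ampliation 1 N f M = f M"
    unfolding ampliation_def using fM b by (intro eq_matI) auto
  moreover have "psd_mat (1 * N) (ampliation 1 N f M)"
    using cp M unfolding completely_positive_def by (metis mult_1)
  ultimately show ?thesis by simp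
qed

lemma mat_linear_diff:
  assumes f: "mat_linear p q f" and A: "A \<in> carrier_mat p q" and B: "B \<in> carrier_mat p q"
  shows "f (A + (-1) \<cdot>\<^sub>m B) = f A + (-1) \<cdot>\<^sub>m f B"
proof -
  have "(-1) \<cdot>\<^sub>m B \<in> carrier_mat p q" using B by simp
  thus ?thesis using f A B unfolding mat_linear_def by metis
qed

text \<open>The map \<Theta> (I + t \<Theta>)^{-1} takes M + t \<Theta>(M) to \<Theta>(M), so no
  inverse has to be computed. For \<open>inv_into\<close> to return M, I + t \<Theta> must be
  injective; otherwise a difference D satisfies \<Theta>(D) = - D / t, which is a negative
  eigenvalue.\<close>

lemma q_positive_resolvent_psd:
  assumes q: "q_positive N \<Theta>" and t: "t \<ge> 0" and M: "M \<in> carrier_mat N N"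
    and psd: "psd_mat N (M + complex_of_real t \<cdot>\<^sub>m \<Theta> M)"
  shows "psd_mat N (\<Theta> M)"
proof -
  define h where "h = (\<lambda>A. A + complex_of_real t \<cdot>\<^sub>m \<Theta> A)"
  have lin: "mat_linear N N \<Theta>" using q unfolding q_positive_def by blast
  have car: "\<Theta> A \<in> carrier_mat N N" if "A \<in> carrier_mat N N" for A
    using lin that unfolding mat_linear_def by blast
  have "inj_on h (carrier_mat N N)"
  proof (rule inj_onI)
    fix A B assume A: "A \<in> carrier_mat N N" and B: "B \<in> carrier_mat N N" and eq: "h A = h B"
    have e: "A $$ (i, j) + complex_of_real t * \<Theta> A $$ (i, j) = B $$ (i, j) + complex_of_real t * \<Theta> B $$ (i, j)"
      if "i < N" "j < N" for i j
      using arg_cong[OF eq, of "\<lambda>X. X $$ (i, j)"] A B car[OF A] car[OF B] that unfolding h_def by auto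
    show "A = B"
    proof (rule ccontr)
      assume ne: "A \<noteq> B"
      have "t \<noteq> 0"
      proof
        assume "t = 0"
        hence "A = B" using e A B by (intro eq_matI) auto
        with ne show False ..
      qed
      hence tp: "t > 0" using t by simp
      define D where "D = A + (-1) \<cdot>\<^sub>m B"
      have D: "D \<in> carrier_mat N N" unfolding D_def using A B by simp
      have \<Theta>D: "\<Theta> D = \<Theta> A + (-1) \<cdot>\<^sub>m \<Theta> B" unfolding D_def by (rule mat_linear_diff[OF lin A B])
      have "\<Theta> D = complex_of_real (- 1 / t) \<cdot>\<^sub>m D"
      proof (rule eq_matI)
        fix i j assume "i < dim_row (complex_of_real (- 1 / t) \<cdot>\<^sub>m D)" "j < dim_col (complex_of_real (- 1 / t) \<cdot>\<^sub>m D)"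
        hence ij: "i < N" "j < N" using D by auto
        have "complex_of_real t * (\<Theta> A $$ (i, j) - \<Theta> B $$ (i, j)) = - (A $$ (i, j) - B $$ (i, j))"
          using e[OF ij] by (simp add: algebra_simps)
        hence "\<Theta> A $$ (i, j) - \<Theta> B $$ (i, j) = complex_of_real (- 1 / t) * (A $$ (i, j) - B $$ (i, j))"
          using tp by (simp add: field_simps)
        thus "\<Theta> D $$ (i, j) = (complex_of_real (- 1 / t) \<cdot>\<^sub>m D) $$ (i, j)"
          unfolding \<Theta>D using ij A B car[OF A] car[OF B] D by (simp add: D_def)
      qed (use car[OF D] D in auto)
      moreover have "D \<noteq> 0\<^sub>m N N"
      proof
        assume "D = 0\<^sub>m N N"
        hence "D $$ (i, j) = 0" if "i < N" "j < N" for i j using that by simp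
        hence "A = B" using A B by (intro eq_matI) (auto simp: D_def)
        with ne show False ..
      qed
      ultimately have "map_eigenvalue N \<Theta> (complex_of_real (- 1 / t))"
        unfolding map_eigenvalue_def using D by blast
      moreover have "- 1 / t < 0" using tp by simp
      ultimately show False using q unfolding q_positive_def by blast
    qed
  qed
  hence inv: "inv_into (carrier_mat N N) h (h M) = M" using M by (simp add: inv_into_f_f)
  have "completely_positive N (\<Theta> \<circ> inv_into (carrier_mat N N) h)"
    using q t unfolding q_positive_def h_def by blast
  from completely_positive_psd[OF this, of "h M"] psd
  show ?thesis using inv by (simp add: h_def)
qed

text \<open>The four blocks in entry form, for arbitrary functionals f and h; in the lower left
  block the two adjoints of \<open>star_map\<close> become two conjugations.\<close>

lemma corner_map_index:
  assumes \<gamma>: "mat_linear n n' \<gamma>"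
    and \<phi>: "\<forall>A \<in> carrier_mat n n. \<phi> A = f A \<cdot>\<^sub>m 1\<^sub>m n"
    and \<psi>: "\<forall>D \<in> carrier_mat n' n'. \<psi> D = h D \<cdot>\<^sub>m 1\<^sub>m n'"
    and M: "M \<in> carrier_mat (n + n') (n + n')"
  shows "corner_map n n' \<phi> \<psi> \<gamma> M \<in> carrier_mat (n + n') (n + n')"
    and "i < n \<Longrightarrow> j < n \<Longrightarrow> corner_map n n' \<phi> \<psi> \<gamma> M $$ (i, j) =
      (if i = j then f (mat n n (\<lambda>(i, j). M $$ (i, j))) else 0)"
    and "i < n \<Longrightarrow> p < n' \<Longrightarrow> corner_map n n' \<phi> \<psi> \<gamma> M $$ (i, n + p) =
      \<gamma> (mat n n' (\<lambda>(i, p). M $$ (i, n + p))) $$ (i, p)"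
    and "i < n \<Longrightarrow> p < n' \<Longrightarrow> corner_map n n' \<phi> \<psi> \<gamma> M $$ (n + p, i) =
      cnj (\<gamma> (mat n n' (\<lambda>(i, p). cnj (M $$ (n + p, i)))) $$ (i, p))"
    and "p < n' \<Longrightarrow> q < n' \<Longrightarrow> corner_map n n' \<phi> \<psi> \<gamma> M $$ (n + p, n + q) =
      (if p = q then h (mat n' n' (\<lambda>(p, q). M $$ (n + p, n + q))) else 0)"
proof -
  define A where "A = mat n n (\<lambda>(i, j). M $$ (i, j))"
  define B where "B = mat n n' (\<lambda>(i, p). M $$ (i, n + p))"
  define C where "C = mat n' n (\<lambda>(p, i). M $$ (n + p, i))"
  define D where "D = mat n' n' (\<lambda>(p, q). M $$ (n + p, n + q))"
  have "split_block M n n = (A, B, C, D)"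
    unfolding split_block_def A_def B_def C_def D_def using M by (simp add: Let_def add.commute)
  hence cm: "corner_map n n' \<phi> \<psi> \<gamma> M = four_block_mat (f A \<cdot>\<^sub>m 1\<^sub>m n) (\<gamma> B) (star_map \<gamma> C) (h D \<cdot>\<^sub>m 1\<^sub>m n')"
    unfolding corner_map_def using bspec[OF \<phi>, of A] bspec[OF \<psi>, of D] by (simp add: A_def D_def)
  have \<gamma>c: "\<gamma> X \<in> carrier_mat n n'" if "X \<in> carrier_mat n n'" for X
    using \<gamma> that unfolding mat_linear_def by blast
  have Cc: "C \<in> carrier_mat n' n" unfolding C_def by simp
  have adj: "mat_adjoint C = mat n n' (\<lambda>(i, p). cnj (M $$ (n + p, i)))"
    using mat_adjoint_carrier[OF Cc] mat_adjoint_index[OF Cc] by (intro eq_matI) (auto simp: C_def)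
  define G where "G = \<gamma> (mat n n' (\<lambda>(i, p). cnj (M $$ (n + p, i))))"
  have G: "G \<in> carrier_mat n n'" unfolding G_def by (rule \<gamma>c) simp
  have star: "star_map \<gamma> C = mat_adjoint G" unfolding star_map_def adj G_def ..
  have B: "\<gamma> B \<in> carrier_mat n n'" by (rule \<gamma>c) (simp add: B_def)
  note adjG = mat_adjoint_carrier[OF G] mat_adjoint_index[OF G]
  show "corner_map n n' \<phi> \<psi> \<gamma> M \<in> carrier_mat (n + n') (n + n')"
    unfolding cm by (rule four_block_carrier_mat) auto
  show "i < n \<Longrightarrow> j < n \<Longrightarrow> corner_map n n' \<phi> \<psi> \<gamma> M $$ (i, j) =
      (if i = j then f (mat n n (\<lambda>(i, j). M $$ (i, j))) else 0)"
    unfolding cm A_def[symmetric] by simp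
  show "i < n \<Longrightarrow> p < n' \<Longrightarrow> corner_map n n' \<phi> \<psi> \<gamma> M $$ (i, n + p) =
      \<gamma> (mat n n' (\<lambda>(i, p). M $$ (i, n + p))) $$ (i, p)"
    unfolding cm B_def[symmetric] by simp
  show "i < n \<Longrightarrow> p < n' \<Longrightarrow> corner_map n n' \<phi> \<psi> \<gamma> M $$ (n + p, i) =
      cnj (\<gamma> (mat n n' (\<lambda>(i, p). cnj (M $$ (n + p, i)))) $$ (i, p))"
    unfolding cm star G_def[symmetric] using adjG by simp
  show "p < n' \<Longrightarrow> q < n' \<Longrightarrow> corner_map n n' \<phi> \<psi> \<gamma> M $$ (n + p, n + q) =
      (if p = q then h (mat n' n' (\<lambda>(p, q). M $$ (n + p, n + q))) else 0)"
    unfolding cm D_def[symmetric] by simp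
qed

text \<open>Testing the block matrix [a I, C; C^H, d I] on a real one-parameter family of vectors
  gives a non-negative quadratic in x. Its discriminant says |b|^4 \<le> |b|^2 a d |v|^2 |w|^2,
  where b is the value of \<open>bil\<close>, and |b|^2 cancels.\<close>

lemma block_diag_form_bound:
  fixes C :: "nat \<Rightarrow> nat \<Rightarrow> complex" and a d :: real
  assumes psd: "psd_mat (n + m) P"
    and P: "\<And>i j. i < n \<Longrightarrow> j < n \<Longrightarrow> P $$ (i, j) = (if i = j then complex_of_real a else 0)"
      "\<And>i p. i < n \<Longrightarrow> p < m \<Longrightarrow> P $$ (i, n + p) = C i p"
      "\<And>i p. i < n \<Longrightarrow> p < m \<Longrightarrow> P $$ (n + p, i) = cnj (C i p)"
      "\<And>p q. p < m \<Longrightarrow> q < m \<Longrightarrow> P $$ (n + p, n + q) = (if p = q then complex_of_real d else 0)"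
    and a: "0 \<le> a" and d: "0 \<le> d"
  shows "(cmod (bil n m C v w))\<^sup>2 \<le> a * d * nsq n v * nsq m w"
proof -
  define b where "b = bil n m C v w"
  have "0 \<le> (a * (cmod b)\<^sup>2 * nsq n v) * x\<^sup>2 - 2 * (cmod b)\<^sup>2 * x + d * nsq m w" for x :: real
  proof -
    \<comment> \<open>The factor b aligns the phases, so that the two cross terms add up to - 2 x
      |b|^2. The \<open>cnj (v p)\<close> in u compensates for \<open>bil\<close> not conjugating
      its first argument.\<close>
    define c where "c = - (complex_of_real x * b)"
    define u where "u = (\<lambda>p. if p < n then c * cnj (v p) else w (p - n))"
    have u: "\<And>i. i < n \<Longrightarrow> u i = c * cnj (v i)" "\<And>p. u (n + p) = w p" unfolding u_def by auto
    have "0 \<le> (\<Sum>p<n + m. \<Sum>q<n + m. cnj (u p) * P $$ (p, q) * u q)"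
      using psd unfolding psd_mat_iff by blast
    also have "\<dots> = (\<Sum>i<n. \<Sum>j<n. cnj (u i) * P $$ (i, j) * u j) + (\<Sum>i<n. \<Sum>p<m. cnj (u i) * P $$ (i, n + p) * u (n + p))
       + ((\<Sum>p<m. \<Sum>i<n. cnj (u (n + p)) * P $$ (n + p, i) * u i) + (\<Sum>p<m. \<Sum>q<m. cnj (u (n + p)) * P $$ (n + p, n + q) * u (n + q)))"
      by (simp add: sum_lessThan_split_add sum.distrib)
    also have "(\<Sum>i<n. \<Sum>j<n. cnj (u i) * P $$ (i, j) * u j) = complex_of_real (a * (cmod c)\<^sup>2 * nsq n v)"
    proof -
      have "(\<Sum>i<n. \<Sum>j<n. cnj (u i) * P $$ (i, j) * u j)
          = (\<Sum>i<n. \<Sum>j<n. cnj (u i) * ((if j = i then complex_of_real a else 0) * u j))"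
        using P(1) by (intro sum.cong refl) auto
      also have "\<dots> = (\<Sum>i<n. cnj (u i) * (complex_of_real a * u i))"
        by (intro sum.cong refl) (simp add: sum_distrib_left[symmetric] sum_mult_delta)
      also have "\<dots> = (\<Sum>i<n. complex_of_real (a * (cmod c)\<^sup>2 * (cmod (v i))\<^sup>2))"
      proof (intro sum.cong refl)
        fix i assume "i \<in> {..<n}"
        hence "cnj (u i) * (complex_of_real a * u i) = complex_of_real a * (c * cnj c) * (v i * cnj (v i))"
          using u by simp
        thus "cnj (u i) * (complex_of_real a * u i) = complex_of_real (a * (cmod c)\<^sup>2 * (cmod (v i))\<^sup>2)"
          by (simp add: complex_norm_square[symmetric])
      qed
      also have "\<dots> = complex_of_real (a * (cmod c)\<^sup>2 * nsq n v)"
        unfolding nsq_def sum_distrib_left of_real_sum ..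
      finally show ?thesis .
    qed
    also have "(\<Sum>p<m. \<Sum>q<m. cnj (u (n + p)) * P $$ (n + p, n + q) * u (n + q)) = complex_of_real (d * nsq m w)"
    proof -
      have "(\<Sum>p<m. \<Sum>q<m. cnj (u (n + p)) * P $$ (n + p, n + q) * u (n + q))
          = (\<Sum>p<m. \<Sum>q<m. cnj (w p) * ((if q = p then complex_of_real d else 0) * w q))"
        using P(4) u by (intro sum.cong refl) auto
      also have "\<dots> = (\<Sum>p<m. cnj (w p) * (complex_of_real d * w p))"
        by (intro sum.cong refl) (simp add: sum_distrib_left[symmetric] sum_mult_delta)
      also have "\<dots> = (\<Sum>p<m. complex_of_real (d * (cmod (w p))\<^sup>2))"
      proof (intro sum.cong refl)
        fix p
        have "cnj (w p) * (complex_of_real d * w p) = complex_of_real d * (w p * cnj (w p))" by simp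
        thus "cnj (w p) * (complex_of_real d * w p) = complex_of_real (d * (cmod (w p))\<^sup>2)"
          by (simp add: complex_norm_square[symmetric])
      qed
      also have "\<dots> = complex_of_real (d * nsq m w)"
        unfolding nsq_def sum_distrib_left of_real_sum ..
      finally show ?thesis .
    qed
    also have "(\<Sum>i<n. \<Sum>p<m. cnj (u i) * P $$ (i, n + p) * u (n + p)) = cnj c * b"
    proof -
      have "(\<Sum>i<n. \<Sum>p<m. cnj (u i) * P $$ (i, n + p) * u (n + p)) = (\<Sum>i<n. \<Sum>p<m. cnj c * (v i * C i p * w p))"
        using P(2) u by (intro sum.cong refl) auto
      thus ?thesis unfolding b_def bil_def sum_distrib_left .
    qed
    also have "(\<Sum>p<m. \<Sum>i<n. cnj (u (n + p)) * P $$ (n + p, i) * u i) = cnj (cnj c * b)"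
    proof -
      have "(\<Sum>p<m. \<Sum>i<n. cnj (u (n + p)) * P $$ (n + p, i) * u i) = (\<Sum>p<m. \<Sum>i<n. cnj (cnj c * (v i * C i p * w p)))"
        using P(3) u by (intro sum.cong refl) auto
      also have "\<dots> = cnj (cnj c * b)"
        unfolding b_def bil_def sum_distrib_left cnj_sum by (rule sum.swap)
      finally show ?thesis .
    qed
    finally have "0 \<le> Re (complex_of_real (a * (cmod c)\<^sup>2 * nsq n v) + cnj c * b + (cnj (cnj c * b) + complex_of_real (d * nsq m w)))"
      by (simp add: less_eq_complex_def)
    moreover have "cnj c * b = - complex_of_real (x * (cmod b)\<^sup>2)"
      unfolding c_def of_real_mult complex_norm_square by simp
    moreover have "(cmod c)\<^sup>2 = x\<^sup>2 * (cmod b)\<^sup>2"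
      unfolding c_def by (simp add: norm_mult power_mult_distrib)
    ultimately show ?thesis by (simp only: complex_cnj_minus complex_cnj_complex_of_real Re_complex_of_real
          plus_complex.simps uminus_complex.simps) (simp add: mult_ac)
  qed
  hence "((cmod b)\<^sup>2)\<^sup>2 \<le> a * (cmod b)\<^sup>2 * nsq n v * (d * nsq m w)"
    by (rule quadratic_nonneg_discriminant) (intro mult_nonneg_nonneg a nsq_nonneg zero_le_power2)
  hence "(cmod b)\<^sup>2 * (cmod b)\<^sup>2 \<le> (cmod b)\<^sup>2 * (a * d * nsq n v * nsq m w)"
    by (simp only: power2_eq_square mult_ac)
  hence "(cmod b)\<^sup>2 \<le> a * d * nsq n v * nsq m w" if "b \<noteq> 0"
    by (rule mult_left_le_imp_le) (use that in simp)
  moreover have "0 \<le> a * d * nsq n v * nsq m w" using a d by (intro mult_nonneg_nonneg nsq_nonneg)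
  ultimately show ?thesis
    unfolding b_def[symmetric] by (cases "b = 0") auto
qed

text \<open>S prescribes M + t \<Theta>(M). If a is the state of its upper left block, that block of
  M is the block of S minus t a / (1 + t) times the identity: its state is a / (1 + t), and adding t
  times this scalar restores S. The lower right block is alike with d.
  \<open>block_diag_form_bound\<close> is then applied to \<Theta>(M), with a / (1 + t) and d / (1 +
  t).\<close>

lemma q_corner_resolvent_bound:
  fixes \<mu> r :: "nat \<Rightarrow> real"
  assumes qc: "q_corner n n' \<phi> \<psi> \<gamma>"
    and \<phi>: "\<forall>A \<in> carrier_mat n n. \<phi> A = (\<Sum>i<k. complex_of_real (\<mu> i) * A $$ (i, i)) \<cdot>\<^sub>m 1\<^sub>m n"
    and \<psi>: "\<forall>D \<in> carrier_mat n' n'. \<psi> D = (\<Sum>i<k'. complex_of_real (r i) * D $$ (i, i)) \<cdot>\<^sub>m 1\<^sub>m n'"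
    and one: "(\<Sum>i<k. \<mu> i) = 1" "(\<Sum>i<k'. r i) = 1" and kn: "k \<le> n" "k' \<le> n'"
    and t: "t \<ge> 0" and B: "B \<in> carrier_mat n n'"
    and S: "psd_mat (n + n') S"
      "\<And>i p. i < n \<Longrightarrow> p < n' \<Longrightarrow> S $$ (i, n + p) = B $$ (i, p) + complex_of_real t * \<gamma> B $$ (i, p)"
      "\<And>i p. i < n \<Longrightarrow> p < n' \<Longrightarrow> S $$ (n + p, i) = cnj (B $$ (i, p) + complex_of_real t * \<gamma> B $$ (i, p))"
    and a: "(\<Sum>i<k. complex_of_real (\<mu> i) * S $$ (i, i)) = complex_of_real a" "0 \<le> a"
    and d: "(\<Sum>p<k'. complex_of_real (r p) * S $$ (n + p, n + p)) = complex_of_real d" "0 \<le> d"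
  shows "(1 + t)\<^sup>2 * (cmod (bil n n' (\<lambda>i p. \<gamma> B $$ (i, p)) v w))\<^sup>2 \<le> a * d * nsq n v * nsq n' w"
proof -
  define \<Theta> where "\<Theta> = corner_map n n' \<phi> \<psi> \<gamma>"
  have \<gamma>: "mat_linear n n' \<gamma>" and q: "q_positive (n + n') \<Theta>"
    using qc unfolding q_corner_def \<Theta>_def by auto
  have Sc: "S \<in> carrier_mat (n + n') (n + n')" using S(1) unfolding psd_mat_def by blast
  define M where "M = mat (n + n') (n + n') (\<lambda>(i, j).
      if i < n \<and> j < n then S $$ (i, j) - (if i = j then complex_of_real (t / (1 + t) * a) else 0)
      else if i < n then B $$ (i, j - n)
      else if j < n then cnj (B $$ (j, i - n))
      else S $$ (i, j) - (if i = j then complex_of_real (t / (1 + t) * d) else 0))"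
  have Mc: "M \<in> carrier_mat (n + n') (n + n')" unfolding M_def by simp
  have M11: "M $$ (i, j) = S $$ (i, j) - (if i = j then complex_of_real (t / (1 + t) * a) else 0)"
    if "i < n" "j < n" for i j unfolding M_def using that by simp
  have M12: "M $$ (i, n + p) = B $$ (i, p)" if "i < n" "p < n'" for i p unfolding M_def using that by simp
  have M21: "M $$ (n + p, i) = cnj (B $$ (i, p))" if "i < n" "p < n'" for i p unfolding M_def using that by simp
  have M22: "M $$ (n + p, n + q) = S $$ (n + p, n + q) - (if p = q then complex_of_real (t / (1 + t) * d) else 0)"
    if "p < n'" "q < n'" for p q unfolding M_def using that by simp
  have U: "mat n n' (\<lambda>(i, p). M $$ (i, n + p)) = B" "mat n n' (\<lambda>(i, p). cnj (M $$ (n + p, i))) = B"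
    using M12 M21 B by (auto intro!: eq_matI)
  have "x - t / (1 + t) * x = x / (1 + t)" for x :: real using t by (simp add: field_simps)
  hence scal: "complex_of_real x - complex_of_real (t / (1 + t) * x) = complex_of_real (x / (1 + t))" for x
    by (metis of_real_diff)
  have "(\<Sum>i<k. complex_of_real (\<mu> i) * mat n n (\<lambda>(i, j). M $$ (i, j)) $$ (i, i))
      = (\<Sum>i<k. complex_of_real (\<mu> i) * S $$ (i, i) - complex_of_real (\<mu> i) * complex_of_real (t / (1 + t) * a))"
    using kn by (intro sum.cong refl) (simp add: M11 right_diff_distrib del: of_real_mult of_real_divide)
  also have "\<dots> = complex_of_real (a / (1 + t))"
    unfolding sum_subtractf a(1) sum_distrib_right[symmetric] of_real_sum[symmetric] one of_real_1 mult_1 by (rule scal)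
  finally have trA: "(\<Sum>i<k. complex_of_real (\<mu> i) * mat n n (\<lambda>(i, j). M $$ (i, j)) $$ (i, i)) = complex_of_real (a / (1 + t))" .
  have "(\<Sum>p<k'. complex_of_real (r p) * mat n' n' (\<lambda>(p, q). M $$ (n + p, n + q)) $$ (p, p))
      = (\<Sum>p<k'. complex_of_real (r p) * S $$ (n + p, n + p) - complex_of_real (r p) * complex_of_real (t / (1 + t) * d))"
    using kn by (intro sum.cong refl) (simp add: M22 right_diff_distrib del: of_real_mult of_real_divide)
  also have "\<dots> = complex_of_real (d / (1 + t))"
    unfolding sum_subtractf d(1) sum_distrib_right[symmetric] of_real_sum[symmetric] one of_real_1 mult_1 by (rule scal)
  finally have trD: "(\<Sum>p<k'. complex_of_real (r p) * mat n' n' (\<lambda>(p, q). M $$ (n + p, n + q)) $$ (p, p)) = complex_of_real (d / (1 + t))" .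
  note ci = corner_map_index[where \<phi> = \<phi> and \<psi> = \<psi>, OF \<gamma> \<phi> \<psi> Mc, folded \<Theta>_def, unfolded U trA trD]
  have "M + complex_of_real t \<cdot>\<^sub>m \<Theta> M = S"
  proof (rule eq_matI)
    fix i j assume "i < dim_row S" "j < dim_col S"
    hence ij: "i < n + n'" "j < n + n'" using Sc by auto
    have e: "(M + complex_of_real t \<cdot>\<^sub>m \<Theta> M) $$ (i, j) = M $$ (i, j) + complex_of_real t * \<Theta> M $$ (i, j)"
      using ij Mc ci(1) by simp
    consider "i < n" "j < n" | p where "i < n" "j = n + p" "p < n'" | p where "i = n + p" "p < n'" "j < n"
      | p q where "i = n + p" "p < n'" "j = n + q" "q < n'"
      using ij by (metis add_diff_inverse_nat nat_add_left_cancel_less)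
    thus "(M + complex_of_real t \<cdot>\<^sub>m \<Theta> M) $$ (i, j) = S $$ (i, j)"
    proof cases
      case 1
      thus ?thesis unfolding e ci(2)[OF 1] M11[OF 1] by simp
    next
      case 2
      thus ?thesis unfolding e using ci(3) M12 S(2) by simp
    next
      case 3
      thus ?thesis unfolding e using ci(4) M21 S(3) by simp
    next
      case 4
      thus ?thesis unfolding e using ci(5) M22 by simp
    qed
  qed (use Mc Sc ci(1) in auto)
  hence "psd_mat (n + n') (\<Theta> M)" using q_positive_resolvent_psd[OF q t Mc] S(1) by simp
  hence "(cmod (bil n n' (\<lambda>i p. \<gamma> B $$ (i, p)) v w))\<^sup>2 \<le> (a / (1 + t)) * (d / (1 + t)) * nsq n v * nsq n' w"
    by (rule block_diag_form_bound) (use ci a(2) d(2) t in auto)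
  also have "\<dots> = (a * d * nsq n v * nsq n' w) / (1 + t)\<^sup>2" by (simp add: power2_eq_square)
  finally show ?thesis using t by (simp add: field_simps)
qed

text \<open>Two positive completions K^H K of the off-diagonal block F = B + t \<gamma>(B). K =
  (F^H, I) gives [F F^H, F; F^H, I], where a is the \<mu>-weighted square norm of the rows of F and
  d = 1. K = (I, F) gives [I, F; F^H, F^H F], where a = 1 and d is the r-weighted square norm of the
  columns.\<close>

lemma q_corner_gram_bounds:
  fixes \<mu> r :: "nat \<Rightarrow> real"
  assumes qc: "q_corner n n' \<phi> \<psi> \<gamma>"
    and \<phi>: "\<forall>A \<in> carrier_mat n n. \<phi> A = (\<Sum>i<k. complex_of_real (\<mu> i) * A $$ (i, i)) \<cdot>\<^sub>m 1\<^sub>m n"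
    and \<psi>: "\<forall>D \<in> carrier_mat n' n'. \<psi> D = (\<Sum>i<k'. complex_of_real (r i) * D $$ (i, i)) \<cdot>\<^sub>m 1\<^sub>m n'"
    and mu: "\<And>i. i < k \<Longrightarrow> \<mu> i > 0" "(\<Sum>i<k. \<mu> i) = 1"
    and r: "\<And>i. i < k' \<Longrightarrow> r i > 0" "(\<Sum>i<k'. r i) = 1" and kn: "k \<le> n" "k' \<le> n'"
    and t: "t \<ge> 0" and B: "B \<in> carrier_mat n n'"
  shows "(1 + t)\<^sup>2 * (cmod (bil n n' (\<lambda>i p. \<gamma> B $$ (i, p)) v w))\<^sup>2 \<le>
      (\<Sum>i<k. \<mu> i * nsq n' (\<lambda>p. B $$ (i, p) + complex_of_real t * \<gamma> B $$ (i, p))) * nsq n v * nsq n' w"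
    and "(1 + t)\<^sup>2 * (cmod (bil n n' (\<lambda>i p. \<gamma> B $$ (i, p)) v w))\<^sup>2 \<le>
      (\<Sum>p<k'. r p * nsq n (\<lambda>i. B $$ (i, p) + complex_of_real t * \<gamma> B $$ (i, p))) * nsq n v * nsq n' w"
proof -
  define F where "F = (\<lambda>i p. B $$ (i, p) + complex_of_real t * \<gamma> B $$ (i, p))"
  note bound = q_corner_resolvent_bound[OF qc \<phi> \<psi> mu(2) r(2) kn t B]
  show "(1 + t)\<^sup>2 * (cmod (bil n n' (\<lambda>i p. \<gamma> B $$ (i, p)) v w))\<^sup>2 \<le>
      (\<Sum>i<k. \<mu> i * nsq n' (\<lambda>p. B $$ (i, p) + complex_of_real t * \<gamma> B $$ (i, p))) * nsq n v * nsq n' w"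
  proof -
    define K where "K = (\<lambda>l q. if q < n then cnj (F q l) else if q = n + l then 1 else 0)"
    define S where "S = mat (n + n') (n + n') (\<lambda>(p, q). \<Sum>l<n'. cnj (K l p) * K l q)"
    define a where "a = (\<Sum>i<k. \<mu> i * nsq n' (F i))"
    have K: "K l i = cnj (F i l)" "K l (n + p) = (if p = l then 1 else 0)" if "i < n" for l i p
      unfolding K_def using that by auto
    have S: "S $$ (p, q) = (\<Sum>l<n'. cnj (K l p) * K l q)" if "p < n + n'" "q < n + n'" for p q
      unfolding S_def using that by simp
    have "(1 + t)\<^sup>2 * (cmod (bil n n' (\<lambda>i p. \<gamma> B $$ (i, p)) v w))\<^sup>2 \<le> a * 1 * nsq n v * nsq n' w"
    proof (rule bound)
      show "psd_mat (n + n') S" by (rule psd_mat_gramI[OF _ S]) (auto simp: S_def)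
      show "S $$ (i, n + p) = B $$ (i, p) + complex_of_real t * \<gamma> B $$ (i, p)" if "i < n" "p < n'" for i p
        using that by (simp add: S K[OF that(1)] if_distrib[of "\<lambda>x. _ * x"] F_def cong: if_cong)
      show "S $$ (n + p, i) = cnj (B $$ (i, p) + complex_of_real t * \<gamma> B $$ (i, p))" if "i < n" "p < n'" for i p
        using that by (simp add: S K[OF that(1)] if_distrib[of cnj] if_distrib[of "\<lambda>x. x * _"] F_def cong: if_cong)
      have "S $$ (i, i) = complex_of_real (nsq n' (F i))" if "i < n" for i
        using that by (simp add: S K[OF that] sum_mult_cnj_self)
      thus "(\<Sum>i<k. complex_of_real (\<mu> i) * S $$ (i, i)) = complex_of_real a"
        unfolding a_def using kn by simp
      show "0 \<le> a" unfolding a_def using mu(1)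
        by (intro sum_nonneg mult_nonneg_nonneg nsq_nonneg) (auto intro: less_imp_le)
      have "S $$ (n + p, n + p) = 1" if "p < n'" for p
        using that unfolding S[of "n + p" "n + p"]
        by (simp add: S K_def if_distrib[of cnj] if_distrib[of "\<lambda>x. x * _"] cong: if_cong)
      thus "(\<Sum>p<k'. complex_of_real (r p) * S $$ (n + p, n + p)) = complex_of_real 1"
        using kn r(2) by (simp flip: of_real_sum)
    qed simp
    thus ?thesis unfolding a_def F_def by simp
  qed
  show "(1 + t)\<^sup>2 * (cmod (bil n n' (\<lambda>i p. \<gamma> B $$ (i, p)) v w))\<^sup>2 \<le>
      (\<Sum>p<k'. r p * nsq n (\<lambda>i. B $$ (i, p) + complex_of_real t * \<gamma> B $$ (i, p))) * nsq n v * nsq n' w"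
  proof -
    define K where "K = (\<lambda>l q. if q < n then if q = l then 1 else 0 else F l (q - n))"
    define S where "S = mat (n + n') (n + n') (\<lambda>(p, q). \<Sum>l<n. cnj (K l p) * K l q)"
    define d where "d = (\<Sum>p<k'. r p * nsq n (\<lambda>i. F i p))"
    have K: "i < n \<Longrightarrow> K l i = (if i = l then 1 else 0)" "K l (n + p) = F l p" for l i p
      unfolding K_def by auto
    have S: "S $$ (p, q) = (\<Sum>l<n. cnj (K l p) * K l q)" if "p < n + n'" "q < n + n'" for p q
      unfolding S_def using that by simp
    have "(1 + t)\<^sup>2 * (cmod (bil n n' (\<lambda>i p. \<gamma> B $$ (i, p)) v w))\<^sup>2 \<le> 1 * d * nsq n v * nsq n' w"
    proof (rule bound)
      show "psd_mat (n + n') S" by (rule psd_mat_gramI[OF _ S]) (auto simp: S_def)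
      show "S $$ (i, n + p) = B $$ (i, p) + complex_of_real t * \<gamma> B $$ (i, p)" if "i < n" "p < n'" for i p
        using that by (simp add: S K if_distrib[of cnj] if_distrib[of "\<lambda>x. x * _"] F_def cong: if_cong)
      show "S $$ (n + p, i) = cnj (B $$ (i, p) + complex_of_real t * \<gamma> B $$ (i, p))" if "i < n" "p < n'" for i p
        using that by (simp add: S K if_distrib[of "\<lambda>x. _ * x"] F_def cong: if_cong)
      have "S $$ (n + p, n + p) = complex_of_real (nsq n (\<lambda>i. F i p))" if "p < n'" for p
        using that sum_mult_cnj_self[of "\<lambda>i. F i p" n] by (simp add: S K mult.commute)
      thus "(\<Sum>p<k'. complex_of_real (r p) * S $$ (n + p, n + p)) = complex_of_real d"
        unfolding d_def using kn by simp
      show "0 \<le> d" unfolding d_def using r(1)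
        by (intro sum_nonneg mult_nonneg_nonneg nsq_nonneg) (auto intro: less_imp_le)
      have "S $$ (i, i) = 1" if "i < n" for i
        using that by (simp add: S K if_distrib[of cnj] if_distrib[of "\<lambda>x. x * _"] cong: if_cong)
      thus "(\<Sum>i<k. complex_of_real (\<mu> i) * S $$ (i, i)) = complex_of_real 1"
        using kn mu(2) by (simp flip: of_real_sum)
    qed simp
    thus ?thesis unfolding d_def F_def by simp
  qed
qed

text \<open>Transfer between matrices and total functions: g pads \<gamma> with 0 outside the n by
  n' range, so that linearity becomes an equality of functions, and \<open>mt\<close> cuts a
  function back to a matrix.\<close>

lemma q_corner_nonzero_form:
  fixes \<mu> r :: "nat \<Rightarrow> real"
  assumes qc: "q_corner n n' \<phi> \<psi> \<gamma>"
    and \<phi>: "\<forall>A \<in> carrier_mat n n. \<phi> A = (\<Sum>i<k. complex_of_real (\<mu> i) * A $$ (i, i)) \<cdot>\<^sub>m 1\<^sub>m n"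
    and \<psi>: "\<forall>D \<in> carrier_mat n' n'. \<psi> D = (\<Sum>i<k'. complex_of_real (r i) * D $$ (i, i)) \<cdot>\<^sub>m 1\<^sub>m n'"
    and mu: "\<And>i. i < k \<Longrightarrow> \<mu> i > 0" "(\<Sum>i<k. \<mu> i) = 1"
    and r: "\<And>i. i < k' \<Longrightarrow> r i > 0" "(\<Sum>i<k'. r i) = 1"
    and dec: "\<And>i j. i \<le> j \<Longrightarrow> j < k \<Longrightarrow> \<mu> j \<le> \<mu> i" "\<And>i j. i \<le> j \<Longrightarrow> j < k' \<Longrightarrow> r j \<le> r i"
    and kn: "k \<le> n" "k' \<le> n'"
    and nz: "B0 \<in> carrier_mat n n'" "\<gamma> B0 \<noteq> 0\<^sub>m n n'"
  shows "\<exists>Z \<kappa>. k = k' \<and> (\<forall>i<k. \<mu> i = r i) \<and> block_form n n' k k' Z 1 \<and> (cmod \<kappa>)\<^sup>2 \<le> Re \<kappa> \<and>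
    (\<forall>i<k. \<forall>p<k. complex_of_real (\<mu> i) * Z i p = complex_of_real (\<mu> p) * Z i p) \<and>
    (\<forall>B \<in> carrier_mat n n'. \<gamma> B = mat n n' (\<lambda>(i, p).
       \<kappa> * (\<Sum>a<k. \<Sum>b<k. complex_of_real (\<mu> b) * cnj (Z a b) * B $$ (a, b)) * Z i p))"
proof -
  have \<gamma>: "mat_linear n n' \<gamma>" using qc unfolding q_corner_def by blast
  have \<gamma>c: "\<gamma> X \<in> carrier_mat n n'" if "X \<in> carrier_mat n n'" for X
    using \<gamma> that unfolding mat_linear_def by blast
  define mt where "mt = (\<lambda>B :: nat \<Rightarrow> nat \<Rightarrow> complex. mat n n' (\<lambda>(i, p). B i p))"
  define g where "g = (\<lambda>B i p. if i < n \<and> p < n' then \<gamma> (mt B) $$ (i, p) else 0)"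
  have mtc: "mt B \<in> carrier_mat n n'" for B unfolding mt_def by simp
  have mti: "mt B $$ (i, p) = B i p" if "i < n" "p < n'" for B i p unfolding mt_def using that by simp
  have gi: "g B i p = \<gamma> (mt B) $$ (i, p)" if "i < n" "p < n'" for B i p unfolding g_def using that by simp
  have lin: "g (\<lambda>i p. B i p + z * B' i p) = (\<lambda>i p. g B i p + z * g B' i p)" for B B' z
  proof -
    have "mt (\<lambda>i p. B i p + z * B' i p) = mt B + z \<cdot>\<^sub>m mt B'"
      unfolding mt_def by (intro eq_matI) auto
    moreover have "z \<cdot>\<^sub>m mt B' \<in> carrier_mat n n'" using mtc by simp
    ultimately have "\<gamma> (mt (\<lambda>i p. B i p + z * B' i p)) = \<gamma> (mt B) + z \<cdot>\<^sub>m \<gamma> (mt B')"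
      using \<gamma> mtc unfolding mat_linear_def by metis
    thus ?thesis unfolding g_def using \<gamma>c[OF mtc[of B]] \<gamma>c[OF mtc[of B']] by (intro ext) auto
  qed
  have bil: "bil n n' (\<lambda>i p. \<gamma> (mt B) $$ (i, p)) v w = bil n n' (g B) v w" for B v w
    unfolding bil_def by (intro sum.cong refl) (simp add: gi)
  have ns1: "nsq n' (\<lambda>p. mt B $$ (i, p) + complex_of_real t * \<gamma> (mt B) $$ (i, p))
      = nsq n' (\<lambda>p. B i p + complex_of_real t * g B i p)" if "i < k" for B i t
    unfolding nsq_def using that kn by (intro sum.cong refl) (simp add: gi mti)
  have ns2: "nsq n (\<lambda>i. mt B $$ (i, p) + complex_of_real t * \<gamma> (mt B) $$ (i, p))
      = nsq n (\<lambda>i. B i p + complex_of_real t * g B i p)" if "p < k'" for B p t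
    unfolding nsq_def using that kn by (intro sum.cong refl) (simp add: gi mti)
  have bd1: "(1 + t)\<^sup>2 * (cmod (bil n n' (g B) v w))\<^sup>2 \<le>
      (\<Sum>i<k. \<mu> i * nsq n' (\<lambda>p. B i p + complex_of_real t * g B i p)) * nsq n v * nsq n' w" if "t \<ge> 0" for B t v w
    using q_corner_gram_bounds(1)[OF qc \<phi> \<psi> mu r kn that mtc, of B v w] unfolding bil by (simp add: ns1)
  have bd2: "(1 + t)\<^sup>2 * (cmod (bil n n' (g B) v w))\<^sup>2 \<le>
      (\<Sum>p<k'. r p * nsq n (\<lambda>i. B i p + complex_of_real t * g B i p)) * nsq n v * nsq n' w" if "t \<ge> 0" for B t v w
    using q_corner_gram_bounds(2)[OF qc \<phi> \<psi> mu r kn that mtc, of B v w] unfolding bil by (simp add: ns2)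
  have mtB: "mt (\<lambda>i p. B $$ (i, p)) = B" if "B \<in> carrier_mat n n'" for B
    unfolding mt_def using that by (intro eq_matI) auto
  have nzg: "g (\<lambda>i p. B0 $$ (i, p)) \<noteq> (\<lambda>i p. 0)"
  proof
    assume "g (\<lambda>i p. B0 $$ (i, p)) = (\<lambda>i p. 0)"
    hence "\<gamma> B0 $$ (i, p) = 0" if "i < n" "p < n'" for i p
      using gi[OF that, of "\<lambda>i p. B0 $$ (i, p)"] unfolding mtB[OF nz(1)] by simp
    hence "\<gamma> B0 = 0\<^sub>m n n'" using \<gamma>c[OF nz(1)] by (intro eq_matI) auto
    with nz(2) show False ..
  qed
  have "\<exists>Z \<kappa>. k = k' \<and> (\<forall>i<k. \<mu> i = r i) \<and> block_form n n' k k' Z 1 \<and> (cmod \<kappa>)\<^sup>2 \<le> Re \<kappa> \<and>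
    (\<forall>i<k. \<forall>p<k. complex_of_real (\<mu> i) * Z i p = complex_of_real (\<mu> p) * Z i p) \<and>
    (\<forall>B. \<forall>i<n. \<forall>p<n'. g B i p =
       \<kappa> * (\<Sum>a<k. \<Sum>b<k. complex_of_real (\<mu> b) * cnj (Z a b) * B a b) * Z i p)"
    by (rule corner_range_classification[where g = g and \<mu> = \<mu> and r = r, OF mu r dec kn lin _ bd1 bd2 nzg])
      (auto simp: g_def)
  then obtain Z \<kappa> where *: "k = k'" "\<forall>i<k. \<mu> i = r i" "block_form n n' k k' Z 1" "(cmod \<kappa>)\<^sup>2 \<le> Re \<kappa>"
    "\<forall>i<k. \<forall>p<k. complex_of_real (\<mu> i) * Z i p = complex_of_real (\<mu> p) * Z i p"
    and f: "\<And>B i p. i < n \<Longrightarrow> p < n' \<Longrightarrow> g B i p =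
       \<kappa> * (\<Sum>a<k. \<Sum>b<k. complex_of_real (\<mu> b) * cnj (Z a b) * B a b) * Z i p"
    by blast
  have "\<gamma> B = mat n n' (\<lambda>(i, p).
       \<kappa> * (\<Sum>a<k. \<Sum>b<k. complex_of_real (\<mu> b) * cnj (Z a b) * B $$ (a, b)) * Z i p)"
    if B: "B \<in> carrier_mat n n'" for B
  proof (rule eq_matI)
    fix i p assume "i < dim_row (mat n n' (\<lambda>(i, p).
       \<kappa> * (\<Sum>a<k. \<Sum>b<k. complex_of_real (\<mu> b) * cnj (Z a b) * B $$ (a, b)) * Z i p))"
      "p < dim_col (mat n n' (\<lambda>(i, p).
       \<kappa> * (\<Sum>a<k. \<Sum>b<k. complex_of_real (\<mu> b) * cnj (Z a b) * B $$ (a, b)) * Z i p))"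
    hence ip: "i < n" "p < n'" by auto
    show "\<gamma> B $$ (i, p) = mat n n' (\<lambda>(i, p).
       \<kappa> * (\<Sum>a<k. \<Sum>b<k. complex_of_real (\<mu> b) * cnj (Z a b) * B $$ (a, b)) * Z i p) $$ (i, p)"
      using gi[OF ip, of "\<lambda>i p. B $$ (i, p)"] f[OF ip, of "\<lambda>i p. B $$ (i, p)"] ip
      unfolding mtB[OF B] by simp
  qed (use \<gamma>c[OF B] in auto)
  thus ?thesis using * by blast
qed

section \<open>Complete positivity and resolvents\<close>

lemma quadratic_form_Suc:
  fixes P :: "nat \<Rightarrow> nat \<Rightarrow> complex"
  shows "(\<Sum>p<Suc n. \<Sum>q<Suc n. cnj (v p) * P p q * v q) =
    (\<Sum>p<n. \<Sum>q<n. cnj (v p) * P p q * v q) + (\<Sum>p<n. cnj (v p) * P p n) * v n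
    + cnj (v n) * (\<Sum>q<n. P n q * v q) + cnj (v n) * P n n * v n"
  by (simp add: sum.distrib sum_distrib_left sum_distrib_right algebra_simps)

text \<open>\<open>0 \<le>\<close> on complex numbers includes being real, so the form is real at
  e_i + z e_j for every z. The values at z = 0, 1, -1, \<open>\<i>\<close>, \<open>-\<i>\<close>
  separate the entries.\<close>

lemma quadratic_form_nonneg_hermitian:
  fixes P :: "nat \<Rightarrow> nat \<Rightarrow> complex"
  assumes pos: "\<And>v. 0 \<le> (\<Sum>p<N. \<Sum>q<N. cnj (v p) * P p q * v q)" and ij: "i < N" "j < N"
  shows "P i j = cnj (P j i)"
proof -
  define e where "e = (\<lambda>z p. (if p = i then 1 else 0) + (if p = j then z else (0::complex)))"
  have ev: "(\<Sum>p<N. \<Sum>q<N. cnj (e z p) * P p q * e z q) = (P i i + P i j * z) + cnj z * (P j i + P j j * z)" for z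
  proof -
    have "(\<Sum>p<N. \<Sum>q<N. cnj (e z p) * P p q * e z q) = (\<Sum>p<N. cnj (e z p) * (\<Sum>q<N. P p q * e z q))"
      by (simp add: sum_distrib_left mult.assoc)
    also have "\<dots> = (\<Sum>p<N. ((if p = i then 1 else 0) + (if p = j then cnj z else 0)) * (P p i + P p j * z))"
      unfolding e_def using ij by (intro sum.cong refl) (simp add: distrib_left sum.distrib sum_mult_delta)
    also have "\<dots> = (P i i + P i j * z) + cnj z * (P j i + P j j * z)"
      using ij by (simp add: distrib_right sum.distrib sum_mult_delta)
    finally show ?thesis .
  qed
  have real: "Im ((P i i + P i j * z) + cnj z * (P j i + P j j * z)) = 0" for z
    using pos[of "e z"] unfolding ev less_eq_complex_def by simp
  show ?thesis
    using real[of 0] real[of 1] real[of "-1"] real[of \<i>] real[of "-\<i>"] by (simp add: complex_eq_iff)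
qed

text \<open>Cholesky factorization, peeling off the last index by a Schur complement.\<close>

lemma quadratic_form_nonneg_factor:
  fixes P :: "nat \<Rightarrow> nat \<Rightarrow> complex"
  assumes "\<And>v. 0 \<le> (\<Sum>p<n. \<Sum>q<n. cnj (v p) * P p q * v q)"
  shows "\<exists>R. \<forall>p<n. \<forall>q<n. P p q = (\<Sum>l<n. cnj (R l p) * R l q)"
  using assms
proof (induction n arbitrary: P)
  case 0
  show ?case by simp
next
  case (Suc n)
  note herm = quadratic_form_nonneg_hermitian[OF Suc.prems]
  have sub: "(\<Sum>p<n. cnj (v p) * P p n) = cnj (\<Sum>q<n. P n q * v q)" for v
    unfolding cnj_sum using herm[of _ n] by (intro sum.cong refl) simp
  define d where "d = Re (P n n)"
  have "P n n = cnj (P n n)" using herm[of n n] by simp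
  hence Pd: "P n n = complex_of_real d" unfolding d_def by (simp add: complex_eq_iff)
  define y where "y = (\<lambda>v. \<Sum>q<n. P n q * v q)"
  have pos: "0 \<le> (\<Sum>p<n. \<Sum>q<n. cnj (v p) * P p q * v q) + cnj (y v) * z + cnj z * y v + cnj z * complex_of_real d * z"
    for v z
  proof -
    have "(\<Sum>p<Suc n. \<Sum>q<Suc n. cnj ((v(n := z)) p) * P p q * (v(n := z)) q)
       = (\<Sum>p<n. \<Sum>q<n. cnj (v p) * P p q * v q) + cnj (y v) * z + cnj z * y v + cnj z * complex_of_real d * z"
      unfolding quadratic_form_Suc sub Pd[symmetric] y_def by simp
    thus ?thesis using Suc.prems[of "v(n := z)"] by (simp only:)
  qed
  have d0: "0 \<le> d" using pos[of "\<lambda>_. 0" 1] unfolding y_def by (simp add: less_eq_complex_def)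
  \<comment> \<open>The value 0 is for the degenerate pivot d = 0, where the rest of the last row
    vanishes as well.\<close>
  define c where "c = (if d = 0 then 0 else 1 / complex_of_real d)"
  have yd: "d = 0 \<Longrightarrow> y v = 0" for v
  proof -
    assume "d = 0"
    define Q where "Q = Re (\<Sum>p<n. \<Sum>q<n. cnj (v p) * P p q * v q)"
    \<comment> \<open>For d = 0 this is the form at last coordinate - t y(v); it can stay
      non-negative for all t only if y(v) = 0.\<close>
    have "0 \<le> Q + (- (2 * (cmod (y v))\<^sup>2)) * t" for t
    proof -
      have "0 \<le> Re ((\<Sum>p<n. \<Sum>q<n. cnj (v p) * P p q * v q) + cnj (y v) * (- complex_of_real t * y v)
          + cnj (- complex_of_real t * y v) * y v + cnj (- complex_of_real t * y v) * complex_of_real d * (- complex_of_real t * y v))"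
        using pos[of v "- complex_of_real t * y v"] unfolding less_eq_complex_def by simp
      also have "\<dots> = Q + (- (2 * (cmod (y v))\<^sup>2)) * t"
        unfolding Q_def \<open>d = 0\<close> cmod_power2 by (simp add: power2_eq_square algebra_simps)
      finally show ?thesis .
    qed
    hence "0 \<le> - (2 * (cmod (y v))\<^sup>2)"
      by (rule affine_nonneg_slope)
    thus "y v = 0" by simp
  qed
  have "\<exists>R. \<forall>p<n. \<forall>q<n. P p q - c * cnj (P n p) * P n q = (\<Sum>l<n. cnj (R l p) * R l q)"
  proof (rule Suc.IH)
    fix v
    have "(\<Sum>p<n. \<Sum>q<n. cnj (v p) * (P p q - c * cnj (P n p) * P n q) * v q)
       = (\<Sum>p<n. \<Sum>q<n. cnj (v p) * P p q * v q) - c * (cnj (y v) * y v)"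
      unfolding y_def cnj_sum sum_product
      by (simp add: sum_subtractf[symmetric] sum_distrib_left algebra_simps)
    \<comment> \<open>The Schur complement at v is the full form with the minimizing last coordinate
      - c y(v), hence non-negative.\<close>
    also have "\<dots> = (\<Sum>p<n. \<Sum>q<n. cnj (v p) * P p q * v q) + cnj (y v) * (- c * y v) + cnj (- c * y v) * y v
        + cnj (- c * y v) * complex_of_real d * (- c * y v)"
      using yd[of v] unfolding c_def by (auto simp: field_simps)
    finally show "0 \<le> (\<Sum>p<n. \<Sum>q<n. cnj (v p) * (P p q - c * cnj (P n p) * P n q) * v q)"
      using pos[of v "- c * y v"] by simp
  qed
  then obtain R where R: "\<And>p q. p < n \<Longrightarrow> q < n \<Longrightarrow>
      P p q - c * cnj (P n p) * P n q = (\<Sum>l<n. cnj (R l p) * R l q)" by blast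
  \<comment> \<open>The new row of the factor is P n q / sqrt d followed by sqrt d, or 0 if d = 0;
    the old rows are continued by 0.\<close>
  define S where "S = (\<lambda>l q. if l < n then if q < n then R l q else 0
      else if q < n then complex_of_real (if d = 0 then 0 else 1 / sqrt d) * P n q else complex_of_real (sqrt d))"
  have Pn0: "P n q = 0" if "d = 0" "q < n" for q
    using yd[OF that(1), of "\<lambda>l. if l = q then 1 else 0"] that(2) unfolding y_def by (simp add: sum_mult_delta)
  have "P p q = (\<Sum>l<Suc n. cnj (S l p) * S l q)" if pq: "p < Suc n" "q < Suc n" for p q
  proof -
    have sq: "complex_of_real (sqrt d) * complex_of_real (sqrt d) = complex_of_real d"
      using d0 by (simp flip: of_real_mult)
    consider "p < n" "q < n" | "p < n" "q = n" | "p = n" "q < n" | "p = n" "q = n" using pq by linarith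
    thus ?thesis
    proof cases
      case 1
      have "(\<Sum>l<n. cnj (S l p) * S l q) = P p q - c * cnj (P n p) * P n q"
        unfolding R[OF 1] using 1 by (simp add: S_def)
      moreover have "cnj (S n p) * S n q = c * cnj (P n p) * P n q"
        unfolding S_def c_def using 1 sq by (simp add: field_simps)
      ultimately show ?thesis by simp
    next
      case 2
      have "(\<Sum>l<n. cnj (S l p) * S l q) = 0" unfolding S_def using 2 by simp
      moreover have "cnj (S n p) * S n q = P p n"
        using 2 Pn0[of p] herm[of p n] d0 unfolding S_def by auto
      ultimately show ?thesis using 2 by simp
    next
      case 3
      have "(\<Sum>l<n. cnj (S l p) * S l q) = 0" unfolding S_def using 3 by simp
      moreover have "cnj (S n p) * S n q = P n q"
        using 3 Pn0[of q] d0 unfolding S_def by auto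
      ultimately show ?thesis using 3 by simp
    next
      case 4
      have "(\<Sum>l<n. cnj (S l p) * S l q) = 0" unfolding S_def using 4 by simp
      moreover have "cnj (S n p) * S n q = P n n"
        using 4 sq Pd unfolding S_def by simp
      ultimately show ?thesis using 4 by simp
    qed
  qed
  thus ?case by blast
qed

section \<open>Kraus form, complete positivity and resolvents\<close>

lemma sum_lessThan_mult:
  fixes f :: "nat \<Rightarrow> 'a::comm_monoid_add"
  shows "(\<Sum>p<m * N. f p) = (\<Sum>a<m. \<Sum>i<N. f (a * N + i))"
proof (induction m)
  case (Suc m)
  have "(\<Sum>p<Suc m * N. f p) = (\<Sum>p<m * N + N. f p)" by (simp add: add.commute)
  thus ?case unfolding sum_lessThan_split_add Suc.IH by simp
qed simp

text \<open>Moves K and L onto the test vectors: x^T (K A L^T) y = (x^T K) A (L^T y), with ^T for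
  the transpose.\<close>

lemma sum_kraus_swap:
  fixes K L :: "nat \<Rightarrow> nat \<Rightarrow> complex"
  shows "(\<Sum>p<N. \<Sum>q<N. x p * (\<Sum>s<N. K p s * (\<Sum>s'<N. A s s' * L q s')) * y q)
    = (\<Sum>s<N. \<Sum>s'<N. (\<Sum>p<N. x p * K p s) * A s s' * (\<Sum>q<N. L q s' * y q))"
proof -
  have "(\<Sum>p<N. \<Sum>q<N. x p * (\<Sum>s<N. K p s * (\<Sum>s'<N. A s s' * L q s')) * y q)
    = (\<Sum>p<N. \<Sum>q<N. \<Sum>s<N. \<Sum>s'<N. x p * K p s * A s s' * (L q s' * y q))"
    by (simp add: sum_distrib_left sum_distrib_right mult.assoc)
  also have "\<dots> = (\<Sum>p<N. \<Sum>s<N. \<Sum>q<N. \<Sum>s'<N. x p * K p s * A s s' * (L q s' * y q))"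
    by (rule sum.cong[OF refl], rule sum.swap)
  also have "\<dots> = (\<Sum>s<N. \<Sum>p<N. \<Sum>q<N. \<Sum>s'<N. x p * K p s * A s s' * (L q s' * y q))"
    by (rule sum.swap)
  also have "\<dots> = (\<Sum>s<N. \<Sum>p<N. \<Sum>s'<N. \<Sum>q<N. x p * K p s * A s s' * (L q s' * y q))"
    by (rule sum.cong[OF refl], rule sum.cong[OF refl], rule sum.swap)
  also have "\<dots> = (\<Sum>s<N. \<Sum>s'<N. \<Sum>p<N. \<Sum>q<N. x p * K p s * A s s' * (L q s' * y q))"
    by (rule sum.cong[OF refl], rule sum.swap)
  also have "\<dots> = (\<Sum>s<N. \<Sum>s'<N. (\<Sum>p<N. x p * K p s) * A s s' * (\<Sum>q<N. L q s' * y q))"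
    by (simp only: sum_distrib_right, simp only: sum_distrib_left mult.assoc)
  finally show ?thesis .
qed

lemma mat_block_carrier: "mat_block N A a b \<in> carrier_mat N N"
  unfolding mat_block_def by simp

text \<open>The form of the ampliation at v is the sum over l of c l times the form of A at (I
  \<otimes> K_l^H) v. Keeping the weights apart from K avoids square roots of the \<mu> i.\<close>

lemma completely_positive_krausI:
  fixes K :: "'l \<Rightarrow> nat \<Rightarrow> nat \<Rightarrow> complex" and c :: "'l \<Rightarrow> real"
  assumes lin: "mat_linear N N f" and c: "\<And>l. l \<in> L \<Longrightarrow> 0 \<le> c l"
    and f: "\<And>A p q. A \<in> carrier_mat N N \<Longrightarrow> p < N \<Longrightarrow> q < N \<Longrightarrow>
      f A $$ (p, q) = (\<Sum>l\<in>L. complex_of_real (c l) * (\<Sum>s<N. K l p s * (\<Sum>s'<N. A $$ (s, s') * cnj (K l q s'))))"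
  shows "completely_positive N f"
  unfolding completely_positive_def
proof (intro conjI allI impI lin)
  fix m A assume psd: "psd_mat (m * N) A"
  hence A: "A \<in> carrier_mat (m * N) (m * N)" unfolding psd_mat_def by blast
  let ?G = "ampliation m N f A"
  have idx: "a * N + p < m * N" if "a < m" "p < N" for a p
  proof -
    have "a * N + p < Suc a * N" using that by simp
    also have "\<dots> \<le> m * N" using that by (intro mult_le_mono1) simp
    finally show ?thesis .
  qed
  have G: "?G $$ (a * N + p, b * N + q)
      = (\<Sum>l\<in>L. complex_of_real (c l) * (\<Sum>s<N. K l p s * (\<Sum>s'<N. A $$ (a * N + s, b * N + s') * cnj (K l q s'))))"
    if "a < m" "b < m" "p < N" "q < N" for a b p q
  proof -
    have "?G $$ (a * N + p, b * N + q) = f (mat_block N A a b) $$ (p, q)"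
      unfolding ampliation_def using idx that by simp
    thus ?thesis
      unfolding f[OF mat_block_carrier that(3,4)] using that by (simp add: mat_block_def)
  qed
  show "psd_mat (m * N) ?G"
    unfolding psd_mat_iff
  proof (intro conjI allI)
    show "?G \<in> carrier_mat (m * N) (m * N)" unfolding ampliation_def by simp
    fix v :: "nat \<Rightarrow> complex"
    \<comment> \<open>This is (I \<otimes> K_l^H) v in flat indices: \<open>S div N\<close> is the
      block and \<open>S mod N\<close> the position in it.\<close>
    define u where "u = (\<lambda>l S. \<Sum>q<N. cnj (K l q (S mod N)) * v (S div N * N + q))"
    have u: "u l (a * N + s) = (\<Sum>q<N. cnj (K l q s) * v (a * N + q))" if "s < N" for l a s
      unfolding u_def using that by simp
    have "(\<Sum>p<m * N. \<Sum>q<m * N. cnj (v p) * ?G $$ (p, q) * v q)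
      = (\<Sum>a<m. \<Sum>b<m. \<Sum>p<N. \<Sum>q<N. cnj (v (a * N + p)) * ?G $$ (a * N + p, b * N + q) * v (b * N + q))"
      unfolding sum_lessThan_mult by (rule sum.cong[OF refl], rule sum.swap)
    also have "\<dots> = (\<Sum>a<m. \<Sum>b<m. \<Sum>l\<in>L. complex_of_real (c l) * (\<Sum>p<N. \<Sum>q<N. cnj (v (a * N + p)) *
        (\<Sum>s<N. K l p s * (\<Sum>s'<N. A $$ (a * N + s, b * N + s') * cnj (K l q s'))) * v (b * N + q)))"
    proof (intro sum.cong refl)
      fix a b assume ab: "a \<in> {..<m}" "b \<in> {..<m}"
      have "(\<Sum>p<N. \<Sum>q<N. cnj (v (a * N + p)) * ?G $$ (a * N + p, b * N + q) * v (b * N + q))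
        = (\<Sum>p<N. \<Sum>q<N. \<Sum>l\<in>L. complex_of_real (c l) * (cnj (v (a * N + p)) *
        (\<Sum>s<N. K l p s * (\<Sum>s'<N. A $$ (a * N + s, b * N + s') * cnj (K l q s'))) * v (b * N + q)))"
        using ab G by (intro sum.cong refl) (simp add: sum_distrib_left sum_distrib_right mult.assoc mult.left_commute)
      also have "\<dots> = (\<Sum>p<N. \<Sum>l\<in>L. \<Sum>q<N. complex_of_real (c l) * (cnj (v (a * N + p)) *
        (\<Sum>s<N. K l p s * (\<Sum>s'<N. A $$ (a * N + s, b * N + s') * cnj (K l q s'))) * v (b * N + q)))"
        by (intro sum.cong refl, rule sum.swap)
      also have "\<dots> = (\<Sum>l\<in>L. \<Sum>p<N. \<Sum>q<N. complex_of_real (c l) * (cnj (v (a * N + p)) *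
        (\<Sum>s<N. K l p s * (\<Sum>s'<N. A $$ (a * N + s, b * N + s') * cnj (K l q s'))) * v (b * N + q)))"
        by (rule sum.swap)
      finally show "(\<Sum>p<N. \<Sum>q<N. cnj (v (a * N + p)) * ?G $$ (a * N + p, b * N + q) * v (b * N + q))
        = (\<Sum>l\<in>L. complex_of_real (c l) * (\<Sum>p<N. \<Sum>q<N. cnj (v (a * N + p)) *
        (\<Sum>s<N. K l p s * (\<Sum>s'<N. A $$ (a * N + s, b * N + s') * cnj (K l q s'))) * v (b * N + q)))"
        unfolding sum_distrib_left[symmetric] .
    qed
    also have "\<dots> = (\<Sum>a<m. \<Sum>b<m. \<Sum>l\<in>L. complex_of_real (c l) *
        (\<Sum>s<N. \<Sum>s'<N. cnj (u l (a * N + s)) * A $$ (a * N + s, b * N + s') * u l (b * N + s')))"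
      unfolding sum_kraus_swap[where A = "\<lambda>s s'. A $$ (_ * N + s, _ * N + s')"] 
      by (intro sum.cong refl arg_cong2[of _ _ _ _ "(*)"]) (simp_all add: u mult.commute)
    also have "\<dots> = (\<Sum>l\<in>L. \<Sum>a<m. \<Sum>b<m. complex_of_real (c l) *
        (\<Sum>s<N. \<Sum>s'<N. cnj (u l (a * N + s)) * A $$ (a * N + s, b * N + s') * u l (b * N + s')))"
      by (subst (2) sum.swap, subst sum.swap, rule refl)
    also have "\<dots> = (\<Sum>l\<in>L. complex_of_real (c l) * (\<Sum>p<m * N. \<Sum>q<m * N. cnj (u l p) * A $$ (p, q) * u l q))"
      unfolding sum_lessThan_mult sum_distrib_left by (rule sum.cong[OF refl], rule sum.cong[OF refl], rule sum.swap)
    also have "\<dots> \<ge> 0"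
    proof (rule sum_nonneg)
      fix l assume "l \<in> L"
      hence "0 \<le> c l" by (rule c)
      moreover have "0 \<le> (\<Sum>p<m * N. \<Sum>q<m * N. cnj (u l p) * A $$ (p, q) * u l q)"
        using psd unfolding psd_mat_iff by blast
      ultimately show "0 \<le> complex_of_real (c l) * (\<Sum>p<m * N. \<Sum>q<m * N. cnj (u l p) * A $$ (p, q) * u l q)"
        by (simp add: less_eq_complex_def)
    qed
    finally show "0 \<le> (\<Sum>p<m * N. \<Sum>q<m * N. cnj (v p) * ?G $$ (p, q) * v q)" .
  qed
qed

text \<open>Maps matter only on the carrier; this replaces a composition with
  \<open>inv_into\<close> by an explicit resolvent.\<close>

lemma completely_positive_cong:
  assumes "\<And>A. A \<in> carrier_mat N N \<Longrightarrow> f A = g A" and cp: "completely_positive N g"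
  shows "completely_positive N f"
proof -
  have "ampliation m N f A = ampliation m N g A" for m A
    unfolding ampliation_def assms(1)[OF mat_block_carrier] ..
  moreover have "mat_linear N N f"
    using cp assms(1) unfolding completely_positive_def mat_linear_def by auto
  ultimately show ?thesis using cp unfolding completely_positive_def by simp
qed

text \<open>\<Psi> t is the candidate for \<Theta> (I + t \<Theta>)^{-1}. By \<open>left\<close>, A
  + t \<Theta>(A) determines \<Theta>(A) and hence A, so I + t \<Theta> is injective;
  \<open>right\<close> exhibits A - t \<Psi>(A) as the preimage of A.\<close>

lemma q_positive_resolventI:
  assumes lin: "mat_linear N N \<Theta>"
    and cp: "\<And>t. t \<ge> 0 \<Longrightarrow> completely_positive N (\<Psi> t)"
    and right: "\<And>t A. t \<ge> 0 \<Longrightarrow> A \<in> carrier_mat N N \<Longrightarrow> \<Theta> (A + (- complex_of_real t) \<cdot>\<^sub>m \<Psi> t A) = \<Psi> t A"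
    and left: "\<And>t A. t \<ge> 0 \<Longrightarrow> A \<in> carrier_mat N N \<Longrightarrow> \<Psi> t (A + complex_of_real t \<cdot>\<^sub>m \<Theta> A) = \<Theta> A"
  shows "q_positive N \<Theta>"
  unfolding q_positive_def
proof (intro conjI allI impI lin)
  have \<Theta>c: "\<Theta> A \<in> carrier_mat N N" if "A \<in> carrier_mat N N" for A
    using lin that unfolding mat_linear_def by blast
  have \<Psi>c: "\<Psi> t A \<in> carrier_mat N N" if "A \<in> carrier_mat N N" "t \<ge> 0" for A t
    using cp[OF that(2)] that(1) unfolding completely_positive_def mat_linear_def by blast
  show "\<not> map_eigenvalue N \<Theta> (complex_of_real c)" if c: "c < 0" for c :: real
  proof
    assume "map_eigenvalue N \<Theta> (complex_of_real c)"
    then obtain A where A: "A \<in> carrier_mat N N" "A \<noteq> 0\<^sub>m N N" "\<Theta> A = complex_of_real c \<cdot>\<^sub>m A"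
      unfolding map_eigenvalue_def by blast
    \<comment> \<open>For \<Theta>(A) = c A this t makes A + t \<Theta>(A) vanish, and
      \<open>left\<close> then gives \<Theta>(A) = 0.\<close>
    define t where "t = - 1 / c"
    have t: "t \<ge> 0" unfolding t_def using c by (simp add: divide_le_0_iff)
    have "complex_of_real t * complex_of_real c = - 1" unfolding t_def using c by (simp flip: of_real_mult)
    hence "A + complex_of_real t \<cdot>\<^sub>m \<Theta> A = 0 \<cdot>\<^sub>m A"
      unfolding A(3) using A(1) by (intro eq_matI) (auto simp: mult.assoc[symmetric])
    hence "\<Theta> A = \<Psi> t (0 \<cdot>\<^sub>m A)" using left[OF t A(1)] by simp
    also have "\<dots> = 0 \<cdot>\<^sub>m \<Psi> t A"
      using cp[OF t] A(1) unfolding completely_positive_def mat_linear_def by blast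
    finally have "complex_of_real c * A $$ (i, j) = 0" if "i < N" "j < N" for i j
      using that A \<Psi>c[OF A(1) t] by (metis A(3) carrier_matD index_smult_mat(1) mult_zero_left)
    hence "A = 0\<^sub>m N N" using A(1) c by (intro eq_matI) auto
    with A(2) show False ..
  qed
  show "completely_positive N (\<Theta> \<circ> inv_into (carrier_mat N N) (\<lambda>A. A + complex_of_real t \<cdot>\<^sub>m \<Theta> A))"
    if t: "t \<ge> 0" for t :: real
  proof (rule completely_positive_cong[OF _ cp[OF t]])
    fix A :: "complex mat" assume A: "A \<in> carrier_mat N N"
    let ?h = "\<lambda>A. A + complex_of_real t \<cdot>\<^sub>m \<Theta> A"
    let ?A' = "A + (- complex_of_real t) \<cdot>\<^sub>m \<Psi> t A"
    have A': "?A' \<in> carrier_mat N N" using A \<Psi>c[OF A t] by simp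
    have inj: "inj_on ?h (carrier_mat N N)"
    proof (rule inj_onI)
      fix X Y assume X: "X \<in> carrier_mat N N" and Y: "Y \<in> carrier_mat N N" and eq: "?h X = ?h Y"
      have th: "\<Theta> X = \<Theta> Y" using left[OF t X] left[OF t Y] eq by simp
      show "X = Y"
      proof (rule eq_matI)
        fix i j assume "i < dim_row Y" "j < dim_col Y"
        hence ij: "i < N" "j < N" using Y by auto
        have "?h X $$ (i, j) = ?h Y $$ (i, j)" using eq by simp
        thus "X $$ (i, j) = Y $$ (i, j)" unfolding th using ij X Y \<Theta>c[OF Y] by simp
      qed (use X Y in auto)
    qed
    have "?h ?A' = A"
      unfolding right[OF t A] using A \<Psi>c[OF A t] by (intro eq_matI) auto
    hence "inv_into (carrier_mat N N) ?h A = ?A'"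
      using inv_into_f_f[OF inj A'] by simp
    thus "(\<Theta> \<circ> inv_into (carrier_mat N N) ?h) A = \<Psi> t A" using right[OF t A] by simp
  qed
qed

text \<open>\<phi> is idempotent, so its resolvents are \<phi> / (1 + t). Their Kraus operators are
  the matrix units E_{j i}, with weights \<mu> i / (1 + t).\<close>

lemma q_positive_scalar_state:
  fixes \<mu> :: "nat \<Rightarrow> real"
  assumes mu: "\<And>i. i < k \<Longrightarrow> \<mu> i > 0" "(\<Sum>i<k. \<mu> i) = 1" and kn: "k \<le> n"
    and \<phi>: "\<forall>A \<in> carrier_mat n n. \<phi> A = (\<Sum>i<k. complex_of_real (\<mu> i) * A $$ (i, i)) \<cdot>\<^sub>m 1\<^sub>m n"
  shows "q_positive n \<phi>"
proof -
  define tr where "tr = (\<lambda>A. \<Sum>i<k. complex_of_real (\<mu> i) * A $$ (i, i))"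
  define \<Psi> where "\<Psi> = (\<lambda>(t::real) A. (complex_of_real (1 / (1 + t)) * tr A) \<cdot>\<^sub>m (1\<^sub>m n :: complex mat))"
  have tr_lin: "tr (A + c \<cdot>\<^sub>m B) = tr A + c * tr B" if "A \<in> carrier_mat n n" "B \<in> carrier_mat n n" for A B c
    unfolding tr_def sum_distrib_left sum.distrib[symmetric]
    using that kn by (intro sum.cong refl) (auto simp: algebra_simps)
  have tr_add: "tr (A + B) = tr A + tr B" if "A \<in> carrier_mat n n" "B \<in> carrier_mat n n" for A B
    unfolding tr_def sum.distrib[symmetric]
    using that kn by (intro sum.cong refl) (auto simp: algebra_simps)
  have tr_smult: "tr (c \<cdot>\<^sub>m B) = c * tr B" if "B \<in> carrier_mat n n" for B c
    unfolding tr_def sum_distrib_left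
    using that kn by (intro sum.cong refl) (auto simp: algebra_simps)
  have tr_one: "tr (c \<cdot>\<^sub>m 1\<^sub>m n) = c" for c
  proof -
    have "tr (c \<cdot>\<^sub>m 1\<^sub>m n) = (\<Sum>i<k. complex_of_real (\<mu> i)) * c"
      unfolding tr_def sum_distrib_right using kn by (intro sum.cong refl) auto
    thus ?thesis using mu(2) by (simp flip: of_real_sum)
  qed
  have \<phi>': "\<phi> A = tr A \<cdot>\<^sub>m 1\<^sub>m n" if "A \<in> carrier_mat n n" for A using \<phi> that unfolding tr_def by blast
  have \<Psi>0: "\<Psi> 0 A = tr A \<cdot>\<^sub>m 1\<^sub>m n" for A unfolding \<Psi>_def by simp
  have lin: "mat_linear n n (\<Psi> t)" for t
    unfolding mat_linear_def \<Psi>_def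
    by (auto simp: tr_add tr_smult algebra_simps add_divide_distrib intro!: eq_matI)
  have "mat_linear n n \<phi>"
    using lin[of 0] unfolding mat_linear_def \<Psi>0 by (auto simp: \<phi>')
  moreover have "completely_positive n (\<Psi> t)" if t: "t \<ge> 0" for t
  proof (rule completely_positive_krausI[where L = "{..<k} \<times> {..<n}" and c = "\<lambda>(i, j). \<mu> i / (1 + t)"
        and K = "\<lambda>(i, j) p s. (if j = p then 1 else 0) * (if s = i then 1 else 0)", OF lin])
    show "0 \<le> (case l of (i, j) \<Rightarrow> \<mu> i / (1 + t))" if "l \<in> {..<k} \<times> {..<n}" for l
      using that mu(1) t by (auto intro!: divide_nonneg_nonneg less_imp_le)
    fix A :: "complex mat" and p q assume A: "A \<in> carrier_mat n n" and p: "p < n" and q: "q < n"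
    have "\<Psi> t A $$ (p, q) = (\<Sum>i<k. complex_of_real (\<mu> i / (1 + t)) * (if q = p then A $$ (i, i) else 0))"
      unfolding \<Psi>_def tr_def using p q by (simp add: sum_distrib_left mult.commute)
    also have "\<dots> = (\<Sum>i<k. \<Sum>j<n. (if j = p then 1 else 0) * (complex_of_real (\<mu> i / (1 + t)) * (if q = j then A $$ (i, i) else 0)))"
      using p by (simp only: sum_mult_delta mult_1)
    also have "\<dots> = (\<Sum>i<k. \<Sum>j<n. complex_of_real (\<mu> i / (1 + t)) *
        (\<Sum>s<n. (if j = p then 1 else 0) * (if s = i then 1 else 0) *
          (\<Sum>s'<n. A $$ (s, s') * cnj ((if j = q then 1 else 0) * (if s' = i then 1 else 0)))))"
    proof (intro sum.cong refl)
      fix i j assume "i \<in> {..<k}" "j \<in> {..<n}"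
      hence i: "i < n" using kn by simp
      have "(\<Sum>s'<n. A $$ (s, s') * cnj ((if j = q then 1 else 0) * (if s' = i then 1 else 0)))
          = A $$ (s, i) * (if j = q then 1 else 0)" for s
        using i by (simp add: sum_mult_delta if_distrib[of cnj] cong: if_cong)
      thus "(if j = p then 1 else 0) * (complex_of_real (\<mu> i / (1 + t)) * (if q = j then A $$ (i, i) else 0))
        = complex_of_real (\<mu> i / (1 + t)) *
        (\<Sum>s<n. (if j = p then 1 else 0) * (if s = i then 1 else 0) *
          (\<Sum>s'<n. A $$ (s, s') * cnj ((if j = q then 1 else 0) * (if s' = i then 1 else 0))))"
        using i by (simp add: sum_mult_delta)
    qed
    finally show "\<Psi> t A $$ (p, q) = (\<Sum>l\<in>{..<k} \<times> {..<n}. complex_of_real (case l of (i, j) \<Rightarrow> \<mu> i / (1 + t)) *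
        (\<Sum>s<n. (case l of (i, j) \<Rightarrow> \<lambda>p s. (if j = p then 1 else 0) * (if s = i then 1 else 0)) p s *
          (\<Sum>s'<n. A $$ (s, s') * cnj ((case l of (i, j) \<Rightarrow> \<lambda>p s. (if j = p then 1 else 0) * (if s = i then 1 else 0)) q s'))))"
      by (simp add: sum.cartesian_product split_beta)
  qed
  moreover have "\<phi> (A + (- complex_of_real t) \<cdot>\<^sub>m \<Psi> t A) = \<Psi> t A" if t: "t \<ge> 0" and A: "A \<in> carrier_mat n n" for t A
  proof -
    have c: "\<Psi> t A \<in> carrier_mat n n" unfolding \<Psi>_def by simp
    have "tr A + (- complex_of_real t) * tr (\<Psi> t A) = complex_of_real (1 / (1 + t)) * tr A"
    proof -
      have "1 + complex_of_real t \<noteq> 0" using t by (metis add_nonneg_eq_0_iff of_real_1 of_real_add of_real_eq_0_iff zero_le_one zero_neq_one)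
      thus ?thesis unfolding \<Psi>_def tr_one by (simp add: field_simps)
    qed
    thus ?thesis using A c by (simp add: \<phi>' tr_lin) (simp add: \<Psi>_def)
  qed
  moreover have "\<Psi> t (A + complex_of_real t \<cdot>\<^sub>m \<phi> A) = \<phi> A" if t: "t \<ge> 0" and A: "A \<in> carrier_mat n n" for t A
  proof -
    have "1 + complex_of_real t \<noteq> 0" using t by (metis add_nonneg_eq_0_iff of_real_1 of_real_add of_real_eq_0_iff zero_le_one zero_neq_one)
    hence "complex_of_real (1 / (1 + t)) * (tr A + complex_of_real t * tr A) = tr A"
      by (simp add: field_simps)
    moreover have "tr (A + complex_of_real t \<cdot>\<^sub>m \<phi> A) = tr A + complex_of_real t * tr A"
      using A by (simp add: \<phi>' tr_lin tr_one)
    ultimately show ?thesis using A by (simp add: \<Psi>_def \<phi>')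
  qed
  ultimately show ?thesis by (rule q_positive_resolventI[where \<Psi> = \<Psi>])
qed

section \<open>The rank-one corner\<close>

text \<open>The offset m selects the diagonal block of a matrix of size n + n': 0 for the upper left
  one, n for the lower right one.\<close>

definition diag_state :: "nat \<Rightarrow> nat \<Rightarrow> (nat \<Rightarrow> real) \<Rightarrow> complex mat \<Rightarrow> complex" where
  "diag_state m k \<mu> M = (\<Sum>i<k. complex_of_real (\<mu> i) * M $$ (m + i, m + i))"

text \<open>With \<open>X\<close> the \<open>k \<times> k\<close> corner of \<open>Z\<close> and \<open>B\<close> that of the upper right block of \<open>M\<close>, this is
  \<open>tr (X\<^sup>* B \<Omega>)\<close>.\<close>

definition corner_functional :: "nat \<Rightarrow> nat \<Rightarrow> (nat \<Rightarrow> real) \<Rightarrow> (nat \<Rightarrow> nat \<Rightarrow> complex) \<Rightarrow> complex mat \<Rightarrow> complex" where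
  "corner_functional n k \<mu> Z M = (\<Sum>a<k. \<Sum>b<k. complex_of_real (\<mu> b) * cnj (Z a b) * M $$ (a, n + b))"

text \<open>The conjugate of \<open>corner_functional\<close> at the adjoint of M, expanded so that
  it is visibly linear in M.\<close>

definition corner_functional_adj :: "nat \<Rightarrow> nat \<Rightarrow> (nat \<Rightarrow> real) \<Rightarrow> (nat \<Rightarrow> nat \<Rightarrow> complex) \<Rightarrow> complex mat \<Rightarrow> complex" where
  "corner_functional_adj n k \<mu> Z M = (\<Sum>a<k. \<Sum>b<k. complex_of_real (\<mu> b) * Z a b * M $$ (n + b, a))"

text \<open>Two scalars, s for the diagonal blocks and c for the corner, because the resolvent
  changes them differently: (1, \<kappa>) becomes (1 / (1 + t), \<kappa> / (1 + t
  \<kappa>)).\<close>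

definition rank_one_corner :: "nat \<Rightarrow> nat \<Rightarrow> nat \<Rightarrow> (nat \<Rightarrow> real) \<Rightarrow> (nat \<Rightarrow> nat \<Rightarrow> complex) \<Rightarrow>
    real \<Rightarrow> complex \<Rightarrow> complex mat \<Rightarrow> complex mat" where
  "rank_one_corner n n' k \<mu> Z s c M = mat (n + n') (n + n') (\<lambda>(i, j).
     if i < n then
       if j < n then if i = j then complex_of_real s * diag_state 0 k \<mu> M else 0
       else c * corner_functional n k \<mu> Z M * Z i (j - n)
     else if j < n then cnj c * corner_functional_adj n k \<mu> Z M * cnj (Z j (i - n))
     else if i = j then complex_of_real s * diag_state n k \<mu> M else 0)"

lemma rank_one_corner_index:
  shows "rank_one_corner n n' k \<mu> Z s c M \<in> carrier_mat (n + n') (n + n')"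
    "i < n \<Longrightarrow> j < n \<Longrightarrow> rank_one_corner n n' k \<mu> Z s c M $$ (i, j) =
       (if i = j then complex_of_real s * diag_state 0 k \<mu> M else 0)"
    "i < n \<Longrightarrow> p < n' \<Longrightarrow> rank_one_corner n n' k \<mu> Z s c M $$ (i, n + p) = c * corner_functional n k \<mu> Z M * Z i p"
    "i < n \<Longrightarrow> p < n' \<Longrightarrow> rank_one_corner n n' k \<mu> Z s c M $$ (n + p, i) = cnj c * corner_functional_adj n k \<mu> Z M * cnj (Z i p)"
    "p < n' \<Longrightarrow> q < n' \<Longrightarrow> rank_one_corner n n' k \<mu> Z s c M $$ (n + p, n + q) =
       (if p = q then complex_of_real s * diag_state n k \<mu> M else 0)"
  unfolding rank_one_corner_def by auto

lemma block_mat_eqI: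
  fixes A B :: "complex mat"
  assumes A: "A \<in> carrier_mat (n + n') (n + n')" and B: "B \<in> carrier_mat (n + n') (n + n')"
    and "\<And>i j. i < n \<Longrightarrow> j < n \<Longrightarrow> A $$ (i, j) = B $$ (i, j)"
    and "\<And>i p. i < n \<Longrightarrow> p < n' \<Longrightarrow> A $$ (i, n + p) = B $$ (i, n + p)"
    and "\<And>i p. i < n \<Longrightarrow> p < n' \<Longrightarrow> A $$ (n + p, i) = B $$ (n + p, i)"
    and "\<And>p q. p < n' \<Longrightarrow> q < n' \<Longrightarrow> A $$ (n + p, n + q) = B $$ (n + p, n + q)"
  shows "A = B"
proof (rule eq_matI)
  fix i j assume "i < dim_row B" "j < dim_col B"
  hence ij: "i < n + n'" "j < n + n'" using B by auto
  consider "i < n" "j < n" | p where "i < n" "j = n + p" "p < n'" | p where "i = n + p" "p < n'" "j < n"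
    | p q where "i = n + p" "p < n'" "j = n + q" "q < n'"
    using ij by (metis add_diff_inverse_nat nat_add_left_cancel_less)
  thus "A $$ (i, j) = B $$ (i, j)" using assms(3-) by cases simp_all
qed (use A B in auto)

lemma state_functionals_linear:
  assumes A: "A \<in> carrier_mat (n + n') (n + n')" and B: "B \<in> carrier_mat (n + n') (n + n')"
    and k: "k \<le> n" "k \<le> n'"
  shows "diag_state 0 k \<mu> (A + B) = diag_state 0 k \<mu> A + diag_state 0 k \<mu> B"
    "diag_state n k \<mu> (A + B) = diag_state n k \<mu> A + diag_state n k \<mu> B"
    "corner_functional n k \<mu> Z (A + B) = corner_functional n k \<mu> Z A + corner_functional n k \<mu> Z B"
    "corner_functional_adj n k \<mu> Z (A + B) = corner_functional_adj n k \<mu> Z A + corner_functional_adj n k \<mu> Z B"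
    "diag_state 0 k \<mu> (z \<cdot>\<^sub>m A) = z * diag_state 0 k \<mu> A"
    "diag_state n k \<mu> (z \<cdot>\<^sub>m A) = z * diag_state n k \<mu> A"
    "corner_functional n k \<mu> Z (z \<cdot>\<^sub>m A) = z * corner_functional n k \<mu> Z A"
    "corner_functional_adj n k \<mu> Z (z \<cdot>\<^sub>m A) = z * corner_functional_adj n k \<mu> Z A"
  unfolding diag_state_def corner_functional_def corner_functional_adj_def
    sum.distrib[symmetric] sum_distrib_left
  using assms by (auto intro!: sum.cong simp: algebra_simps)

lemma rank_one_corner_linear:
  assumes "k \<le> n" "k \<le> n'"
  shows "mat_linear (n + n') (n + n') (rank_one_corner n n' k \<mu> Z s c)"
  unfolding mat_linear_def
proof (intro conjI ballI allI)
  note lin = state_functionals_linear[OF _ _ assms]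
  show "rank_one_corner n n' k \<mu> Z s c A \<in> carrier_mat (n + n') (n + n')" for A
    by (rule rank_one_corner_index)
  show "rank_one_corner n n' k \<mu> Z s c (A + B) = rank_one_corner n n' k \<mu> Z s c A + rank_one_corner n n' k \<mu> Z s c B"
    if AB: "A \<in> carrier_mat (n + n') (n + n')" "B \<in> carrier_mat (n + n') (n + n')" for A B
    unfolding rank_one_corner_def lin[OF AB]
    by (intro eq_matI) (auto simp: algebra_simps)
  show "rank_one_corner n n' k \<mu> Z s c (z \<cdot>\<^sub>m A) = z \<cdot>\<^sub>m rank_one_corner n n' k \<mu> Z s c A"
    if A: "A \<in> carrier_mat (n + n') (n + n')" for A z
    unfolding rank_one_corner_def lin[OF A A]
    by (intro eq_matI) (auto simp: algebra_simps)
qed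

text \<open>Composition with the map multiplies the four functionals by s, s, c and cnj c. For the
  corner this is tr (X^H X \<Omega>) = tr \<Omega> = 1, with X the corner of Z.\<close>

lemma rank_one_corner_functionals:
  assumes one: "(\<Sum>i<k. \<mu> i) = 1" and k: "k \<le> n" "k \<le> n'"
    and Z: "\<forall>b<k. (\<Sum>a<k. cnj (Z a b) * Z a b) = 1"
  shows "diag_state 0 k \<mu> (rank_one_corner n n' k \<mu> Z s c M) = complex_of_real s * diag_state 0 k \<mu> M"
    "diag_state n k \<mu> (rank_one_corner n n' k \<mu> Z s c M) = complex_of_real s * diag_state n k \<mu> M"
    "corner_functional n k \<mu> Z (rank_one_corner n n' k \<mu> Z s c M) = c * corner_functional n k \<mu> Z M"
    "corner_functional_adj n k \<mu> Z (rank_one_corner n n' k \<mu> Z s c M) = cnj c * corner_functional_adj n k \<mu> Z M"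
proof -
  let ?T = "rank_one_corner n n' k \<mu> Z s c M"
  have one': "(\<Sum>i<k. complex_of_real (\<mu> i)) = 1" using one by (simp flip: of_real_sum)
  have "diag_state 0 k \<mu> ?T = (\<Sum>i<k. complex_of_real (\<mu> i)) * (complex_of_real s * diag_state 0 k \<mu> M)"
    unfolding diag_state_def[of 0 k \<mu> ?T] sum_distrib_right
    using k by (intro sum.cong refl) (simp add: rank_one_corner_index)
  thus "diag_state 0 k \<mu> ?T = complex_of_real s * diag_state 0 k \<mu> M" unfolding one' by simp
  have "diag_state n k \<mu> ?T = (\<Sum>i<k. complex_of_real (\<mu> i)) * (complex_of_real s * diag_state n k \<mu> M)"
    unfolding diag_state_def[of n k \<mu> ?T] sum_distrib_right
    using k by (intro sum.cong refl) (simp add: rank_one_corner_index)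
  thus "diag_state n k \<mu> ?T = complex_of_real s * diag_state n k \<mu> M" unfolding one' by simp
  have ZZ: "(\<Sum>a<k. \<Sum>b<k. complex_of_real (\<mu> b) * (cnj (Z a b) * Z a b)) = 1"
    using Z one' by (subst sum.swap) (simp add: sum_distrib_left[symmetric])
  have "corner_functional n k \<mu> Z ?T
      = (\<Sum>a<k. \<Sum>b<k. complex_of_real (\<mu> b) * (cnj (Z a b) * Z a b)) * (c * corner_functional n k \<mu> Z M)"
    unfolding corner_functional_def[of n k \<mu> Z ?T] sum_distrib_right
    using k by (intro sum.cong refl) (simp add: rank_one_corner_index)
  thus "corner_functional n k \<mu> Z ?T = c * corner_functional n k \<mu> Z M" unfolding ZZ by simp
  have "corner_functional_adj n k \<mu> Z ?T
      = (\<Sum>a<k. \<Sum>b<k. complex_of_real (\<mu> b) * (cnj (Z a b) * Z a b)) * (cnj c * corner_functional_adj n k \<mu> Z M)"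
    unfolding corner_functional_adj_def[of n k \<mu> Z ?T] sum_distrib_right
    using k by (intro sum.cong refl) (simp add: rank_one_corner_index)
  thus "corner_functional_adj n k \<mu> Z ?T = cnj c * corner_functional_adj n k \<mu> Z M" unfolding ZZ by simp
qed

text \<open>Since the functionals are only rescaled, the family is closed under such compositions
  and resolvent identities reduce to scalar arithmetic. The real x may be negative; both x = t and x
  = - t occur.\<close>

lemma rank_one_corner_compose:
  assumes one: "(\<Sum>i<k. \<mu> i) = 1" and k: "k \<le> n" "k \<le> n'"
    and ZB: "\<forall>b<k. (\<Sum>a<k. cnj (Z a b) * Z a b) = 1"
    and M: "M \<in> carrier_mat (n + n') (n + n')"
    and s: "s * (1 + x * s') = s''" and c: "c * (1 + complex_of_real x * c') = c''"
  shows "rank_one_corner n n' k \<mu> Z s c (M + complex_of_real x \<cdot>\<^sub>m rank_one_corner n n' k \<mu> Z s' c' M)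
    = rank_one_corner n n' k \<mu> Z s'' c'' M"
proof -
  let ?T = "rank_one_corner n n' k \<mu> Z s' c' M"
  have T: "?T \<in> carrier_mat (n + n') (n + n')" by (rule rank_one_corner_index)
  hence xT: "complex_of_real x \<cdot>\<^sub>m ?T \<in> carrier_mat (n + n') (n + n')" by simp
  note f = rank_one_corner_functionals[where Z = Z, OF one k ZB]
  note l = state_functionals_linear(1-4)[OF M xT k] state_functionals_linear(5-8)[OF T T k] f
  have sc: "complex_of_real s * (D + complex_of_real x * (complex_of_real s' * D)) = complex_of_real s'' * D" for D
    unfolding s[symmetric] by (simp add: algebra_simps)
  have cc: "c * (D + complex_of_real x * (c' * D)) = c'' * D" for D
    unfolding c[symmetric] by (simp add: algebra_simps)
  have cc': "cnj c * (D + complex_of_real x * (cnj c' * D)) = cnj c'' * D" for D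
    unfolding c[symmetric] by (simp add: algebra_simps)
  show ?thesis
    unfolding rank_one_corner_def[of n n' k \<mu> Z s c] rank_one_corner_def[of n n' k \<mu> Z s'' c''] l sc cc cc' ..
qed

lemma kraus_block_sum:
  fixes n n' k i :: nat
  assumes "k \<le> n" "i < k" "i < n'"
  shows "(\<Sum>s<n + n'. (if s < k then x s else 0) * F s) = (\<Sum>s<k. x s * (F s :: complex))"
    "(\<Sum>s<n + n'. (if s = n + i then 1 else 0) * F s) = F (n + i)"
proof -
  show "(\<Sum>s<n + n'. (if s < k then x s else 0) * F s) = (\<Sum>s<k. x s * F s)"
    using assms(1) by (intro sum.mono_neutral_cong_right) auto
  show "(\<Sum>s<n + n'. (if s = n + i then 1 else 0) * F s) = F (n + i)"
    using assms sum_mult_delta(1)[of "n + i" "n + n'" 1 F] by simp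
qed

text \<open>Let X be the corner of Z, x_i its columns, z_j the columns of Z and c = s c1. The Kraus
  operators, of weight s \<mu> i, are (c1 z_j x_i^H) \<oplus> E_{j i} and, acting in the upper left
  block only, r_l e_i^H with r_l the columns of R^H. The first family yields both corners, the lower
  right block, and |c1|^2 Z Z^H times tr (A X \<Omega> X^H) in the upper left block; the second
  completes |c1|^2 Z Z^H to the identity there.\<close>

lemma rank_one_corner_completely_positive:
  fixes \<mu> :: "nat \<Rightarrow> real"
  assumes mu: "\<And>i. i < k \<Longrightarrow> \<mu> i > 0" and k: "k \<le> n" "k \<le> n'"
    and Zorth: "\<And>a b. a < k \<Longrightarrow> b < k \<Longrightarrow>
      (\<Sum>i<k. complex_of_real (\<mu> i) * cnj (Z a i) * Z b i) = (if a = b then complex_of_real (\<mu> a) else 0)"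
    and Zcon: "\<And>v. nsq n' (\<lambda>p. \<Sum>i<n. v i * Z i p) \<le> nsq n v"
    and s: "0 < s" and c: "cmod c \<le> s"
  shows "completely_positive (n + n') (rank_one_corner n n' k \<mu> Z s c)"
proof -
  define c1 where "c1 = c / complex_of_real s"
  have c1: "cmod c1 \<le> 1" and cc1: "c = complex_of_real s * c1"
    unfolding c1_def using s c by (auto simp: norm_divide)
  \<comment> \<open>P = I - |c1|^2 Z Z^H is what the first family misses of the identity. It is
    non-negative because c1 and Z are contractive.\<close>
  define P where "P = (\<lambda>p q. (if p = q then 1 else 0) - (\<Sum>j<n'. (c1 * Z p j) * cnj (c1 * Z q j)))"
  have "0 \<le> (\<Sum>p<n. \<Sum>q<n. cnj (v p) * P p q * v q)" for v
  proof -
    define x where "x = (\<lambda>j. \<Sum>p<n. cnj (v p) * Z p j)"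
    have "(\<Sum>p<n. \<Sum>q<n. cnj (v p) * (\<Sum>j\<in>{..<n'}. cnj (cnj (c1 * Z p j)) * cnj (c1 * Z q j)) * v q)
       = (\<Sum>j<n'. cnj (\<Sum>p<n. cnj (c1 * Z p j) * v p) * (\<Sum>q<n. cnj (c1 * Z q j) * v q))"
      by (rule gram_form)
    also have "\<dots> = (\<Sum>j<n'. c1 * x j * cnj (c1 * x j))"
      unfolding x_def by (simp add: sum_distrib_left mult_ac)
    also have "\<dots> = complex_of_real (nsq n' (\<lambda>j. c1 * x j))" by (rule sum_mult_cnj_self)
    finally have a: "(\<Sum>p<n. \<Sum>q<n. cnj (v p) * (\<Sum>j<n'. (c1 * Z p j) * cnj (c1 * Z q j)) * v q)
       = complex_of_real (nsq n' (\<lambda>j. c1 * x j))" by simp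
    have "(\<Sum>p<n. \<Sum>q<n. cnj (v p) * (if p = q then 1 else 0) * v q) = (\<Sum>p<n. v p * cnj (v p))"
      by (intro sum.cong refl) (simp add: if_distrib[of "\<lambda>x. _ * x"] if_distrib[of "\<lambda>x. x * _"] mult.commute cong: if_cong)
    hence b: "(\<Sum>p<n. \<Sum>q<n. cnj (v p) * (if p = q then 1 else 0) * v q) = complex_of_real (nsq n v)"
      unfolding sum_mult_cnj_self .
    have e: "(\<Sum>p<n. \<Sum>q<n. cnj (v p) * P p q * v q) = complex_of_real (nsq n v - nsq n' (\<lambda>j. c1 * x j))"
      unfolding P_def of_real_diff a[symmetric] b[symmetric] sum_subtractf[symmetric]
      by (intro sum.cong refl) (simp only: left_diff_distrib right_diff_distrib)
    have "nsq n' (\<lambda>j. c1 * x j) = (cmod c1)\<^sup>2 * nsq n' x"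
      unfolding nsq_def by (simp add: norm_mult power_mult_distrib sum_distrib_left)
    also have "\<dots> \<le> 1 * nsq n' x"
      by (intro mult_right_mono nsq_nonneg) (use c1 in \<open>simp add: abs_square_le_1\<close>)
    also have "\<dots> \<le> nsq n (\<lambda>p. cnj (v p))" unfolding x_def using Zcon[of "\<lambda>p. cnj (v p)"] by simp
    also have "\<dots> = nsq n v" unfolding nsq_def by simp
    finally show ?thesis unfolding e by (simp add: less_eq_complex_def)
  qed
  from quadratic_form_nonneg_factor[where n = n and P = P, OF this]
  obtain R where R: "\<And>p q. p < n \<Longrightarrow> q < n \<Longrightarrow> P p q = (\<Sum>l<n. cnj (R l p) * R l q)" by blast
  \<comment> \<open>j < n' selects the operators of the first family, j = n' + l the one built from
    row l of R.\<close>
  define K where "K = (\<lambda>(i, j) p s. if j < n' then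
      if p < n then c1 * Z p j * (if s < k then cnj (Z s i) else 0)
      else (if p = n + j then 1 else 0) * (if s = n + i then 1 else 0)
    else if p < n then cnj (R (j - n') p) * (if s = i then 1 else (0::complex)) else 0)"
  show ?thesis
  proof (rule completely_positive_krausI[where L = "{..<k} \<times> {..<n' + n}" and c = "\<lambda>(i, j). s * \<mu> i" and K = K,
        OF rank_one_corner_linear[OF k]])
    show "0 \<le> (case l of (i, j) \<Rightarrow> s * \<mu> i)" if "l \<in> {..<k} \<times> {..<n' + n}" for l
      using that mu s by (auto intro!: mult_nonneg_nonneg less_imp_le)
    fix A :: "complex mat" and p q
    assume A: "A \<in> carrier_mat (n + n') (n + n')" and p: "p < n + n'" and q: "q < n + n'"
    let ?N = "n + n'"
    define W where "W = (\<lambda>i j. \<Sum>s<?N. K (i, j) p s * (\<Sum>s'<?N. A $$ (s, s') * cnj (K (i, j) q s')))"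
    have W_alt: "W i j = (\<Sum>s<?N. K (i, j) p s * (\<Sum>s'<?N. cnj (K (i, j) q s') * A $$ (s, s')))" for i j
      unfolding W_def by (simp add: mult.commute)
    have sumW: "(\<Sum>l\<in>{..<k} \<times> {..<n' + n}. complex_of_real (case l of (i, j) \<Rightarrow> s * \<mu> i) *
        (\<Sum>s<?N. K l p s * (\<Sum>s'<?N. A $$ (s, s') * cnj (K l q s'))))
      = complex_of_real s * (\<Sum>i<k. complex_of_real (\<mu> i) * ((\<Sum>j<n'. W i j) + (\<Sum>l<n. W i (n' + l))))"
    proof -
      have "(\<Sum>l\<in>{..<k} \<times> {..<n' + n}. complex_of_real (case l of (i, j) \<Rightarrow> s * \<mu> i) *
          (\<Sum>s<?N. K l p s * (\<Sum>s'<?N. A $$ (s, s') * cnj (K l q s'))))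
        = (\<Sum>i<k. \<Sum>j<n' + n. complex_of_real (s * \<mu> i) * W i j)"
        unfolding W_def sum.cartesian_product by (intro sum.cong refl) auto
      thus ?thesis
        by (simp add: sum_lessThan_split_add sum_distrib_left[symmetric] mult.assoc distrib_left sum.distrib)
    qed
    \<comment> \<open>\<open>Zorth\<close> says X \<Omega> X^H = \<Omega>, which removes X from the
      state.\<close>
    have orth: "(\<Sum>i<k. complex_of_real (\<mu> i) * (\<Sum>a<k. cnj (Z a i) * (\<Sum>b<k. Z b i * A $$ (a, b)))) = diag_state 0 k \<mu> A"
    proof -
      have "(\<Sum>i<k. complex_of_real (\<mu> i) * (\<Sum>a<k. cnj (Z a i) * (\<Sum>b<k. Z b i * A $$ (a, b))))
        = (\<Sum>i<k. \<Sum>a<k. \<Sum>b<k. (complex_of_real (\<mu> i) * cnj (Z a i) * Z b i) * A $$ (a, b))"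
        by (simp add: sum_distrib_left mult.assoc)
      also have "\<dots> = (\<Sum>a<k. \<Sum>i<k. \<Sum>b<k. (complex_of_real (\<mu> i) * cnj (Z a i) * Z b i) * A $$ (a, b))"
        by (rule sum.swap)
      also have "\<dots> = (\<Sum>a<k. \<Sum>b<k. \<Sum>i<k. (complex_of_real (\<mu> i) * cnj (Z a i) * Z b i) * A $$ (a, b))"
        by (rule sum.cong[OF refl], rule sum.swap)
      also have "\<dots> = (\<Sum>a<k. \<Sum>b<k. (if b = a then complex_of_real (\<mu> a) else 0) * A $$ (a, b))"
        unfolding sum_distrib_right[symmetric] by (intro sum.cong refl) (auto simp: Zorth)
      also have "\<dots> = (\<Sum>a<k. complex_of_real (\<mu> a) * A $$ (a, a))"
        by (intro sum.cong refl) (simp add: sum_mult_delta)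
      finally show ?thesis unfolding diag_state_def by simp
    qed
    have ell: "(\<Sum>i<k. complex_of_real (\<mu> i) * (\<Sum>a<k. cnj (Z a i) * A $$ (a, n + i))) = corner_functional n k \<mu> Z A"
      unfolding corner_functional_def by (subst sum.swap) (simp add: sum_distrib_left mult.assoc)
    have ell': "(\<Sum>i<k. complex_of_real (\<mu> i) * (\<Sum>a<k. Z a i * A $$ (n + i, a))) = corner_functional_adj n k \<mu> Z A"
      unfolding corner_functional_adj_def by (subst sum.swap) (simp add: sum_distrib_left mult.assoc)
    note ks = kraus_block_sum[OF k(1)]
    consider "p < n" "q < n" | q' where "p < n" "q = n + q'" "q' < n'" | p' where "p = n + p'" "p' < n'" "q < n"
      | p' q' where "p = n + p'" "p' < n'" "q = n + q'" "q' < n'"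
      using p q by (metis add_diff_inverse_nat nat_add_left_cancel_less)
    hence "rank_one_corner n n' k \<mu> Z s c A $$ (p, q)
      = complex_of_real s * (\<Sum>i<k. complex_of_real (\<mu> i) * ((\<Sum>j<n'. W i j) + (\<Sum>l<n. W i (n' + l))))"
    proof cases
      case 1
      have W1: "W i j = (c1 * Z p j) * cnj (c1 * Z q j) * (\<Sum>a<k. cnj (Z a i) * (\<Sum>b<k. Z b i * A $$ (a, b)))"
        if "i < k" "j < n'" for i j
      proof -
        have "W i j = (\<Sum>s<?N. (c1 * Z p j * (if s < k then cnj (Z s i) else 0)) *
            (\<Sum>s'<?N. (cnj (c1 * Z q j) * (if s' < k then Z s' i else 0)) * A $$ (s, s')))"
          unfolding W_alt K_def using 1 that by (intro sum.cong refl arg_cong2[of _ _ _ _ "(*)"]) auto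
        also have "\<dots> = (c1 * Z p j) * (\<Sum>s<?N. (if s < k then cnj (Z s i) else 0) *
            (cnj (c1 * Z q j) * (\<Sum>s'<?N. (if s' < k then Z s' i else 0) * A $$ (s, s'))))"
          by (simp only: mult.assoc sum_distrib_left)
        also have "\<dots> = (c1 * Z p j) * (\<Sum>s<k. cnj (Z s i) * (cnj (c1 * Z q j) * (\<Sum>s'<k. Z s' i * A $$ (s, s'))))"
          using that k by (simp only: ks[OF that(1)] less_le_trans)
        also have "\<dots> = (c1 * Z p j) * cnj (c1 * Z q j) * (\<Sum>a<k. cnj (Z a i) * (\<Sum>b<k. Z b i * A $$ (a, b)))"
          by (simp add: sum_distrib_left mult.left_commute mult.assoc)
        finally show ?thesis .
      qed
      have W2: "W i (n' + l) = cnj (R l p) * R l q * A $$ (i, i)" if "i < k" "l < n" for i l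
      proof -
        have "W i (n' + l) = (\<Sum>s<?N. cnj (R l p) * (if s = i then 1 else 0) *
            (\<Sum>s'<?N. (R l q * (if s' = i then 1 else 0)) * A $$ (s, s')))"
          unfolding W_alt K_def using 1 that by (intro sum.cong refl arg_cong2[of _ _ _ _ "(*)"]) auto
        also have "\<dots> = cnj (R l p) * (R l q * A $$ (i, i))"
          using that k by (simp add: mult.assoc sum_distrib_left[symmetric] sum_mult_delta)
        finally show ?thesis by simp
      qed
      let ?G = "\<Sum>j<n'. (c1 * Z p j) * cnj (c1 * Z q j)"
      have "(\<Sum>i<k. complex_of_real (\<mu> i) * ((\<Sum>j<n'. W i j) + (\<Sum>l<n. W i (n' + l))))
        = (\<Sum>i<k. ?G * (complex_of_real (\<mu> i) * (\<Sum>a<k. cnj (Z a i) * (\<Sum>b<k. Z b i * A $$ (a, b))))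
            + P p q * (complex_of_real (\<mu> i) * A $$ (i, i)))"
      proof (intro sum.cong refl)
        fix i assume i: "i \<in> {..<k}"
        have "(\<Sum>j<n'. W i j) = ?G * (\<Sum>a<k. cnj (Z a i) * (\<Sum>b<k. Z b i * A $$ (a, b)))"
          unfolding sum_distrib_right[of _ "{..<n'}"] using W1 i by (intro sum.cong refl) simp
        moreover have "(\<Sum>l<n. W i (n' + l)) = P p q * A $$ (i, i)"
          unfolding R[OF 1] sum_distrib_right using W2 i by (intro sum.cong refl) simp
        ultimately show "complex_of_real (\<mu> i) * ((\<Sum>j<n'. W i j) + (\<Sum>l<n. W i (n' + l)))
          = ?G * (complex_of_real (\<mu> i) * (\<Sum>a<k. cnj (Z a i) * (\<Sum>b<k. Z b i * A $$ (a, b))))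
            + P p q * (complex_of_real (\<mu> i) * A $$ (i, i))"
          by (simp only: distrib_left mult.left_commute)
      qed
      also have "\<dots> = ?G * diag_state 0 k \<mu> A + P p q * diag_state 0 k \<mu> A"
        unfolding sum.distrib sum_distrib_left[symmetric] orth by (simp add: diag_state_def)
      \<comment> \<open>By the definition of P, \<open>?G + P p q\<close> is the entry (p, q) of the
        identity.\<close>
      also have "\<dots> = (if p = q then 1 else 0) * diag_state 0 k \<mu> A"
        unfolding P_def by (simp only: distrib_right[symmetric] add_diff_cancel_left' add_diff_eq)
      finally show ?thesis using 1 by (simp add: rank_one_corner_index)
    next
      case 2
      have W1: "W i j = (if j = q' then c1 * Z p q' else 0) * (\<Sum>a<k. cnj (Z a i) * A $$ (a, n + i))"
        if "i < k" "j < n'" for i j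
      proof -
        have "W i j = (\<Sum>s<?N. (c1 * Z p j * (if s < k then cnj (Z s i) else 0)) *
            (\<Sum>s'<?N. ((if j = q' then 1 else 0) * (if s' = n + i then 1 else 0)) * A $$ (s, s')))"
          unfolding W_alt K_def using 2 that by (intro sum.cong refl arg_cong2[of _ _ _ _ "(*)"]) auto
        also have "\<dots> = (c1 * Z p j) * (\<Sum>s<?N. (if s < k then cnj (Z s i) else 0) *
            ((if j = q' then 1 else 0) * (\<Sum>s'<?N. (if s' = n + i then 1 else 0) * A $$ (s, s'))))"
          by (simp only: mult.assoc sum_distrib_left)
        also have "\<dots> = (c1 * Z p j) * (\<Sum>s<k. cnj (Z s i) * ((if j = q' then 1 else 0) * A $$ (s, n + i)))"
          using that k by (simp only: ks[OF that(1)] less_le_trans)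
        also have "\<dots> = (if j = q' then c1 * Z p q' else 0) * (\<Sum>a<k. cnj (Z a i) * A $$ (a, n + i))"
          by simp
        finally show ?thesis .
      qed
      have W2: "W i (n' + l) = 0" if "i < k" "l < n" for i l
        unfolding W_alt K_def using 2 by simp
      have "(\<Sum>i<k. complex_of_real (\<mu> i) * ((\<Sum>j<n'. W i j) + (\<Sum>l<n. W i (n' + l))))
        = (\<Sum>i<k. c1 * Z p q' * (complex_of_real (\<mu> i) * (\<Sum>a<k. cnj (Z a i) * A $$ (a, n + i))))"
        using 2 W1 W2 by (intro sum.cong refl) (simp add: sum_distrib_right[symmetric])
      also have "\<dots> = c1 * Z p q' * corner_functional n k \<mu> Z A"
        unfolding sum_distrib_left[symmetric] ell ..
      finally show ?thesis using 2 by (simp add: rank_one_corner_index cc1)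
    next
      case 3
      have W1: "W i j = (if j = p' then cnj (c1 * Z q p') else 0) * (\<Sum>a<k. Z a i * A $$ (n + i, a))"
        if "i < k" "j < n'" for i j
      proof -
        have "W i j = (\<Sum>s<?N. ((if j = p' then 1 else 0) * (if s = n + i then 1 else 0)) *
            (\<Sum>s'<?N. (cnj (c1 * Z q j) * (if s' < k then Z s' i else 0)) * A $$ (s, s')))"
          unfolding W_alt K_def using 3 that by (intro sum.cong refl arg_cong2[of _ _ _ _ "(*)"]) auto
        also have "\<dots> = (if j = p' then 1 else 0) * (\<Sum>s<?N. (if s = n + i then 1 else 0) *
            (cnj (c1 * Z q j) * (\<Sum>s'<?N. (if s' < k then Z s' i else 0) * A $$ (s, s'))))"
          by (simp only: mult.assoc sum_distrib_left)
        also have "\<dots> = (if j = p' then 1 else 0) * (cnj (c1 * Z q j) * (\<Sum>s'<k. Z s' i * A $$ (n + i, s')))"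
          using that k by (simp only: ks[OF that(1)] less_le_trans)
        also have "\<dots> = (if j = p' then cnj (c1 * Z q p') else 0) * (\<Sum>a<k. Z a i * A $$ (n + i, a))"
          by simp
        finally show ?thesis .
      qed
      have W2: "W i (n' + l) = 0" if "i < k" "l < n" for i l
        unfolding W_alt K_def using 3 by simp
      have "(\<Sum>i<k. complex_of_real (\<mu> i) * ((\<Sum>j<n'. W i j) + (\<Sum>l<n. W i (n' + l))))
        = (\<Sum>i<k. cnj (c1 * Z q p') * (complex_of_real (\<mu> i) * (\<Sum>a<k. Z a i * A $$ (n + i, a))))"
        using 3 W1 W2 by (intro sum.cong refl) (simp add: sum_distrib_right[symmetric])
      also have "\<dots> = cnj (c1 * Z q p') * corner_functional_adj n k \<mu> Z A"
        unfolding sum_distrib_left[symmetric] ell' ..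
      finally show ?thesis using 3 by (simp add: rank_one_corner_index cc1)
    next
      case 4
      have W1: "W i j = (if j = p' then if p' = q' then 1 else 0 else 0) * A $$ (n + i, n + i)"
        if "i < k" "j < n'" for i j
      proof -
        have "W i j = (\<Sum>s<?N. ((if j = p' then 1 else 0) * (if s = n + i then 1 else 0)) *
            (\<Sum>s'<?N. ((if j = q' then 1 else 0) * (if s' = n + i then 1 else 0)) * A $$ (s, s')))"
          unfolding W_alt K_def using 4 that by (intro sum.cong refl arg_cong2[of _ _ _ _ "(*)"]) auto
        also have "\<dots> = (if j = p' then 1 else 0) * (\<Sum>s<?N. (if s = n + i then 1 else 0) *
            ((if j = q' then 1 else 0) * (\<Sum>s'<?N. (if s' = n + i then 1 else 0) * A $$ (s, s'))))"
          by (simp only: mult.assoc sum_distrib_left)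
        also have "\<dots> = (if j = p' then 1 else 0) * ((if j = q' then 1 else 0) * A $$ (n + i, n + i))"
          using that k by (simp only: ks[OF that(1)] less_le_trans)
        finally show ?thesis by simp
      qed
      have W2: "W i (n' + l) = 0" if "i < k" "l < n" for i l
        unfolding W_alt K_def using 4 by simp
      have "(\<Sum>i<k. complex_of_real (\<mu> i) * ((\<Sum>j<n'. W i j) + (\<Sum>l<n. W i (n' + l))))
        = (\<Sum>i<k. (if p' = q' then 1 else 0) * (complex_of_real (\<mu> i) * A $$ (n + i, n + i)))"
        using 4 W1 W2 by (intro sum.cong refl) (simp add: sum_distrib_right[symmetric])
      also have "\<dots> = (if p' = q' then 1 else 0) * diag_state n k \<mu> A"
        unfolding sum_distrib_left[symmetric] diag_state_def ..
      finally show ?thesis using 4 by (simp add: rank_one_corner_index)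
    qed
    thus "rank_one_corner n n' k \<mu> Z s c A $$ (p, q) = (\<Sum>l\<in>{..<k} \<times> {..<n' + n}. complex_of_real (case l of (i, j) \<Rightarrow> s * \<mu> i) *
        (\<Sum>s<?N. K l p s * (\<Sum>s'<?N. A $$ (s, s') * cnj (K l q s'))))"
      unfolding sumW .
  qed
qed

text \<open>For the resolvent parameters, the requirement \<open>cmod c \<le> s\<close> is
  |\<kappa>| (1 + t) \<le> |1 + t \<kappa>|; everything else is scalar arithmetic through
  \<open>rank_one_corner_compose\<close>.\<close>

lemma rank_one_corner_q_positive:
  fixes \<mu> :: "nat \<Rightarrow> real"
  assumes mu: "\<And>i. i < k \<Longrightarrow> \<mu> i > 0" and one: "(\<Sum>i<k. \<mu> i) = 1" and k: "k \<le> n" "k \<le> n'"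
    and Zorth: "\<And>a b. a < k \<Longrightarrow> b < k \<Longrightarrow>
      (\<Sum>i<k. complex_of_real (\<mu> i) * cnj (Z a i) * Z b i) = (if a = b then complex_of_real (\<mu> a) else 0)"
    and Z: "\<forall>b<k. (\<Sum>a<k. cnj (Z a b) * Z a b) = 1"
    and Zcon: "\<And>v. nsq n' (\<lambda>p. \<Sum>i<n. v i * Z i p) \<le> nsq n v"
    and \<kappa>: "(cmod \<kappa>)\<^sup>2 \<le> Re \<kappa>"
    and \<Theta>: "\<And>M. M \<in> carrier_mat (n + n') (n + n') \<Longrightarrow> \<Theta> M = rank_one_corner n n' k \<mu> Z 1 \<kappa> M"
  shows "q_positive (n + n') \<Theta>"
proof -
  define \<Psi> where "\<Psi> = (\<lambda>t. rank_one_corner n n' k \<mu> Z (1 / (1 + t)) (\<kappa> / (1 + complex_of_real t * \<kappa>)))"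
  have Re0: "0 \<le> Re \<kappa>" using \<kappa> zero_le_power2 order_trans by blast
  \<comment> \<open>The condition on \<kappa> gives Re \<kappa> \<ge> 0, so the real part here is at
    least 1.\<close>
  have d0: "1 + complex_of_real t * \<kappa> \<noteq> 0" if "t \<ge> 0" for t
  proof
    assume "1 + complex_of_real t * \<kappa> = 0"
    hence "1 + t * Re \<kappa> = 0" by (simp add: complex_eq_iff)
    moreover have "0 \<le> t * Re \<kappa>" using that Re0 by simp
    ultimately show False by simp
  qed
  have "mat_linear (n + n') (n + n') \<Theta>"
    using rank_one_corner_linear[OF k, of \<mu> Z 1 \<kappa>] unfolding mat_linear_def by (auto simp: \<Theta>)
  moreover have "completely_positive (n + n') (\<Psi> t)" if t: "t \<ge> 0" for t
    unfolding \<Psi>_def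
  proof (rule rank_one_corner_completely_positive[OF mu k Zorth Zcon])
    show "0 < 1 / (1 + t)" using t by simp
    have "(cmod \<kappa> * (1 + t))\<^sup>2 = (cmod \<kappa>)\<^sup>2 * (1 + 2 * t) + t\<^sup>2 * (cmod \<kappa>)\<^sup>2"
      by (simp add: power2_eq_square algebra_simps)
    also have "\<dots> \<le> 1 + 2 * t * Re \<kappa> + t\<^sup>2 * (cmod \<kappa>)\<^sup>2"
    proof -
      \<comment> \<open>The condition on \<kappa> describes the disc with centre 1/2 and radius 1/2,
        which lies in the unit disc.\<close>
      have "(Re \<kappa>)\<^sup>2 \<le> (cmod \<kappa>)\<^sup>2" unfolding cmod_power2 by simp
      hence "Re \<kappa> * Re \<kappa> \<le> 1 * Re \<kappa>" using \<kappa> unfolding power2_eq_square by simp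
      hence "Re \<kappa> \<le> 1" using Re0 by (cases "Re \<kappa> = 0") (auto simp: mult_le_cancel_right)
      hence "(cmod \<kappa>)\<^sup>2 \<le> 1" using \<kappa> by simp
      moreover have "2 * t * (cmod \<kappa>)\<^sup>2 \<le> 2 * t * Re \<kappa>" using \<kappa> t by (intro mult_left_mono) auto
      ultimately show ?thesis by (simp add: algebra_simps)
    qed
    also have "\<dots> = (cmod (1 + complex_of_real t * \<kappa>))\<^sup>2"
      unfolding cmod_power2 by (simp add: power2_eq_square algebra_simps)
    finally have "cmod \<kappa> * (1 + t) \<le> cmod (1 + complex_of_real t * \<kappa>)"
      by (rule power2_le_imp_le) simp
    thus "cmod (\<kappa> / (1 + complex_of_real t * \<kappa>)) \<le> 1 / (1 + t)"
      using t d0[OF t] by (simp add: norm_divide field_simps)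
  qed
  moreover have "\<Theta> (A + (- complex_of_real t) \<cdot>\<^sub>m \<Psi> t A) = \<Psi> t A"
    if t: "t \<ge> 0" and A: "A \<in> carrier_mat (n + n') (n + n')" for t A
  proof -
    have c: "A + (- complex_of_real t) \<cdot>\<^sub>m \<Psi> t A \<in> carrier_mat (n + n') (n + n')"
      using A rank_one_corner_index(1) unfolding \<Psi>_def by simp
    have "1 * (1 + (- t) * (1 / (1 + t))) = 1 / (1 + t)" using t by (simp add: field_simps)
    moreover have "\<kappa> * (1 + complex_of_real (- t) * (\<kappa> / (1 + complex_of_real t * \<kappa>))) = \<kappa> / (1 + complex_of_real t * \<kappa>)"
      using d0[OF t] by (simp add: field_simps)
    ultimately have "rank_one_corner n n' k \<mu> Z 1 \<kappa> (A + complex_of_real (- t) \<cdot>\<^sub>m \<Psi> t A) = \<Psi> t A"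
      unfolding \<Psi>_def by (rule rank_one_corner_compose[OF one k Z A])
    thus ?thesis unfolding \<Theta>[OF c] by simp
  qed
  moreover have "\<Psi> t (A + complex_of_real t \<cdot>\<^sub>m \<Theta> A) = \<Theta> A"
    if t: "t \<ge> 0" and A: "A \<in> carrier_mat (n + n') (n + n')" for t A
  proof -
    have "1 / (1 + t) * (1 + t * 1) = 1" using t by (simp add: field_simps)
    moreover have "\<kappa> / (1 + complex_of_real t * \<kappa>) * (1 + complex_of_real t * \<kappa>) = \<kappa>"
      using d0[OF t] by simp
    ultimately show ?thesis
      unfolding \<Theta>[OF A] \<Psi>_def by (rule rank_one_corner_compose[OF one k Z A])
  qed
  ultimately show ?thesis by (rule q_positive_resolventI[where \<Psi> = \<Psi>])
qed

section \<open>Unitaries, contractions and the density matrix\<close>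

text \<open>\<rho>(A^H A) is the sum of \<mu> i times the square norm of column i of A, with
  positive weights.\<close>

lemma diag_state_faithful:
  fixes \<mu> :: "nat \<Rightarrow> real"
  assumes mu: "\<And>i. i < k \<Longrightarrow> \<mu> i > 0" "(\<Sum>i<k. \<mu> i) = 1"
    and \<rho>: "\<forall>A \<in> carrier_mat k k. \<rho> A = (\<Sum>i<k. complex_of_real (\<mu> i) * A $$ (i, i))"
  shows "faithful_state k \<rho>"
proof -
  have sq: "\<rho> (mat_adjoint A * A) = complex_of_real (\<Sum>i<k. \<mu> i * nsq k (\<lambda>j. A $$ (j, i)))"
    if A: "A \<in> carrier_mat k k" for A
  proof -
    note adj = mat_adjoint_carrier[OF A] mat_adjoint_index[OF A]
    have "(mat_adjoint A * A) $$ (i, i) = complex_of_real (nsq k (\<lambda>j. A $$ (j, i)))" if "i < k" for i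
    proof -
      have "(mat_adjoint A * A) $$ (i, i) = (\<Sum>j<k. A $$ (j, i) * cnj (A $$ (j, i)))"
        using A adj that by (simp add: scalar_prod_def atLeast0LessThan mult.commute)
      thus ?thesis unfolding sum_mult_cnj_self .
    qed
    moreover have "mat_adjoint A * A \<in> carrier_mat k k" using adj A by simp
    ultimately show ?thesis using \<rho> by simp
  qed
  have nn: "0 \<le> \<mu> i * nsq k (\<lambda>j. A $$ (j, i))" if "i \<in> {..<k}" for A i
    using mu(1) that by (intro mult_nonneg_nonneg nsq_nonneg) (auto intro: less_imp_le)
  have "A = 0\<^sub>m k k" if A: "A \<in> carrier_mat k k" and z: "\<rho> (mat_adjoint A * A) = 0" for A
  proof -
    have "(\<Sum>i<k. \<mu> i * nsq k (\<lambda>j. A $$ (j, i))) = 0" using z unfolding sq[OF A] by (simp only: of_real_eq_0_iff)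
    hence "\<mu> i * nsq k (\<lambda>j. A $$ (j, i)) = 0" if "i < k" for i
      using nn that by (subst (asm) sum_nonneg_eq_0_iff) auto
    hence "nsq k (\<lambda>j. A $$ (j, i)) = 0" if "i < k" for i using that mu(1)[of i] by force
    hence "A $$ (j, i) = 0" if "i < k" "j < k" for i j
      using that unfolding nsq_def by (subst (asm) sum_nonneg_eq_0_iff) auto
    thus ?thesis using A by (intro eq_matI) auto
  qed
  moreover have "\<rho> (1\<^sub>m k) = 1" using \<rho> mu(2) by (simp flip: of_real_sum)
  moreover have "0 \<le> \<rho> (mat_adjoint A * A)" if "A \<in> carrier_mat k k" for A
  proof -
    have "0 \<le> (\<Sum>i<k. \<mu> i * nsq k (\<lambda>j. A $$ (j, i)))" by (intro sum_nonneg nn)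
    thus ?thesis unfolding sq[OF that] less_eq_complex_def Re_complex_of_real Im_complex_of_real by simp
  qed
  ultimately show ?thesis
    unfolding faithful_state_def using \<rho> by (auto simp: distrib_left sum.distrib sum_distrib_left mult_ac)
qed

text \<open>Pairing with the matrix unit E_{j i} reads off one entry, since tr (E_{j i} \<Omega>) is
  the entry (i, j) of \<Omega>.\<close>

lemma trace_density_diag:
  assumes \<Omega>: "trace_density k \<rho> \<Omega>"
    and \<rho>: "\<forall>A \<in> carrier_mat k k. \<rho> A = (\<Sum>i<k. complex_of_real (\<mu> i) * A $$ (i, i))"
    and ij: "i < k" "j < k"
  shows "\<Omega> $$ (i, j) = (if i = j then complex_of_real (\<mu> i) else 0)"
proof -
  have \<Omega>c: "\<Omega> \<in> carrier_mat k k" using \<Omega> unfolding trace_density_def by blast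
  define A :: "complex mat" where "A = mat k k (\<lambda>(a, b). (if a = j then 1 else 0) * (if b = i then 1 else 0))"
  have A: "A \<in> carrier_mat k k" unfolding A_def by simp
  have "mat_trace (A * \<Omega>) = (\<Sum>a<k. \<Sum>b<k. (if a = j then 1 else 0) * ((if b = i then 1 else 0) * \<Omega> $$ (b, a)))"
    unfolding mat_trace_def using A \<Omega>c by (simp add: scalar_prod_def atLeast0LessThan A_def mult.assoc)
  also have "\<dots> = \<Omega> $$ (i, j)"
    using ij by (simp only: sum_distrib_left[symmetric] sum_mult_delta mult_1)
  finally have "\<Omega> $$ (i, j) = \<rho> A" using \<Omega> A unfolding trace_density_def by simp
  also have "\<dots> = (\<Sum>a<k. (if a = j then 1 else 0) * (if a = i then complex_of_real (\<mu> a) else 0))"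
    using \<rho> A unfolding A_def by (simp add: mult.commute cong: if_cong) (intro sum.cong refl, auto)
  also have "\<dots> = (if i = j then complex_of_real (\<mu> i) else 0)"
    using ij by (subst sum_mult_delta) auto
  finally show ?thesis .
qed

lemma times_mat_index:
  "A \<in> carrier_mat n m \<Longrightarrow> B \<in> carrier_mat m p \<Longrightarrow> i < n \<Longrightarrow> j < p \<Longrightarrow>
    (A * B) $$ (i, j) = (\<Sum>c<m. A $$ (i, c) * B $$ (c, j))"
  by (simp add: scalar_prod_def atLeast0LessThan)

text \<open>As \<Omega> is diagonal and stands on the right, its weights fall on the column index
  b.\<close>

lemma mat_trace_adjoint_density:
  assumes X: "X \<in> carrier_mat k k" and B: "B \<in> carrier_mat k k" and \<Omega>: "\<Omega> \<in> carrier_mat k k"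
    and diag: "\<forall>i<k. \<forall>j<k. \<Omega> $$ (i, j) = (if i = j then complex_of_real (\<mu> i) else 0)"
  shows "mat_trace (mat_adjoint X * B * \<Omega>) =
    (\<Sum>a<k. \<Sum>b<k. complex_of_real (\<mu> b) * cnj (X $$ (a, b)) * B $$ (a, b))"
proof -
  note adj = mat_adjoint_carrier[OF X] mat_adjoint_index[OF X]
  have XB: "mat_adjoint X * B \<in> carrier_mat k k" using adj B by simp
  have "(mat_adjoint X * B * \<Omega>) $$ (b, b) = (\<Sum>a<k. complex_of_real (\<mu> b) * cnj (X $$ (a, b)) * B $$ (a, b))"
    if b: "b < k" for b
  proof -
    have "(mat_adjoint X * B * \<Omega>) $$ (b, b) = (\<Sum>c<k. (mat_adjoint X * B) $$ (b, c) * \<Omega> $$ (c, b))"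
      by (rule times_mat_index[OF XB \<Omega> b b])
    also have "\<dots> = (\<Sum>c<k. (mat_adjoint X * B) $$ (b, c) * (if c = b then complex_of_real (\<mu> b) else 0))"
      using b by (intro sum.cong refl) (auto simp: diag)
    also have "\<dots> = (mat_adjoint X * B) $$ (b, b) * complex_of_real (\<mu> b)" using b by (rule sum_mult_delta(2))
    also have "(mat_adjoint X * B) $$ (b, b) = (\<Sum>a<k. cnj (X $$ (a, b)) * B $$ (a, b))"
      using adj B b by (simp add: scalar_prod_def atLeast0LessThan)
    finally show ?thesis unfolding sum_distrib_right by (simp only: mult_ac)
  qed
  moreover have "dim_row (mat_adjoint X * B * \<Omega>) = k" using adj by simp
  ultimately have "mat_trace (mat_adjoint X * B * \<Omega>) =
      (\<Sum>b<k. \<Sum>a<k. complex_of_real (\<mu> b) * cnj (X $$ (a, b)) * B $$ (a, b))"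
    unfolding mat_trace_def by simp
  thus ?thesis by (simp only: sum.swap[of "\<lambda>b a. complex_of_real (\<mu> b) * cnj (X $$ (a, b)) * B $$ (a, b)"])
qed

section \<open>Operator norm and contractions\<close>

lemma euclid_norm_nsq: "euclid_norm v = sqrt (nsq (dim_vec v) (\<lambda>i. v $ i))"
  unfolding euclid_norm_def nsq_def ..

lemma euclid_norm_mult_mat_vec:
  assumes "E \<in> carrier_mat p q" "v \<in> carrier_vec q"
  shows "euclid_norm (E *\<^sub>v v) = sqrt (nsq p (\<lambda>i. \<Sum>j<q. E $$ (i, j) * v $ j))"
proof -
  have "nsq p (\<lambda>i. (E *\<^sub>v v) $ i) = nsq p (\<lambda>i. \<Sum>j<q. E $$ (i, j) * v $ j)"
    unfolding nsq_def using assms by (intro sum.cong refl) (simp add: scalar_prod_def atLeast0LessThan)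
  thus ?thesis unfolding euclid_norm_nsq using assms by simp
qed

lemma nsq_scale: "nsq n (\<lambda>i. c * v i) = (cmod c)\<^sup>2 * nsq n v"
  unfolding nsq_def by (simp add: norm_mult power_mult_distrib sum_distrib_left)

text \<open>A real supremum is informative only for a bounded set, and F, the squared Frobenius
  norm, provides the bound. Vectors are rescaled to norm 1; those of norm 0 are handled by F
  too.\<close>

lemma contraction_mat_iff:
  "contraction_mat p q E \<longleftrightarrow> E \<in> carrier_mat p q \<and>
     (\<forall>w. nsq p (\<lambda>i. \<Sum>j<q. E $$ (i, j) * w j) \<le> nsq q w)"
proof (cases "E \<in> carrier_mat p q")
  case E: True
  define S where "S = {v \<in> carrier_vec q. euclid_norm v \<le> 1}"
  have op: "op_norm E = (SUP v\<in>S. euclid_norm (E *\<^sub>v v))" unfolding op_norm_def S_def using E by simp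
  define F where "F = (\<Sum>i<p. nsq q (\<lambda>j. E $$ (i, j)))"
  have F0: "0 \<le> F" unfolding F_def by (intro sum_nonneg nsq_nonneg)
  have frob: "nsq p (\<lambda>i. \<Sum>j<q. E $$ (i, j) * w j) \<le> F * nsq q w" for w
    unfolding F_def sum_distrib_right nsq_def[of p]
    by (intro sum_mono cauchy_schwarz_nsq)
  have S: "nsq q (\<lambda>j. v $ j) \<le> 1" if "v \<in> S" for v
    using that unfolding S_def euclid_norm_nsq by auto
  have bdd: "bdd_above ((\<lambda>v. euclid_norm (E *\<^sub>v v)) ` S)"
  proof (rule bdd_aboveI2)
    fix v assume v: "v \<in> S"
    have "nsq p (\<lambda>i. \<Sum>j<q. E $$ (i, j) * v $ j) \<le> F * nsq q (\<lambda>j. v $ j)" by (rule frob)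
    also have "\<dots> \<le> F * 1" by (intro mult_left_mono S v F0)
    finally show "euclid_norm (E *\<^sub>v v) \<le> sqrt F"
      using euclid_norm_mult_mat_vec[OF E, of v] v unfolding S_def by simp
  qed
  have ne: "S \<noteq> {}"
  proof -
    have "0\<^sub>v q \<in> S" unfolding S_def euclid_norm_nsq nsq_def by simp
    thus ?thesis by blast
  qed
  show ?thesis
  proof
    assume "contraction_mat p q E"
    hence le: "op_norm E \<le> 1" unfolding contraction_mat_def by blast
    have "nsq p (\<lambda>i. \<Sum>j<q. E $$ (i, j) * w j) \<le> nsq q w" for w
    proof (cases "nsq q w = 0")
      case True
      thus ?thesis using frob[of w] by simp
    next
      case False
      define N where "N = nsq q w"
      have N: "N > 0" using False nsq_nonneg[of q w] unfolding N_def by simp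
      define c where "c = complex_of_real (1 / sqrt N)"
      have c: "(cmod c)\<^sup>2 = 1 / N" unfolding c_def using N by (simp add: norm_divide power_divide)
      define v where "v = vec q (\<lambda>j. c * w j)"
      have vc: "v \<in> carrier_vec q" unfolding v_def by simp
      have "nsq q (\<lambda>j. v $ j) = nsq q (\<lambda>j. c * w j)"
        unfolding nsq_def v_def by (intro sum.cong refl) simp
      also have "\<dots> = 1" unfolding nsq_scale c N_def[symmetric] using N by simp
      finally have "v \<in> S" unfolding S_def euclid_norm_nsq using vc by simp
      hence "euclid_norm (E *\<^sub>v v) \<le> 1"
        using cSUP_upper[OF _ bdd, of v] le unfolding op by simp
      hence "nsq p (\<lambda>i. \<Sum>j<q. E $$ (i, j) * v $ j) \<le> 1"
        unfolding euclid_norm_mult_mat_vec[OF E vc] by simp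
      moreover have "nsq p (\<lambda>i. \<Sum>j<q. E $$ (i, j) * v $ j) = nsq p (\<lambda>i. c * (\<Sum>j<q. E $$ (i, j) * w j))"
        unfolding nsq_def v_def by (intro sum.cong refl) (simp add: sum_distrib_left mult.left_commute)
      ultimately have "nsq p (\<lambda>i. \<Sum>j<q. E $$ (i, j) * w j) / N \<le> 1"
        unfolding nsq_scale c by simp
      thus ?thesis using N unfolding N_def by simp
    qed
    thus "E \<in> carrier_mat p q \<and> (\<forall>w. nsq p (\<lambda>i. \<Sum>j<q. E $$ (i, j) * w j) \<le> nsq q w)" using E by blast
  next
    assume *: "E \<in> carrier_mat p q \<and> (\<forall>w. nsq p (\<lambda>i. \<Sum>j<q. E $$ (i, j) * w j) \<le> nsq q w)"
    have "op_norm E \<le> 1" unfolding op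
    proof (rule cSUP_least[OF ne])
      fix v assume v: "v \<in> S"
      have "nsq p (\<lambda>i. \<Sum>j<q. E $$ (i, j) * v $ j) \<le> 1"
        using * S[OF v] order_trans by blast
      thus "euclid_norm (E *\<^sub>v v) \<le> 1"
        using euclid_norm_mult_mat_vec[OF E, of v] v unfolding S_def by simp
    qed
    thus "contraction_mat p q E" unfolding contraction_mat_def using E by blast
  qed
qed (simp add: contraction_mat_def)

lemma nsq_split_add: "nsq (k + e) v = nsq k v + nsq e (\<lambda>i. v (k + i))"
  unfolding nsq_def by (rule sum_lessThan_split_add)

section \<open>Unitary corners and block diagonal ranges\<close>

lemma unitary_mat_index:
  assumes "unitary_mat k X"
  shows "X \<in> carrier_mat k k"
    "\<And>i j. i < k \<Longrightarrow> j < k \<Longrightarrow> (\<Sum>a<k. cnj (X $$ (a, i)) * X $$ (a, j)) = (if i = j then 1 else 0)"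
    "\<And>i j. i < k \<Longrightarrow> j < k \<Longrightarrow> (\<Sum>a<k. X $$ (i, a) * cnj (X $$ (j, a))) = (if i = j then 1 else 0)"
proof -
  show X: "X \<in> carrier_mat k k" using assms unfolding unitary_mat_def by blast
  note adj = mat_adjoint_carrier[OF X] mat_adjoint_index[OF X]
  show "(\<Sum>a<k. cnj (X $$ (a, i)) * X $$ (a, j)) = (if i = j then 1 else 0)" if "i < k" "j < k" for i j
  proof -
    have "(mat_adjoint X * X) $$ (i, j) = (\<Sum>a<k. cnj (X $$ (a, i)) * X $$ (a, j))"
      using X adj that by (simp add: scalar_prod_def atLeast0LessThan)
    thus ?thesis using assms that unfolding unitary_mat_def by simp
  qed
  show "(\<Sum>a<k. X $$ (i, a) * cnj (X $$ (j, a))) = (if i = j then 1 else 0)" if "i < k" "j < k" for i j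
  proof -
    have "(X * mat_adjoint X) $$ (i, j) = (\<Sum>a<k. X $$ (i, a) * cnj (X $$ (j, a)))"
      using X adj that by (simp add: scalar_prod_def atLeast0LessThan)
    thus ?thesis using assms that unfolding unitary_mat_def by simp
  qed
qed

lemma unitary_matI:
  assumes X: "X \<in> carrier_mat k k"
    and "\<And>i j. i < k \<Longrightarrow> j < k \<Longrightarrow> (\<Sum>a<k. cnj (X $$ (a, i)) * X $$ (a, j)) = (if i = j then 1 else 0)"
    and "\<And>i j. i < k \<Longrightarrow> j < k \<Longrightarrow> (\<Sum>a<k. X $$ (i, a) * cnj (X $$ (j, a))) = (if i = j then 1 else 0)"
  shows "unitary_mat k X"
proof -
  note adj = mat_adjoint_carrier[OF X] mat_adjoint_index[OF X]
  have "mat_adjoint X * X = 1\<^sub>m k"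
    using X adj assms(2) by (intro eq_matI) (auto simp: scalar_prod_def atLeast0LessThan)
  moreover have "X * mat_adjoint X = 1\<^sub>m k"
    using X adj assms(3) by (intro eq_matI) (auto simp: scalar_prod_def atLeast0LessThan)
  ultimately show ?thesis unfolding unitary_mat_def using X by blast
qed

lemma commute_diag_iff:
  assumes X: "X \<in> carrier_mat k k" and \<Omega>: "\<Omega> \<in> carrier_mat k k"
    and diag: "\<forall>i<k. \<forall>j<k. \<Omega> $$ (i, j) = (if i = j then complex_of_real (\<mu> i) else 0)"
  shows "X * \<Omega> = \<Omega> * X \<longleftrightarrow>
    (\<forall>i<k. \<forall>p<k. complex_of_real (\<mu> i) * X $$ (i, p) = complex_of_real (\<mu> p) * X $$ (i, p))"
proof -
  have l: "(X * \<Omega>) $$ (i, p) = complex_of_real (\<mu> p) * X $$ (i, p)" if "i < k" "p < k" for i p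
  proof -
    have "(X * \<Omega>) $$ (i, p) = (\<Sum>a<k. X $$ (i, a) * (if a = p then complex_of_real (\<mu> p) else 0))"
      using X \<Omega> that by (auto simp: scalar_prod_def atLeast0LessThan diag intro!: sum.cong)
    thus ?thesis using sum_mult_delta(2)[OF that(2), of "\<lambda>a. X $$ (i, a)"] by (simp add: mult.commute)
  qed
  have r: "(\<Omega> * X) $$ (i, p) = complex_of_real (\<mu> i) * X $$ (i, p)" if "i < k" "p < k" for i p
  proof -
    have "(\<Omega> * X) $$ (i, p) = (\<Sum>a<k. (if a = i then complex_of_real (\<mu> i) else 0) * X $$ (a, p))"
      using X \<Omega> that by (auto simp: scalar_prod_def atLeast0LessThan diag intro!: sum.cong)
    thus ?thesis using sum_mult_delta(1)[OF that(1), of "complex_of_real (\<mu> i)" "\<lambda>a. X $$ (a, p)"] by simp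
  qed
  show ?thesis
  proof
    assume "X * \<Omega> = \<Omega> * X"
    thus "\<forall>i<k. \<forall>p<k. complex_of_real (\<mu> i) * X $$ (i, p) = complex_of_real (\<mu> p) * X $$ (i, p)"
      using l r by metis
  next
    assume *: "\<forall>i<k. \<forall>p<k. complex_of_real (\<mu> i) * X $$ (i, p) = complex_of_real (\<mu> p) * X $$ (i, p)"
    show "X * \<Omega> = \<Omega> * X"
    proof (rule eq_matI)
      fix i j assume "i < dim_row (\<Omega> * X)" "j < dim_col (\<Omega> * X)"
      hence "i < k" "j < k" using X \<Omega> by auto
      thus "(X * \<Omega>) $$ (i, j) = (\<Omega> * X) $$ (i, j)" using l r * by metis
    qed (use X \<Omega> in auto)
  qed
qed

text \<open>Passes between the block formula for \<gamma> and its entries. Every n by n' matrix is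
  reassembled from its four blocks, so quantifying over blocks is quantifying over all
  matrices.\<close>

lemma block_diag_formula_iff:
  fixes Z :: "nat \<Rightarrow> nat \<Rightarrow> complex"
  assumes kn: "k \<le> n" "k \<le> n'" and X: "X \<in> carrier_mat k k" and E: "E \<in> carrier_mat (n - k) (n' - k)"
    and \<Omega>: "\<Omega> \<in> carrier_mat k k"
    and diag: "\<forall>i<k. \<forall>j<k. \<Omega> $$ (i, j) = (if i = j then complex_of_real (\<mu> i) else 0)"
    and Z: "\<And>i p. i < n \<Longrightarrow> p < n' \<Longrightarrow> Z i p = four_block_mat X (0\<^sub>m k (n' - k)) (0\<^sub>m (n - k) k) E $$ (i, p)"
  shows "(\<forall>B \<in> carrier_mat k k. \<forall>W \<in> carrier_mat k (n' - k).
      \<forall>Q \<in> carrier_mat (n - k) k. \<forall>Y \<in> carrier_mat (n - k) (n' - k).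
        \<gamma> (four_block_mat B W Q Y) = (\<kappa> * mat_trace (mat_adjoint X * B * \<Omega>)) \<cdot>\<^sub>m
          four_block_mat X (0\<^sub>m k (n' - k)) (0\<^sub>m (n - k) k) E) \<longleftrightarrow>
    (\<forall>M \<in> carrier_mat n n'. \<gamma> M = mat n n' (\<lambda>(i, p).
       \<kappa> * (\<Sum>a<k. \<Sum>b<k. complex_of_real (\<mu> b) * cnj (Z a b) * M $$ (a, b)) * Z i p))"
    (is "?L \<longleftrightarrow> ?R")
proof -
  let ?D = "four_block_mat X (0\<^sub>m k (n' - k)) (0\<^sub>m (n - k) k) E"
  have D: "?D \<in> carrier_mat n n'" using four_block_carrier_mat[OF X E] kn by simp
  have ZX: "Z a b = X $$ (a, b)" if "a < k" "b < k" for a b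
    using Z[of a b] that kn X E by simp
  have key: "(\<kappa> * mat_trace (mat_adjoint X * B * \<Omega>)) \<cdot>\<^sub>m ?D = mat n n' (\<lambda>(i, p).
       \<kappa> * (\<Sum>a<k. \<Sum>b<k. complex_of_real (\<mu> b) * cnj (Z a b) * M $$ (a, b)) * Z i p)"
    if B: "B \<in> carrier_mat k k" and M: "\<And>a b. a < k \<Longrightarrow> b < k \<Longrightarrow> M $$ (a, b) = B $$ (a, b)" for B M
  proof -
    have "(\<Sum>a<k. \<Sum>b<k. complex_of_real (\<mu> b) * cnj (Z a b) * M $$ (a, b)) = mat_trace (mat_adjoint X * B * \<Omega>)"
      unfolding mat_trace_adjoint_density[OF X B \<Omega> diag] by (intro sum.cong refl) (simp add: ZX M)
    moreover have "dim_row X + dim_row E = n" "dim_col X + dim_col E = n'" using X E kn by auto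
    ultimately show ?thesis using X E by (intro eq_matI) (simp_all add: Z)
  qed
  show ?thesis
  proof
    assume L: ?L
    show ?R
    proof
      fix M :: "complex mat" assume M: "M \<in> carrier_mat n n'"
      define B W Q Y where "B = mat k k (\<lambda>(i, j). M $$ (i, j))"
        and "W = mat k (n' - k) (\<lambda>(i, j). M $$ (i, k + j))"
        and "Q = mat (n - k) k (\<lambda>(i, j). M $$ (k + i, j))"
        and "Y = mat (n - k) (n' - k) (\<lambda>(i, j). M $$ (k + i, k + j))"
      have c: "B \<in> carrier_mat k k" "W \<in> carrier_mat k (n' - k)" "Q \<in> carrier_mat (n - k) k"
        "Y \<in> carrier_mat (n - k) (n' - k)" unfolding B_def W_def Q_def Y_def by auto
      have "four_block_mat B W Q Y = M"
        unfolding B_def W_def Q_def Y_def using M kn by (intro eq_matI) auto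
      hence "\<gamma> M = (\<kappa> * mat_trace (mat_adjoint X * B * \<Omega>)) \<cdot>\<^sub>m ?D" using L c by metis
      also have "\<dots> = mat n n' (\<lambda>(i, p).
         \<kappa> * (\<Sum>a<k. \<Sum>b<k. complex_of_real (\<mu> b) * cnj (Z a b) * M $$ (a, b)) * Z i p)"
        by (rule key[OF c(1)]) (simp add: B_def)
      finally show "\<gamma> M = mat n n' (\<lambda>(i, p).
         \<kappa> * (\<Sum>a<k. \<Sum>b<k. complex_of_real (\<mu> b) * cnj (Z a b) * M $$ (a, b)) * Z i p)" .
    qed
  next
    assume R: ?R
    show ?L
    proof (intro ballI)
      fix B W Q Y :: "complex mat"
      assume B: "B \<in> carrier_mat k k" and Y: "Y \<in> carrier_mat (n - k) (n' - k)"
      have "four_block_mat B W Q Y \<in> carrier_mat n n'" using four_block_carrier_mat[OF B Y] kn by simp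
      hence "\<gamma> (four_block_mat B W Q Y) = mat n n' (\<lambda>(i, p).
         \<kappa> * (\<Sum>a<k. \<Sum>b<k. complex_of_real (\<mu> b) * cnj (Z a b) * four_block_mat B W Q Y $$ (a, b)) * Z i p)"
        using R by blast
      also have "\<dots> = (\<kappa> * mat_trace (mat_adjoint X * B * \<Omega>)) \<cdot>\<^sub>m ?D"
        by (rule key[OF B, symmetric]) (use B Y in simp)
      finally show "\<gamma> (four_block_mat B W Q Y) = (\<kappa> * mat_trace (mat_adjoint X * B * \<Omega>)) \<cdot>\<^sub>m ?D" .
    qed
  qed
qed

text \<open>X is isometric on the first k coordinates and E contractive on the others, which bounds
  Z acting on columns. The Kraus construction needs Z acting on rows, which the bilinear form
  supplies.\<close>

lemma block_diag_contraction:
  fixes Z :: "nat \<Rightarrow> nat \<Rightarrow> complex"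
  assumes kn: "k \<le> n" "k \<le> n'" and X: "unitary_mat k X" and E: "contraction_mat (n - k) (n' - k) E"
    and Z: "\<And>i p. i < n \<Longrightarrow> p < n' \<Longrightarrow> Z i p = four_block_mat X (0\<^sub>m k (n' - k)) (0\<^sub>m (n - k) k) E $$ (i, p)"
  shows "nsq n' (\<lambda>p. \<Sum>i<n. v i * Z i p) \<le> nsq n v"
proof -
  note U = unitary_mat_index[OF X]
  have Ec: "E \<in> carrier_mat (n - k) (n' - k)" using E unfolding contraction_mat_def by blast
  have iso: "nsq k (\<lambda>i. \<Sum>p<k. X $$ (i, p) * w p) = nsq k w" for w
  proof -
    have "complex_of_real (nsq k (\<lambda>i. \<Sum>p<k. X $$ (i, p) * w p))
      = (\<Sum>i\<in>{..<k}. cnj (\<Sum>p<k. X $$ (i, p) * w p) * (\<Sum>p<k. X $$ (i, p) * w p))"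
      unfolding sum_mult_cnj_self[symmetric] by (simp only: mult.commute)
    also have "\<dots> = (\<Sum>p<k. \<Sum>q<k. cnj (w p) * (\<Sum>i\<in>{..<k}. cnj (X $$ (i, p)) * X $$ (i, q)) * w q)"
      by (rule gram_form[symmetric])
    also have "\<dots> = (\<Sum>p<k. \<Sum>q<k. cnj (w p) * ((if q = p then 1 else 0) * w q))"
      by (intro sum.cong refl) (auto simp: U(2))
    also have "\<dots> = (\<Sum>p<k. w p * cnj (w p))"
      by (intro sum.cong refl) (simp add: sum_distrib_left[symmetric] sum_mult_delta mult.commute)
    also have "\<dots> = complex_of_real (nsq k w)" by (rule sum_mult_cnj_self)
    finally show ?thesis by (simp only: of_real_eq_iff)
  qed
  have col: "nsq n (\<lambda>i. \<Sum>p<n'. Z i p * w p) \<le> 1 * nsq n' w" for w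
  proof -
    have n: "n = k + (n - k)" "n' = k + (n' - k)" using kn by auto
    have i1: "(\<Sum>p<n'. Z i p * w p) = (\<Sum>p<k. X $$ (i, p) * w p)" if "i < k" for i
      using that kn U(1) Ec by (subst n(2), unfold sum_lessThan_split_add) (simp add: Z)
    have i2: "(\<Sum>p<n'. Z (k + i) p * w p) = (\<Sum>p<n' - k. E $$ (i, p) * w (k + p))" if "i < n - k" for i
      using that kn U(1) Ec by (subst n(2), unfold sum_lessThan_split_add) (simp add: Z)
    have "nsq n (\<lambda>i. \<Sum>p<n'. Z i p * w p)
      = nsq k (\<lambda>i. \<Sum>p<n'. Z i p * w p) + nsq (n - k) (\<lambda>i. \<Sum>p<n'. Z (k + i) p * w p)"
      by (subst (1) n(1), rule nsq_split_add)
    also have "\<dots> = nsq k (\<lambda>i. \<Sum>p<k. X $$ (i, p) * w p) + nsq (n - k) (\<lambda>i. \<Sum>p<n' - k. E $$ (i, p) * w (k + p))"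
      unfolding nsq_def using i1 i2 by (intro arg_cong2[of _ _ _ _ "(+)"] sum.cong refl) auto
    also have "\<dots> \<le> nsq k w + nsq (n' - k) (\<lambda>p. w (k + p))"
      unfolding iso using E unfolding contraction_mat_iff by simp
    also have "\<dots> = nsq (k + (n' - k)) w" by (rule nsq_split_add[symmetric])
    also have "\<dots> = nsq n' w" using n(2) by simp
    finally show ?thesis by simp
  qed
  have "nsq n' (\<lambda>p. \<Sum>i<n. v i * Z i p) \<le> 1 * nsq n v"
    by (rule bil_bound_row, rule bil_bound_of_col, rule col) simp
  thus ?thesis by simp
qed

text \<open>Identifies the corner map with \<open>rank_one_corner\<close> for the scalars 1 and
  \<kappa>, and derives the conditions on Z from unitarity, commutation and contractivity.\<close>

lemma block_diag_q_corner:
  fixes \<mu> :: "nat \<Rightarrow> real" and Z :: "nat \<Rightarrow> nat \<Rightarrow> complex"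
  assumes mu: "\<And>i. i < k \<Longrightarrow> \<mu> i > 0" and one: "(\<Sum>i<k. \<mu> i) = 1" and kn: "k \<le> n" "k \<le> n'"
    and \<phi>: "\<forall>A \<in> carrier_mat n n. \<phi> A = (\<Sum>i<k. complex_of_real (\<mu> i) * A $$ (i, i)) \<cdot>\<^sub>m 1\<^sub>m n"
    and \<psi>: "\<forall>D \<in> carrier_mat n' n'. \<psi> D = (\<Sum>i<k. complex_of_real (\<mu> i) * D $$ (i, i)) \<cdot>\<^sub>m 1\<^sub>m n'"
    and X: "unitary_mat k X" and E: "contraction_mat (n - k) (n' - k) E"
    and comm: "\<forall>i<k. \<forall>p<k. complex_of_real (\<mu> i) * X $$ (i, p) = complex_of_real (\<mu> p) * X $$ (i, p)"
    and Z: "\<And>i p. i < n \<Longrightarrow> p < n' \<Longrightarrow> Z i p = four_block_mat X (0\<^sub>m k (n' - k)) (0\<^sub>m (n - k) k) E $$ (i, p)"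
    and \<kappa>: "(cmod \<kappa>)\<^sup>2 \<le> Re \<kappa>" and lin: "mat_linear n n' \<gamma>"
    and \<gamma>: "\<forall>M \<in> carrier_mat n n'. \<gamma> M = mat n n' (\<lambda>(i, p).
       \<kappa> * (\<Sum>a<k. \<Sum>b<k. complex_of_real (\<mu> b) * cnj (Z a b) * M $$ (a, b)) * Z i p)"
  shows "q_corner n n' \<phi> \<psi> \<gamma>"
  unfolding q_corner_def
proof (intro conjI lin)
  note U = unitary_mat_index[OF X]
  have Ec: "E \<in> carrier_mat (n - k) (n' - k)" using E unfolding contraction_mat_def by blast
  have ZX: "Z a b = X $$ (a, b)" if "a < k" "b < k" for a b
    using Z[of a b] that kn U(1) Ec by simp
  show "q_positive (n + n') (corner_map n n' \<phi> \<psi> \<gamma>)"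
  proof (rule rank_one_corner_q_positive[where k = k and \<mu> = \<mu> and Z = Z and \<kappa> = \<kappa>, OF mu one kn])
    show "(\<Sum>i<k. complex_of_real (\<mu> i) * cnj (Z a i) * Z b i) = (if a = b then complex_of_real (\<mu> a) else 0)"
      if ab: "a < k" "b < k" for a b
    proof -
      have "(\<Sum>i<k. complex_of_real (\<mu> i) * cnj (Z a i) * Z b i)
        = (\<Sum>i<k. complex_of_real (\<mu> b) * (X $$ (b, i) * cnj (X $$ (a, i))))"
      proof (intro sum.cong refl)
        fix i assume i: "i \<in> {..<k}"
        have "complex_of_real (\<mu> i) * cnj (Z a i) * Z b i = (complex_of_real (\<mu> i) * X $$ (b, i)) * cnj (X $$ (a, i))"
          using i ab by (simp add: ZX)
        \<comment> \<open>Commutation with \<Omega> moves the weight from the column index i to the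
          row index b, out of the sum; orthonormality of rows remains.\<close>
        also have "complex_of_real (\<mu> i) * X $$ (b, i) = complex_of_real (\<mu> b) * X $$ (b, i)"
          using comm i ab by (metis lessThan_iff)
        finally show "complex_of_real (\<mu> i) * cnj (Z a i) * Z b i
          = complex_of_real (\<mu> b) * (X $$ (b, i) * cnj (X $$ (a, i)))" by (simp only: mult.assoc)
      qed
      thus ?thesis unfolding sum_distrib_left[symmetric] using U(3)[OF ab(2,1)] by auto
    qed
    show "\<forall>b<k. (\<Sum>a<k. cnj (Z a b) * Z a b) = 1" using U(2) by (simp add: ZX)
    show "nsq n' (\<lambda>p. \<Sum>i<n. v i * Z i p) \<le> nsq n v" for v
      by (rule block_diag_contraction[OF kn X E Z])
    show "(cmod \<kappa>)\<^sup>2 \<le> Re \<kappa>" by (rule \<kappa>)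
    fix M :: "complex mat" assume M: "M \<in> carrier_mat (n + n') (n + n')"
    note ci = corner_map_index[where \<phi> = \<phi> and \<psi> = \<psi>, OF lin \<phi> \<psi> M]
    note ri = rank_one_corner_index[where n = n and n' = n' and k = k and \<mu> = \<mu> and Z = Z and s = 1 and c = \<kappa> and M = M]
    show "corner_map n n' \<phi> \<psi> \<gamma> M = rank_one_corner n n' k \<mu> Z 1 \<kappa> M"
    proof (rule block_mat_eqI[OF ci(1) ri(1)])
      show "corner_map n n' \<phi> \<psi> \<gamma> M $$ (i, j) = rank_one_corner n n' k \<mu> Z 1 \<kappa> M $$ (i, j)"
        if "i < n" "j < n" for i j
        unfolding ci(2)[OF that] ri(2)[OF that] diag_state_def using kn by simp
      show "corner_map n n' \<phi> \<psi> \<gamma> M $$ (n + p, n + q) = rank_one_corner n n' k \<mu> Z 1 \<kappa> M $$ (n + p, n + q)"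
        if "p < n'" "q < n'" for p q
        unfolding ci(5)[OF that] ri(5)[OF that] diag_state_def using kn by simp
      show "corner_map n n' \<phi> \<psi> \<gamma> M $$ (i, n + p) = rank_one_corner n n' k \<mu> Z 1 \<kappa> M $$ (i, n + p)"
        if "i < n" "p < n'" for i p
        unfolding ci(3)[OF that] ri(3)[OF that] corner_functional_def using kn that \<gamma> by simp
      show "corner_map n n' \<phi> \<psi> \<gamma> M $$ (n + p, i) = rank_one_corner n n' k \<mu> Z 1 \<kappa> M $$ (n + p, i)"
        if "i < n" "p < n'" for i p
        unfolding ci(4)[OF that] ri(4)[OF that] corner_functional_adj_def using kn that \<gamma> by simp
    qed
  qed
qed

text \<open>The first five conjuncts confirm what the informal statement takes for granted about
  \<phi>, \<psi> and \<rho>. The scalar is called \<kappa> because \<lambda> denotes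
  abstraction.\<close>

theorem theorem3p6:
  fixes \<mu> r :: "nat \<Rightarrow> real" and k k' n n' :: nat
    and \<phi> \<psi> :: "complex mat \<Rightarrow> complex mat"
    and \<rho> :: "complex mat \<Rightarrow> complex" and \<Omega> :: "complex mat"
  assumes \<mu>_decreasing: "\<And>i j. i \<le> j \<Longrightarrow> j < k \<Longrightarrow> \<mu> j \<le> \<mu> i"
    and r_decreasing: "\<And>i j. i \<le> j \<Longrightarrow> j < k' \<Longrightarrow> r j \<le> r i"
    and \<mu>_pos: "\<And>i. i < k \<Longrightarrow> \<mu> i > 0"
    and r_pos: "\<And>i. i < k' \<Longrightarrow> r i > 0"
    and \<mu>_sum: "(\<Sum>i<k. \<mu> i) = 1"
    and r_sum: "(\<Sum>i<k'. r i) = 1"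
    and n_ge: "n \<ge> k"
    and n'_ge: "n' \<ge> k'"
    and \<phi>_def: "\<And>A. A \<in> carrier_mat n n \<Longrightarrow>
      \<phi> A = (\<Sum>i<k. complex_of_real (\<mu> i) * A $$ (i, i)) \<cdot>\<^sub>m 1\<^sub>m n"
    and \<psi>_def: "\<And>D. D \<in> carrier_mat n' n' \<Longrightarrow>
      \<psi> D = (\<Sum>i<k'. complex_of_real (r i) * D $$ (i, i)) \<cdot>\<^sub>m 1\<^sub>m n'"
    and \<rho>_def: "\<And>A. A \<in> carrier_mat k k \<Longrightarrow>
      \<rho> A = (\<Sum>i<k. complex_of_real (\<mu> i) * A $$ (i, i))"
    and \<Omega>_def: "trace_density k \<rho> \<Omega>"
  shows "unital n \<phi> \<and> q_positive n \<phi> \<and> unital n' \<psi> \<and> q_positive n' \<psi> \<and> faithful_state k \<rho> \<and>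
    ((\<exists>\<gamma>. q_corner n n' \<phi> \<psi> \<gamma> \<and> (\<exists>B \<in> carrier_mat n n'. \<gamma> B \<noteq> 0\<^sub>m n n'))
       \<longrightarrow> k = k' \<and> (\<forall>i<k. \<mu> i = r i)) \<and>
    (k = k' \<and> (\<forall>i<k. \<mu> i = r i) \<longrightarrow>
       (\<forall>\<gamma>. mat_linear n n' \<gamma> \<longrightarrow>
          (q_corner n n' \<phi> \<psi> \<gamma> \<longleftrightarrow>
             (\<exists>X E \<kappa>. unitary_mat k X \<and> X * \<Omega> = \<Omega> * X \<and>
                contraction_mat (n - k) (n' - k) E \<and> (cmod \<kappa>)\<^sup>2 \<le> Re \<kappa> \<and>
                (\<forall>B \<in> carrier_mat k k. \<forall>W \<in> carrier_mat k (n' - k).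
                 \<forall>Q \<in> carrier_mat (n - k) k. \<forall>Y \<in> carrier_mat (n - k) (n' - k).
                   \<gamma> (four_block_mat B W Q Y) =
                     (\<kappa> * mat_trace (mat_adjoint X * B * \<Omega>)) \<cdot>\<^sub>m
                       four_block_mat X (0\<^sub>m k (n' - k)) (0\<^sub>m (n - k) k) E)))))"
proof -
  have \<phi>: "\<forall>A \<in> carrier_mat n n. \<phi> A = (\<Sum>i<k. complex_of_real (\<mu> i) * A $$ (i, i)) \<cdot>\<^sub>m 1\<^sub>m n"
    and \<psi>: "\<forall>D \<in> carrier_mat n' n'. \<psi> D = (\<Sum>i<k'. complex_of_real (r i) * D $$ (i, i)) \<cdot>\<^sub>m 1\<^sub>m n'"
    and \<rho>: "\<forall>A \<in> carrier_mat k k. \<rho> A = (\<Sum>i<k. complex_of_real (\<mu> i) * A $$ (i, i))"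
    using \<phi>_def \<psi>_def \<rho>_def by blast+
  have unital\<phi>: "unital n \<phi>"
  proof -
    have "(\<Sum>i<k. complex_of_real (\<mu> i) * (1\<^sub>m n :: complex mat) $$ (i, i)) = (\<Sum>i<k. complex_of_real (\<mu> i))"
      using n_ge by (intro sum.cong refl) simp
    also have "\<dots> = 1" using \<mu>_sum by (simp flip: of_real_sum)
    finally show ?thesis unfolding unital_def by (auto simp: \<phi>_def intro!: eq_matI)
  qed
  have unital\<psi>: "unital n' \<psi>"
  proof -
    have "(\<Sum>i<k'. complex_of_real (r i) * (1\<^sub>m n' :: complex mat) $$ (i, i)) = (\<Sum>i<k'. complex_of_real (r i))"
      using n'_ge by (intro sum.cong refl) simp
    also have "\<dots> = 1" using r_sum by (simp flip: of_real_sum)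
    finally show ?thesis unfolding unital_def by (auto simp: \<psi>_def intro!: eq_matI)
  qed
  have nonzero: "\<exists>Z \<kappa>. k = k' \<and> (\<forall>i<k. \<mu> i = r i) \<and> block_form n n' k k' Z 1 \<and> (cmod \<kappa>)\<^sup>2 \<le> Re \<kappa> \<and>
      (\<forall>i<k. \<forall>p<k. complex_of_real (\<mu> i) * Z i p = complex_of_real (\<mu> p) * Z i p) \<and>
      (\<forall>B \<in> carrier_mat n n'. \<gamma> B = mat n n' (\<lambda>(i, p).
         \<kappa> * (\<Sum>a<k. \<Sum>b<k. complex_of_real (\<mu> b) * cnj (Z a b) * B $$ (a, b)) * Z i p))"
    if "q_corner n n' \<phi> \<psi> \<gamma>" "B0 \<in> carrier_mat n n'" "\<gamma> B0 \<noteq> 0\<^sub>m n n'" for \<gamma> B0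
    by (rule q_corner_nonzero_form[OF that(1) \<phi> \<psi> \<mu>_pos \<mu>_sum r_pos r_sum \<mu>_decreasing r_decreasing
          n_ge n'_ge that(2,3)])
  have \<Omega>: "\<Omega> \<in> carrier_mat k k" using \<Omega>_def unfolding trace_density_def by blast
  have diag: "\<forall>i<k. \<forall>j<k. \<Omega> $$ (i, j) = (if i = j then complex_of_real (\<mu> i) else 0)"
    using trace_density_diag[OF \<Omega>_def \<rho>] by blast
  have char: "q_corner n n' \<phi> \<psi> \<gamma> \<longleftrightarrow>
             (\<exists>X E \<kappa>. unitary_mat k X \<and> X * \<Omega> = \<Omega> * X \<and>
                contraction_mat (n - k) (n' - k) E \<and> (cmod \<kappa>)\<^sup>2 \<le> Re \<kappa> \<and>
                (\<forall>B \<in> carrier_mat k k. \<forall>W \<in> carrier_mat k (n' - k).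
                 \<forall>Q \<in> carrier_mat (n - k) k. \<forall>Y \<in> carrier_mat (n - k) (n' - k).
                   \<gamma> (four_block_mat B W Q Y) =
                     (\<kappa> * mat_trace (mat_adjoint X * B * \<Omega>)) \<cdot>\<^sub>m
                       four_block_mat X (0\<^sub>m k (n' - k)) (0\<^sub>m (n - k) k) E))"
    (is "_ \<longleftrightarrow> (\<exists>X E \<kappa>. ?P X E \<kappa>)")
    if kk: "k = k'" and mr: "\<forall>i<k. \<mu> i = r i" and lin: "mat_linear n n' \<gamma>" for \<gamma>
  proof
    have kn: "k \<le> n" "k \<le> n'" using n_ge n'_ge kk by auto
    {
      assume qc: "q_corner n n' \<phi> \<psi> \<gamma>"
      show "\<exists>X E \<kappa>. ?P X E \<kappa>"
      proof (cases "\<exists>B0 \<in> carrier_mat n n'. \<gamma> B0 \<noteq> 0\<^sub>m n n'")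
        case True
        then obtain Z \<kappa> where Z: "block_form n n' k k Z 1" and \<kappa>: "(cmod \<kappa>)\<^sup>2 \<le> Re \<kappa>"
          and comm: "\<forall>i<k. \<forall>p<k. complex_of_real (\<mu> i) * Z i p = complex_of_real (\<mu> p) * Z i p"
          and \<gamma>: "\<forall>B \<in> carrier_mat n n'. \<gamma> B = mat n n' (\<lambda>(i, p).
             \<kappa> * (\<Sum>a<k. \<Sum>b<k. complex_of_real (\<mu> b) * cnj (Z a b) * B $$ (a, b)) * Z i p)"
          using nonzero[OF qc] kk by blast
        note bf = block_formD[OF Z]
        define X where "X = mat k k (\<lambda>(i, p). Z i p)"
        define E where "E = mat (n - k) (n' - k) (\<lambda>(i, p). Z (k + i) (k + p))"
        have X: "X \<in> carrier_mat k k" and Ec: "E \<in> carrier_mat (n - k) (n' - k)"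
          unfolding X_def E_def by auto
        have "unitary_mat k X"
        proof (rule unitary_matI[OF X])
          fix i j assume ij: "i < k" "j < k"
          have "(\<Sum>a<k. cnj (Z a i) * Z a j) = (if i = j then 1 else 0)"
          proof (cases "i = j")
            case True
            thus ?thesis using sum_mult_cnj_self[of "\<lambda>a. Z a j" k] bf(4)[OF ij(2)] by (simp add: mult.commute)
          next
            case False
            thus ?thesis using bf(6)[OF ij(2,1)] by (simp add: mult.commute)
          qed
          thus "(\<Sum>a<k. cnj (X $$ (a, i)) * X $$ (a, j)) = (if i = j then 1 else 0)"
            unfolding X_def using ij by simp
          have "(\<Sum>a<k. Z i a * cnj (Z j a)) = (if i = j then 1 else 0)"
            using sum_mult_cnj_self[of "Z j" k] bf(1)[OF ij(2)] bf(3)[OF ij] by auto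
          thus "(\<Sum>a<k. X $$ (i, a) * cnj (X $$ (j, a))) = (if i = j then 1 else 0)"
            unfolding X_def using ij by simp
        qed
        moreover have "X * \<Omega> = \<Omega> * X"
          unfolding commute_diag_iff[OF X \<Omega> diag] using comm by (simp add: X_def)
        moreover have "contraction_mat (n - k) (n' - k) E"
          unfolding contraction_mat_iff
        proof (intro conjI Ec allI)
          fix w :: "nat \<Rightarrow> complex"
          \<comment> \<open>Padding w with k leading zeros makes Z act through its block E on the
            last n - k rows; the first k rows can only increase the norm.\<close>
          define w' where "w' = (\<lambda>p. if p < k then 0 else w (p - k))"
          \<comment> \<open>The transpose is used because \<open>bil_bound_row\<close> bounds the
            action on rows, while \<open>contraction_mat_iff\<close> speaks of columns.\<close>
          have "(cmod (bil n' n (\<lambda>p i. Z i p) w v))\<^sup>2 \<le> 1 * nsq n' w * nsq n v" for v w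
            using bf(7)[of v w] unfolding bil_transpose[of n' n Z] by (simp add: mult.commute)
          from bil_bound_row[OF this, of w']
          have "nsq n (\<lambda>i. \<Sum>p<n'. w' p * Z i p) \<le> nsq n' w'" by simp
          moreover have "nsq n' w' = nsq (n' - k) w"
          proof -
            have "nsq n' w' = nsq (k + (n' - k)) w'" using kn by simp
            thus ?thesis unfolding nsq_split_add unfolding nsq_def w'_def by simp
          qed
          moreover have "nsq (n - k) (\<lambda>i. \<Sum>j<n' - k. E $$ (i, j) * w j) \<le> nsq n (\<lambda>i. \<Sum>p<n'. w' p * Z i p)"
          proof -
            have "(\<Sum>p<n'. w' p * Z (k + i) p) = (\<Sum>j<n' - k. E $$ (i, j) * w j)" if "i < n - k" for i
            proof -
              have "(\<Sum>p<n'. w' p * Z (k + i) p) = (\<Sum>p<k + (n' - k). w' p * Z (k + i) p)" using kn by simp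
              thus ?thesis unfolding sum_lessThan_split_add
                using that by (simp add: w'_def E_def mult.commute)
            qed
            hence "nsq (n - k) (\<lambda>i. \<Sum>j<n' - k. E $$ (i, j) * w j) = nsq (n - k) (\<lambda>i. \<Sum>p<n'. w' p * Z (k + i) p)"
              unfolding nsq_def by (intro sum.cong refl) simp
            also have "\<dots> \<le> nsq (k + (n - k)) (\<lambda>i. \<Sum>p<n'. w' p * Z i p)"
              unfolding nsq_split_add using nsq_nonneg by simp
            finally show ?thesis using kn by simp
          qed
          ultimately show "nsq (n - k) (\<lambda>i. \<Sum>j<n' - k. E $$ (i, j) * w j) \<le> nsq (n' - k) w" by simp
        qed
        \<comment> \<open>The off-diagonal blocks of Z vanish by the two support clauses of
          \<open>block_form\<close>.\<close>
        moreover have "Z i p = four_block_mat X (0\<^sub>m k (n' - k)) (0\<^sub>m (n - k) k) E $$ (i, p)"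
          if "i < n" "p < n'" for i p
          using that kn X Ec bf(2)[of i p] bf(5)[of p i] by (auto simp: X_def E_def)
        ultimately show ?thesis
          using \<kappa> \<gamma> block_diag_formula_iff[where Z = Z and \<gamma> = \<gamma> and \<kappa> = \<kappa>, OF kn X Ec \<Omega> diag] by blast
      next
        case False
        \<comment> \<open>The zero map is the case \<kappa> = 0, where any admissible X and E will
          do.\<close>
        have "?P (1\<^sub>m k) (0\<^sub>m (n - k) (n' - k)) 0"
        proof (intro conjI ballI)
          show "unitary_mat k (1\<^sub>m k)"
            by (rule unitary_matI) (auto simp: if_distrib[of cnj] if_distrib[of "\<lambda>x. x * _"] cong: if_cong)
          show "1\<^sub>m k * \<Omega> = \<Omega> * 1\<^sub>m k" using \<Omega> by simp
          show "contraction_mat (n - k) (n' - k) (0\<^sub>m (n - k) (n' - k))"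
            unfolding contraction_mat_iff using nsq_nonneg by (auto simp: nsq_def)
          show "(cmod 0)\<^sup>2 \<le> Re 0" by simp
          fix B W Q Y :: "complex mat"
          assume B: "B \<in> carrier_mat k k" and Y: "Y \<in> carrier_mat (n - k) (n' - k)"
          have "four_block_mat B W Q Y \<in> carrier_mat n n'" using four_block_carrier_mat[OF B Y] kn by simp
          hence "\<gamma> (four_block_mat B W Q Y) = 0\<^sub>m n n'" using False by blast
          thus "\<gamma> (four_block_mat B W Q Y) = (0 * mat_trace (mat_adjoint (1\<^sub>m k) * B * \<Omega>)) \<cdot>\<^sub>m
              four_block_mat (1\<^sub>m k) (0\<^sub>m k (n' - k)) (0\<^sub>m (n - k) k) (0\<^sub>m (n - k) (n' - k))"
            using kn by (intro eq_matI) auto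
        qed
        thus ?thesis by blast
      qed
    next
      assume "\<exists>X E \<kappa>. ?P X E \<kappa>"
      then obtain X E \<kappa> where P: "?P X E \<kappa>" by blast
      define Z where "Z = (\<lambda>i p. four_block_mat X (0\<^sub>m k (n' - k)) (0\<^sub>m (n - k) k) E $$ (i, p))"
      have X: "X \<in> carrier_mat k k" and Ec: "E \<in> carrier_mat (n - k) (n' - k)"
        using P unfolding unitary_mat_def contraction_mat_def by auto
      have \<psi>': "\<forall>D \<in> carrier_mat n' n'. \<psi> D = (\<Sum>i<k. complex_of_real (\<mu> i) * D $$ (i, i)) \<cdot>\<^sub>m 1\<^sub>m n'"
        using \<psi> mr kk by simp
      have comm: "\<forall>i<k. \<forall>p<k. complex_of_real (\<mu> i) * X $$ (i, p) = complex_of_real (\<mu> p) * X $$ (i, p)"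
        using P commute_diag_iff[OF X \<Omega> diag] by blast
      have "\<forall>M \<in> carrier_mat n n'. \<gamma> M = mat n n' (\<lambda>(i, p).
          \<kappa> * (\<Sum>a<k. \<Sum>b<k. complex_of_real (\<mu> b) * cnj (Z a b) * M $$ (a, b)) * Z i p)"
        by (rule iffD1[OF block_diag_formula_iff[where Z = Z and \<gamma> = \<gamma> and \<kappa> = \<kappa>, OF kn X Ec \<Omega> diag]
              P[THEN conjunct2, THEN conjunct2, THEN conjunct2, THEN conjunct2]]) (simp add: Z_def)
      with P comm show "q_corner n n' \<phi> \<psi> \<gamma>"
        by (intro block_diag_q_corner[where X = X and E = E and Z = Z and \<kappa> = \<kappa> and k = k and \<mu> = \<mu>,
              OF \<mu>_pos \<mu>_sum kn \<phi> \<psi>' _ _ comm _ _ lin]) (simp_all add: Z_def)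
    }
  qed
  have eq: "(\<exists>\<gamma>. q_corner n n' \<phi> \<psi> \<gamma> \<and> (\<exists>B \<in> carrier_mat n n'. \<gamma> B \<noteq> 0\<^sub>m n n'))
      \<longrightarrow> k = k' \<and> (\<forall>i<k. \<mu> i = r i)"
  proof
    assume "\<exists>\<gamma>. q_corner n n' \<phi> \<psi> \<gamma> \<and> (\<exists>B \<in> carrier_mat n n'. \<gamma> B \<noteq> 0\<^sub>m n n')"
    then obtain \<gamma> B where "q_corner n n' \<phi> \<psi> \<gamma>" "B \<in> carrier_mat n n'" "\<gamma> B \<noteq> 0\<^sub>m n n'"
      by blast
    from nonzero[OF this] show "k = k' \<and> (\<forall>i<k. \<mu> i = r i)" by (elim exE conjE) (rule conjI)
  qed
  have q: "q_positive n \<phi>" "q_positive n' \<psi>" "faithful_state k \<rho>"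
    by (rule q_positive_scalar_state[OF \<mu>_pos \<mu>_sum n_ge \<phi>], assumption,
        rule q_positive_scalar_state[OF r_pos r_sum n'_ge \<psi>], assumption,
        rule diag_state_faithful[OF \<mu>_pos \<mu>_sum \<rho>])
  show ?thesis
    by (rule conjI[OF unital\<phi> conjI[OF q(1) conjI[OF unital\<psi> conjI[OF q(2) conjI[OF q(3) conjI[OF eq]]]]]])
      (intro impI allI, elim conjE, rule char)
qed

end
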